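(* Let $V$ be a finite-dimensional real vector space with the involution $\tau=-\mathrm{id}_V$, and let $\Omega\subseteq V$ be an open convex cone not containing affine lines. Then any $1$-bounded positive definite distribution $D\in\mathcal D'(\Omega)$ is represented by an analytic function on $\Omega$, also denoted $D$, and there exists a unique positive Radon measure $\mu$ on the dual cone $\Omega^\star$ with $$D(x)=\mathcal L(\mu)(x)=\int_{\Omega^\star}e^{-\alpha(x)}\,d\mu(\alpha)\quad\text{for all }x\in\Omega.$$
   Context: $\Omega^\star:=\{\alpha\in V^*:\alpha(x)\ge0\text{ for all }x\in\Omega\}$. $\mathcal D(\Omega)=C_c^\infty(\Omega,\mathbb C)$ with its LF topology, and $\mathcal D'(\Omega)$ is the space of continuous antilinear functionals on it; $D$ is represented by a function $f$ if $D(\varphi)=\int_\Omega\overline{\varphi(x)}f(x)\,dx$ for all $\varphi$ ($dx$ a fixed Lebesgue measure on $V$). $\mathcal D(\Omega)$ is a $*$-algebra under convolution and, since $\tau=-\mathrm{id}_V$ means that the involution $x^\sharp=-\tau(x)=x$ on $\Omega$ is trivial, $\varphi^\sharp(x)=\overline{\varphi(x)}$. $D$ is positive definite if $D(\varphi^\sharp*\varphi)\ge0$ for all $\varphi\in\mathcal D(\Omega)$, and $1$-bounded if $|D(\varphi*\psi*\varphi^\sharp)|\le\|\psi\|_1\,D(\varphi*\varphi^\sharp)$ for all $\varphi,\psi\in\mathcal D(\Omega)$, where $\|\psi\|_1=\int_\Omega|\psi(x)|\,dx$. *)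

theory Defs
  imports "HOL-Analysis.Analysis"
begin

text \<open>Throughout, the finite-dimensional space V is a type of class euclidean_space, its dual
  is the type of (bounded) linear functionals on it, and dx is lborel. A function on an open set is
  represented by a function on all of V; elements of \<open>C_c^\<infinity>(\<Omega>)\<close> are extended by zero.\<close>

section \<open>Cones\<close>

text \<open>The library's \<open>cone\<close> is closed under multiplication with 0, hence not usable for open cones.\<close>

definition open_convex_cone :: "'a::euclidean_space set \<Rightarrow> bool" where
  "open_convex_cone \<Omega> \<longleftrightarrow>
     \<Omega> \<noteq> {} \<and> open \<Omega> \<and> convex \<Omega> \<and> (\<forall>x\<in>\<Omega>. \<forall>c>0. c *\<^sub>R x \<in> \<Omega>)"

definition contains_affine_line :: "'a::real_vector set \<Rightarrow> bool" where
  "contains_affine_line S \<longleftrightarrow> (\<exists>x v. v \<noteq> 0 \<and> range (\<lambda>t::real. x + t *\<^sub>R v) \<subseteq> S)"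

definition dual_cone :: "'a::euclidean_space set \<Rightarrow> ('a \<Rightarrow>\<^sub>L real) set" where
  "dual_cone \<Omega> = {\<alpha>. \<forall>x\<in>\<Omega>. 0 \<le> blinfun_apply \<alpha> x}"


section \<open>Test functions and distributions\<close>

fun iter_deriv :: "'a::euclidean_space list \<Rightarrow> ('a \<Rightarrow> complex) \<Rightarrow> 'a \<Rightarrow> complex" where
  "iter_deriv [] f = f"
| "iter_deriv (v # vs) f = (\<lambda>x. frechet_derivative (iter_deriv vs f) (at x) v)"

definition smooth :: "('a::euclidean_space \<Rightarrow> complex) \<Rightarrow> bool" where
  "smooth f \<longleftrightarrow> (\<forall>vs x. iter_deriv vs f differentiable (at x))"

definition supp :: "('a::euclidean_space \<Rightarrow> complex) \<Rightarrow> 'a set" where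
  "supp f = closure {x. f x \<noteq> 0}"

definition test_functions :: "'a::euclidean_space set \<Rightarrow> ('a \<Rightarrow> complex) set" where
  "test_functions \<Omega> = {\<phi>. smooth \<phi> \<and> compact (supp \<phi>) \<and> supp \<phi> \<subseteq> \<Omega>}"

text \<open>The basic neighbourhoods of 0 in the Frechet space \<open>\<D>\<^sub>K\<close> of smooth functions supported in the
  compact set K.\<close>

definition frechet_nhd :: "'a::euclidean_space set \<Rightarrow> nat \<Rightarrow> real \<Rightarrow> ('a \<Rightarrow> complex) set" where
  "frechet_nhd K m \<epsilon> =
     {\<phi>. smooth \<phi> \<and> supp \<phi> \<subseteq> K \<and>
         (\<forall>vs x. set vs \<subseteq> Basis \<and> length vs \<le> m \<longrightarrow> cmod (iter_deriv vs \<phi> x) < \<epsilon>)}"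

text \<open>The LF topology is the locally convex inductive limit of the spaces \<open>\<D>\<^sub>K\<close>: a base at 0 is given
  by the absolutely convex sets whose intersection with each \<open>\<D>\<^sub>K\<close> is a neighbourhood of 0
  (such sets are automatically absorbing).\<close>

definition lf_nhd :: "'a::euclidean_space set \<Rightarrow> ('a \<Rightarrow> complex) set \<Rightarrow> bool" where
  "lf_nhd \<Omega> W \<longleftrightarrow>
     W \<subseteq> test_functions \<Omega> \<and>
     (\<forall>\<phi>\<in>W. \<forall>\<psi>\<in>W. \<forall>a b. cmod a + cmod b \<le> 1 \<longrightarrow> (\<lambda>x. a * \<phi> x + b * \<psi> x) \<in> W) \<and>
     (\<forall>K. compact K \<and> K \<subseteq> \<Omega> \<longrightarrow> (\<exists>m. \<exists>\<epsilon>>0. frechet_nhd K m \<epsilon> \<subseteq> W))"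

definition lf_topology :: "'a::euclidean_space set \<Rightarrow> ('a \<Rightarrow> complex) topology" where
  "lf_topology \<Omega> = topology (\<lambda>U. U \<subseteq> test_functions \<Omega> \<and>
     (\<forall>\<phi>\<in>U. \<exists>W. lf_nhd \<Omega> W \<and> (\<forall>\<psi>\<in>W. (\<lambda>x. \<phi> x + \<psi> x) \<in> U)))"

definition distribution ::
  "'a::euclidean_space set \<Rightarrow> (('a \<Rightarrow> complex) \<Rightarrow> complex) \<Rightarrow> bool" where
  "distribution \<Omega> D \<longleftrightarrow>
     (\<forall>\<phi>\<in>test_functions \<Omega>. \<forall>\<psi>\<in>test_functions \<Omega>. D (\<lambda>x. \<phi> x + \<psi> x) = D \<phi> + D \<psi>) \<and>
     (\<forall>c. \<forall>\<phi>\<in>test_functions \<Omega>. D (\<lambda>x. c * \<phi> x) = cnj c * D \<phi>) \<and>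
     continuous_map (lf_topology \<Omega>) euclidean D"

definition represented_by ::
  "'a::euclidean_space set \<Rightarrow> (('a \<Rightarrow> complex) \<Rightarrow> complex) \<Rightarrow> ('a \<Rightarrow> complex) \<Rightarrow> bool" where
  "represented_by \<Omega> D f \<longleftrightarrow>
     (\<forall>\<phi>\<in>test_functions \<Omega>.
        set_integrable lborel \<Omega> (\<lambda>x. cnj (\<phi> x) * f x) \<and>
        D \<phi> = (LINT x:\<Omega>|lborel. cnj (\<phi> x) * f x))"


section \<open>The convolution algebra\<close>

definition convolution ::
  "('a::euclidean_space \<Rightarrow> complex) \<Rightarrow> ('a \<Rightarrow> complex) \<Rightarrow> 'a \<Rightarrow> complex" where
  "convolution \<phi> \<psi> x = (LINT y|lborel. \<phi> y * \<psi> (x - y))"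

definition sharp :: "('a::euclidean_space \<Rightarrow> 'a) \<Rightarrow> ('a \<Rightarrow> complex) \<Rightarrow> 'a \<Rightarrow> complex" where
  "sharp \<tau> \<phi> x = cnj (\<phi> (- \<tau> x))"

definition positive_definite ::
  "('a::euclidean_space \<Rightarrow> 'a) \<Rightarrow> 'a set \<Rightarrow> (('a \<Rightarrow> complex) \<Rightarrow> complex) \<Rightarrow> bool" where
  "positive_definite \<tau> \<Omega> D \<longleftrightarrow>
     (\<forall>\<phi>\<in>test_functions \<Omega>. D (convolution (sharp \<tau> \<phi>) \<phi>) \<in> \<real>\<^sub>\<ge>\<^sub>0)"

text \<open>For positive definite D the number \<open>D (\<phi> * \<phi>\<^sup>\<sharp>)\<close> is real and nonnegative.\<close>

definition one_bounded ::
  "('a::euclidean_space \<Rightarrow> 'a) \<Rightarrow> 'a set \<Rightarrow> (('a \<Rightarrow> complex) \<Rightarrow> complex) \<Rightarrow> bool" where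
  "one_bounded \<tau> \<Omega> D \<longleftrightarrow>
     (\<forall>\<phi>\<in>test_functions \<Omega>. \<forall>\<psi>\<in>test_functions \<Omega>.
        cmod (D (convolution (convolution \<phi> \<psi>) (sharp \<tau> \<phi>)))
          \<le> (LINT x:\<Omega>|lborel. cmod (\<psi> x)) * Re (D (convolution \<phi> (sharp \<tau> \<phi>))))"


section \<open>Real analytic functions\<close>

text \<open>Local expansion into an absolutely convergent power series in the coordinates; the
  multi-indices are the functions from Basis to nat.\<close>

definition real_analytic_on :: "('a::euclidean_space \<Rightarrow> complex) \<Rightarrow> 'a set \<Rightarrow> bool" where
  "real_analytic_on f S \<longleftrightarrow>
     (\<forall>a\<in>S. \<exists>r>0. \<exists>c. ball a r \<subseteq> S \<and> (\<forall>x\<in>ball a r.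
        ((\<lambda>k. c k * (\<Prod>b\<in>Basis. of_real ((x - a) \<bullet> b) ^ k b)) has_sum f x)
          (Basis \<rightarrow>\<^sub>E (UNIV :: nat set))))"


section \<open>Radon measures\<close>

text \<open>A positive Radon measure on a (locally compact) subspace A: a Borel measure that is
  finite on compact sets and inner regular.\<close>

definition radon_measure_on :: "'b::t2_space set \<Rightarrow> 'b measure \<Rightarrow> bool" where
  "radon_measure_on A \<mu> \<longleftrightarrow>
     sets \<mu> = sets (restrict_space borel A) \<and>
     (\<forall>K. compact K \<and> K \<subseteq> A \<longrightarrow> emeasure \<mu> K < \<infinity>) \<and>
     (\<forall>B\<in>sets \<mu>. emeasure \<mu> B = (SUP K\<in>{K. compact K \<and> K \<subseteq> B}. emeasure \<mu> K))"


section \<open>Well-definedness of the LF topology\<close>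

lemma lf_nhd_Int:
  assumes "lf_nhd \<Omega> V" "lf_nhd \<Omega> W"
  shows "lf_nhd \<Omega> (V \<inter> W)"
proof -
  have "\<exists>m. \<exists>\<epsilon>>0. frechet_nhd K m \<epsilon> \<subseteq> V \<inter> W" if K: "compact K" "K \<subseteq> \<Omega>" for K
  proof -
    obtain m \<epsilon> where 1: "\<epsilon> > 0" "frechet_nhd K m \<epsilon> \<subseteq> V"
      using assms(1) K unfolding lf_nhd_def by blast
    obtain n \<delta> where 2: "\<delta> > 0" "frechet_nhd K n \<delta> \<subseteq> W"
      using assms(2) K unfolding lf_nhd_def by blast
    have "frechet_nhd K (max m n) (min \<epsilon> \<delta>) \<subseteq> frechet_nhd K m \<epsilon> \<inter> frechet_nhd K n \<delta>"
      by (auto simp: frechet_nhd_def)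
    then show ?thesis
      using 1 2 by (intro exI[of _ "max m n"] exI[of _ "min \<epsilon> \<delta>"]) auto
  qed
  moreover have "V \<inter> W \<subseteq> test_functions \<Omega>"
    using assms(1) unfolding lf_nhd_def by blast
  moreover have "(\<lambda>x. a * \<phi> x + b * \<psi> x) \<in> V \<inter> W"
    if "\<phi> \<in> V \<inter> W" "\<psi> \<in> V \<inter> W" "cmod a + cmod b \<le> 1" for \<phi> \<psi> a b
    using assms that unfolding lf_nhd_def by simp
  ultimately show ?thesis
    unfolding lf_nhd_def by simp
qed

lemma openin_lf_topology:
  "openin (lf_topology \<Omega>) U \<longleftrightarrow> U \<subseteq> test_functions \<Omega> \<and>
     (\<forall>\<phi>\<in>U. \<exists>W. lf_nhd \<Omega> W \<and> (\<forall>\<psi>\<in>W. (\<lambda>x. \<phi> x + \<psi> x) \<in> U))"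
proof -
  let ?P = "\<lambda>U. U \<subseteq> test_functions \<Omega> \<and>
     (\<forall>\<phi>\<in>U. \<exists>W. lf_nhd \<Omega> W \<and> (\<forall>\<psi>\<in>W. (\<lambda>x. \<phi> x + \<psi> x) \<in> U))"
  have "?P (S \<inter> T)" if "?P S" "?P T" for S T
  proof (intro conjI ballI)
    show "S \<inter> T \<subseteq> test_functions \<Omega>" using that by blast
    fix \<phi> assume "\<phi> \<in> S \<inter> T"
    then obtain V W where "lf_nhd \<Omega> V" "\<forall>\<psi>\<in>V. (\<lambda>x. \<phi> x + \<psi> x) \<in> S"
      "lf_nhd \<Omega> W" "\<forall>\<psi>\<in>W. (\<lambda>x. \<phi> x + \<psi> x) \<in> T"
      using \<open>?P S\<close> \<open>?P T\<close> by blast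
    then show "\<exists>W. lf_nhd \<Omega> W \<and> (\<forall>\<psi>\<in>W. (\<lambda>x. \<phi> x + \<psi> x) \<in> S \<inter> T)"
      using lf_nhd_Int[of \<Omega> V W] by blast
  qed
  moreover have "?P (\<Union>\<K>)" if asm: "\<forall>S\<in>\<K>. ?P S" for \<K>
  proof (intro conjI ballI)
    show "\<Union>\<K> \<subseteq> test_functions \<Omega>" using that by blast
    fix \<phi> assume "\<phi> \<in> \<Union>\<K>"
    then obtain S where S: "S \<in> \<K>" "\<phi> \<in> S" by blast
    then obtain W where "lf_nhd \<Omega> W" "\<forall>\<psi>\<in>W. (\<lambda>x. \<phi> x + \<psi> x) \<in> S"
      using asm by blast
    then show "\<exists>W. lf_nhd \<Omega> W \<and> (\<forall>\<psi>\<in>W. (\<lambda>x. \<phi> x + \<psi> x) \<in> \<Union>\<K>)"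
      using S by blast
  qed
  ultimately have "istopology ?P"
    unfolding istopology_def by presburger
  from topology_inverse'[OF this] show ?thesis
    unfolding lf_topology_def by (rule fun_cong)
qed

lemma iter_deriv_lincomb:
  assumes "smooth f" "smooth g"
  shows "iter_deriv vs (\<lambda>x. a * f x + b * g x) = (\<lambda>x. a * iter_deriv vs f x + b * iter_deriv vs g x)"
proof (induction vs)
  case (Cons v vs)
  have "((\<lambda>x. a * iter_deriv vs f x + b * iter_deriv vs g x) has_derivative
      (\<lambda>h. a * frechet_derivative (iter_deriv vs f) (at x) h
         + b * frechet_derivative (iter_deriv vs g) (at x) h)) (at x)" for x
    using assms unfolding smooth_def
    by (intro has_derivative_add has_derivative_mult_right) (auto simp: frechet_derivative_works)
  from frechet_derivative_at[OF this] show ?case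
    by (simp add: Cons.IH fun_eq_iff)
qed simp

lemma smooth_lincomb:
  assumes "smooth f" "smooth g"
  shows "smooth (\<lambda>x. a * f x + b * g x)"
  using assms unfolding smooth_def
  by (auto simp: iter_deriv_lincomb[OF assms] intro!: differentiable_add differentiable_mult)

lemma test_functions_lincomb:
  assumes "\<phi> \<in> test_functions \<Omega>" "\<psi> \<in> test_functions \<Omega>"
  shows "(\<lambda>x. a * \<phi> x + b * \<psi> x) \<in> test_functions \<Omega>"
proof -
  have "{x. a * \<phi> x + b * \<psi> x \<noteq> 0} \<subseteq> {x. \<phi> x \<noteq> 0} \<union> {x. \<psi> x \<noteq> 0}" by auto
  then have *: "supp (\<lambda>x. a * \<phi> x + b * \<psi> x) \<subseteq> supp \<phi> \<union> supp \<psi>"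
    unfolding supp_def closure_Un[symmetric] by (rule closure_mono)
  moreover have "closed (supp (\<lambda>x. a * \<phi> x + b * \<psi> x))" by (simp add: supp_def)
  moreover have "compact (supp \<phi> \<union> supp \<psi>)"
    using assms by (auto simp: test_functions_def)
  ultimately have "compact (supp (\<lambda>x. a * \<phi> x + b * \<psi> x))"
    using closed_Int_compact[of "supp (\<lambda>x. a * \<phi> x + b * \<psi> x)" "supp \<phi> \<union> supp \<psi>"]
    by (simp only: inf.absorb1)
  then show ?thesis
    using assms * smooth_lincomb[of \<phi> \<psi> a b] unfolding test_functions_def by blast
qed

lemma lf_nhd_test_functions: "lf_nhd \<Omega> (test_functions \<Omega>)"
  unfolding lf_nhd_def
proof (intro conjI ballI allI impI)
  fix K assume K: "compact K \<and> K \<subseteq> \<Omega>"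
  have "compact (supp \<phi>)" if "supp \<phi> \<subseteq> K" for \<phi>
    using K that by (metis closed_closure compact_Int_closed inf.absorb_iff2 supp_def)
  then have "frechet_nhd K 0 1 \<subseteq> test_functions \<Omega>"
    using K by (auto simp: frechet_nhd_def test_functions_def)
  then show "\<exists>m. \<exists>\<epsilon>>0. frechet_nhd K m \<epsilon> \<subseteq> test_functions \<Omega>"
    by (intro exI[of _ 0] exI[of _ 1]) simp
qed (auto intro: test_functions_lincomb)

lemma topspace_lf_topology: "topspace (lf_topology \<Omega>) = test_functions \<Omega>"
proof
  show "topspace (lf_topology \<Omega>) \<subseteq> test_functions \<Omega>"
    using openin_topspace[of "lf_topology \<Omega>"] unfolding openin_lf_topology by (rule conjunct1)
  have "(\<lambda>x. \<phi> x + \<psi> x) \<in> test_functions \<Omega>"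
    if "\<phi> \<in> test_functions \<Omega>" "\<psi> \<in> test_functions \<Omega>" for \<phi> \<psi>
    using test_functions_lincomb[OF that, of 1 1] by simp
  then have "openin (lf_topology \<Omega>) (test_functions \<Omega>)"
    unfolding openin_lf_topology using lf_nhd_test_functions[of \<Omega>] by (intro conjI ballI exI) simp_all
  then show "test_functions \<Omega> \<subseteq> topspace (lf_topology \<Omega>)"
    by (rule openin_subset)
qed

end

theory Submission
  imports Defs "HOL-Probability.Helly_Selection"
begin

text \<open>For a real test function \<open>r\<close> let \<open>h = r * r\<close>. The function \<open>g x = D (h (\<cdot> - x))\<close> on the
  semigroup \<open>S = \<Omega> \<union> {0}\<close> is continuous and positive definite, and 1-boundedness, applied with
  \<open>\<psi>\<close> tending to the point mass at x, gives \<open>\<bar>g x\<bar> \<le> g 0\<close>. On the class of bounded positive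
  definite functions the translations \<open>E\<^sub>a\<close> satisfy \<open>0 \<le> E\<^sub>a \<le> I\<close>, so the Bernstein polynomials of
  \<open>E\<^sub>a\<close> split g into pieces which are nearly eigenvectors of \<open>E\<^sub>a\<close>. Iterating over finitely many a
  approximates g by finite mixtures of functions that are nearly characters with values in [0, 1];
  a weak limit of the mixing measures on the Hilbert cube (obtained on the real line by Helly
  selection, through a space filling curve) is carried by true characters \<open>exp (- \<alpha>)\<close> with \<open>\<alpha>\<close> in
  the dual cone. Hence \<open>g = \<L> M\<^sub>r\<close> for a finite measure \<open>M\<^sub>r\<close>.

  The measures \<open>(\<L> r)\<^sup>-\<^sup>2 M\<^sub>r\<close> do not depend on r, because convolution is commutative and Laplace
  transforms determine measures. Their common value \<open>\<mu>\<close> satisfies \<open>D = \<L> \<mu>\<close>, as one sees by letting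
  r run through an approximate identity.\<close>

section \<open>Bounded positive definite functions on a cone\<close>

text \<open>\<open>D\<close> has no value at 0, and \<open>\<mu>\<close> is infinite in general, so
  nothing bounded is at hand. Smearing by \<open>r * r\<close> with \<open>r\<close> real repairs
  both. The involution fixes real functions, so the form of \<open>g\<close> is \<open>D\<close> of
  the square of a combination of translates of \<open>r\<close>; on the other side
  \<open>\<mu>\<close> acquires the density \<open>(\<L> r)\<^sup>2\<close>, which makes it finite.
  Since \<open>\<L> r > 0\<close> everywhere, this density can be divided out again.

  The inequality \<open>E\<^sub>a \<le> I\<close> rests on boundedness: for fixed points and
  coefficients the form of \<open>g\<close>, shifted by z, is itself bounded and positive definite
  in z, hence largest at z = 0. The pieces of order N behave like a binomial law: piece k carries
  the value k / N, and the variance is of order 1 / N.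

  The limit is controlled through moments of coordinates in [0, 1]. As the curve is continuous and
  onto, finite mixtures on the cube lift to [0, 1], and the moments become integrals of bounded
  continuous functions there. Countably many coordinates suffice: the characters are found on
  rational points, and continuity of \<open>g\<close> does the rest.\<close>

definition pd_on :: "'a::real_vector set \<Rightarrow> ('a \<Rightarrow> real) \<Rightarrow> bool" where
  "pd_on S g \<longleftrightarrow>
     (\<forall>xs. set (map snd xs) \<subseteq> S \<longrightarrow> 0 \<le> (\<Sum>(c, x)\<leftarrow>xs. \<Sum>(d, y)\<leftarrow>xs. c * d * g (x + y))) \<and>
     (\<exists>M. \<forall>x\<in>S. g x \<le> M)"

lemma sum_list_swap:
  fixes f :: "'b \<Rightarrow> 'c \<Rightarrow> 'd::comm_monoid_add"
  shows "(\<Sum>x\<leftarrow>xs. \<Sum>y\<leftarrow>ys. f x y) = (\<Sum>y\<leftarrow>ys. \<Sum>x\<leftarrow>xs. f x y)"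
  by (induction xs) (simp_all add: sum_list_addf)

lemma sum_list_product_map:
  fixes k :: "'b \<Rightarrow> 'd::comm_monoid_add"
  shows "(\<Sum>z\<leftarrow>map h (List.product xs ys). k z) = (\<Sum>x\<leftarrow>xs. \<Sum>y\<leftarrow>ys. k (h (x, y)))"
  by (induction xs) (simp_all add: o_def)

text \<open>Halving replaces square roots: \<open>g x\<close> is the form at the single point x / 2,
  and a shift by a is a shift of both points by a / 2. The instances are
  \<open>insert 0 \<Omega>\<close>; the unit 0 is added by hand to an open cone.\<close>

locale halvable_cone =
  fixes S :: "'a::real_vector set"
  assumes zero_in: "0 \<in> S"
    and add_in: "x \<in> S \<Longrightarrow> y \<in> S \<Longrightarrow> x + y \<in> S"
    and half_in: "x \<in> S \<Longrightarrow> (1/2) *\<^sub>R x \<in> S"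
begin

lemma pd_onD:
  assumes "pd_on S g" "set (map snd xs) \<subseteq> S"
  shows "0 \<le> (\<Sum>(c, x)\<leftarrow>xs. \<Sum>(d, y)\<leftarrow>xs. c * d * g (x + y))"
  using assms unfolding pd_on_def by blast

lemma half_add: "(1/2) *\<^sub>R x + (1/2) *\<^sub>R x = (x::'a)"
  by (simp flip: scaleR_left_distrib)

lemma pd_on_nonneg:
  assumes "pd_on S g" "x \<in> S"
  shows "0 \<le> g x"
  using pd_onD[OF assms(1), of "[(1, (1/2) *\<^sub>R x)]"] assms half_in half_add by simp

lemma pd_on_shift:
  assumes g: "pd_on S g" and a: "a \<in> S"
  shows "pd_on S (\<lambda>x. g (x + a))"
  unfolding pd_on_def
proof (intro conjI allI impI)
  fix xs :: "(real \<times> 'a) list" assume xs: "set (map snd xs) \<subseteq> S"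
  define h where "h = (\<lambda>(c::real, x). (c, x + (1/2) *\<^sub>R a))"
  have "set (map snd (map h xs)) \<subseteq> S"
    using xs a add_in half_in by (auto simp: h_def)
  from pd_onD[OF g this]
  have "0 \<le> (\<Sum>(c, x)\<leftarrow>xs. \<Sum>(d, y)\<leftarrow>xs. c * d * g ((x + (1/2) *\<^sub>R a) + (y + (1/2) *\<^sub>R a)))"
    by (simp add: h_def case_prod_unfold o_def)
  moreover have "(x + (1/2) *\<^sub>R a) + (y + (1/2) *\<^sub>R a) = x + y + a" for x y
    using half_add[of a] by (simp add: algebra_simps)
  ultimately show "0 \<le> (\<Sum>(c, x)\<leftarrow>xs. \<Sum>(d, y)\<leftarrow>xs. c * d * g (x + y + a))"
    by (simp only:)
next
  show "\<exists>M. \<forall>x\<in>S. g (x + a) \<le> M"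
    using g a add_in unfolding pd_on_def by blast
qed

lemma pd_on_add:
  assumes f: "pd_on S f" and g: "pd_on S g"
  shows "pd_on S (\<lambda>x. f x + g x)"
  unfolding pd_on_def
proof (intro conjI allI impI)
  fix xs :: "(real \<times> 'a) list" assume xs: "set (map snd xs) \<subseteq> S"
  show "0 \<le> (\<Sum>(c, x)\<leftarrow>xs. \<Sum>(d, y)\<leftarrow>xs. c * d * (f (x + y) + g (x + y)))"
    using pd_onD[OF f xs] pd_onD[OF g xs]
    by (simp add: distrib_left case_prod_unfold sum_list_addf)
next
  obtain M N where "\<forall>x\<in>S. f x \<le> M" "\<forall>x\<in>S. g x \<le> N"
    using f g unfolding pd_on_def by blast
  then show "\<exists>M. \<forall>x\<in>S. f x + g x \<le> M"
    by (intro exI[of _ "M + N"]) (auto intro: add_mono)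
qed

lemma pd_on_zero: "pd_on S (\<lambda>x. 0)"
  by (auto simp: pd_on_def case_prod_unfold sum_list_nonneg)

text \<open>If \<open>g y > g 0\<close>, then \<open>g y ^ 2 \<le> g 0 * g (2 y)\<close> makes the values of g along
  \<open>y, 2 y, 4 y, \<dots>\<close> grow beyond every bound.\<close>

lemma pd_on_le_zero:
  assumes g: "pd_on S g" and y: "y \<in> S"
  shows "g y \<le> g 0"
proof (rule ccontr)
  assume "\<not> g y \<le> g 0"
  then have gt: "g y > g 0" by simp
  have cs: "(g z)\<^sup>2 \<le> g 0 * g (2 *\<^sub>R z)" if z: "z \<in> S" for z
  proof -
    have q: "0 \<le> c * c * g 0 + 2 * c * g z + g (2 *\<^sub>R z)" for c
      using pd_onD[OF g, of "[(c, 0), (1, z)]"] z zero_in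
      by (simp add: algebra_simps scaleR_2)
    show ?thesis
    proof (cases "g 0 = 0")
      case True
      have "g z = 0"
      proof (rule ccontr)
        assume nz: "g z \<noteq> 0"
        \<comment> \<open>At \<open>g 0 = 0\<close> the form is affine in the coefficient; this
          coefficient would give it the value -1.\<close>
        have "2 * (- (g (2 *\<^sub>R z) + 1) / (2 * g z)) * g z = - (g (2 *\<^sub>R z) + 1)"
          using nz by simp
        then show False using q[of "- (g (2 *\<^sub>R z) + 1) / (2 * g z)"] True by simp
      qed
      then show ?thesis using True by simp
    next
      case False
      then have p: "g 0 > 0" using pd_on_nonneg[OF g zero_in] by simp
      \<comment> \<open>The coefficient \<open>- g z / g 0\<close> minimises the quadratic
        polynomial in \<open>q\<close>.\<close>
      have "0 \<le> g 0 * ((- g z / g 0) * (- g z / g 0) * g 0 + 2 * (- g z / g 0) * g z + g (2 *\<^sub>R z))"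
        by (rule mult_nonneg_nonneg[OF less_imp_le[OF p] q])
      also have "\<dots> = g 0 * g (2 *\<^sub>R z) - (g z)\<^sup>2"
        using p by (simp add: field_simps power2_eq_square)
      finally show ?thesis by simp
    qed
  qed
  have dbl: "2 *\<^sub>R z \<in> S" if "z \<in> S" for z
    using add_in[OF that that] by (simp add: scaleR_2)
  have pos: "g 0 > 0"
  proof -
    have "(g y)\<^sup>2 > 0" using gt pd_on_nonneg[OF g zero_in] by simp
    then show ?thesis using cs[OF y] pd_on_nonneg[OF g zero_in] by (cases "g 0 = 0") auto
  qed
  define r where "r = g y / g 0"
  have r: "r > 1" using gt pos by (simp add: r_def)
  have pw: "(2 ^ k) *\<^sub>R y \<in> S \<and> g ((2 ^ k) *\<^sub>R y) \<ge> g 0 * r ^ (2 ^ k)" for k :: nat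
  proof (induction k)
    case 0 then show ?case using y pos by (simp add: r_def)
  next
    case (Suc k)
    let ?z = "(2 ^ k) *\<^sub>R y"
    have "(g 0 * r ^ (2 ^ k))\<^sup>2 \<le> (g ?z)\<^sup>2"
      using Suc pos r by (intro power_mono) auto
    also have "\<dots> \<le> g 0 * g (2 *\<^sub>R ?z)" using cs Suc by blast
    finally have "g 0 * (g 0 * (r ^ (2 ^ k))\<^sup>2) \<le> g 0 * g (2 *\<^sub>R ?z)"
      by (simp only: power_mult_distrib power2_eq_square[of "g 0"] mult.assoc)
    then have "g 0 * (r ^ (2 ^ k))\<^sup>2 \<le> g (2 *\<^sub>R ?z)"
      using pos by (simp only: mult_le_cancel_left_pos)
    then have "g 0 * r ^ (2 ^ Suc k) \<le> g (2 *\<^sub>R ?z)"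
      by (simp only: power_mult[symmetric] power_Suc2)
    moreover have "(2 ^ Suc k) *\<^sub>R y = 2 *\<^sub>R ?z" by simp
    ultimately show ?case using dbl Suc by metis
  qed
  obtain M where M: "\<And>x. x \<in> S \<Longrightarrow> g x \<le> M" using g unfolding pd_on_def by blast
  obtain n where n: "M / g 0 < r ^ n" using real_arch_pow[OF r] by blast
  have "r ^ n \<le> r ^ (2 ^ n)" using r by (intro power_increasing) (auto intro: less_imp_le)
  then have "M / g 0 < r ^ (2 ^ n)" using n by linarith
  then have "M < g 0 * r ^ (2 ^ n)" using pos by (simp only: pos_divide_less_eq mult.commute)
  then show False using pw[of n] M[of "(2 ^ n) *\<^sub>R y"] by linarith
qed

text \<open>Let \<open>u z\<close> be the form of \<open>g\<close> on xs shifted by z. The form of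
  \<open>u\<close> on ys is the form of \<open>g\<close> on all sums x + y with coefficients c * d.
  So \<open>u\<close> is again bounded and positive definite, and \<open>u a \<le> u 0\<close> is
  the claim.\<close>

lemma pd_on_diff_shift:
  assumes g: "pd_on S g" and a: "a \<in> S"
  shows "pd_on S (\<lambda>x. g x - g (x + a))"
  unfolding pd_on_def
proof (intro conjI allI impI)
  fix xs :: "(real \<times> 'a) list" assume xs: "set (map snd xs) \<subseteq> S"
  define u where "u z = (\<Sum>(c, x)\<leftarrow>xs. \<Sum>(d, y)\<leftarrow>xs. c * d * g (x + y + z))" for z
  obtain M where M: "\<And>x. x \<in> S \<Longrightarrow> g x \<le> M" using g unfolding pd_on_def by blast
  have "pd_on S u"
    unfolding pd_on_def
  proof (intro conjI allI impI)
    fix ys :: "(real \<times> 'a) list" assume ys: "set (map snd ys) \<subseteq> S"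
    \<comment> \<open>Different pairs may have the same sum. Lists of weighted points tolerate such
      repetitions, whereas coefficients indexed by a set of points would have to be merged.\<close>
    define zs where "zs = map (\<lambda>((c, x), (d, y)). (c * d, x + y)) (List.product xs ys)"
    have "snd z \<in> S" if "z \<in> set zs" for z
    proof -
      obtain p q where "z = (fst p * fst q, snd p + snd q)" "p \<in> set xs" "q \<in> set ys"
        using \<open>z \<in> set zs\<close> unfolding zs_def by auto
      then show ?thesis using xs ys by (auto intro!: add_in)
    qed
    then have "set (map snd zs) \<subseteq> S" by auto
    from pd_onD[OF g this]
    have "0 \<le> (\<Sum>p\<leftarrow>xs. \<Sum>q\<leftarrow>ys. \<Sum>p'\<leftarrow>xs. \<Sum>q'\<leftarrow>ys.
        (fst p * fst q) * (fst p' * fst q') * g ((snd p + snd q) + (snd p' + snd q')))"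
      unfolding zs_def sum_list_product_map by (simp add: case_prod_unfold)
    also have "\<dots> = (\<Sum>q\<leftarrow>ys. \<Sum>p\<leftarrow>xs. \<Sum>q'\<leftarrow>ys. \<Sum>p'\<leftarrow>xs.
        (fst p * fst q) * (fst p' * fst q') * g ((snd p + snd q) + (snd p' + snd q')))"
      by (subst sum_list_swap) (subst (3) sum_list_swap, rule refl)
    also have "\<dots> = (\<Sum>q\<leftarrow>ys. \<Sum>q'\<leftarrow>ys. \<Sum>p\<leftarrow>xs. \<Sum>p'\<leftarrow>xs.
        (fst p * fst q) * (fst p' * fst q') * g ((snd p + snd q) + (snd p' + snd q')))"
      by (subst (2) sum_list_swap) (rule refl)
    also have "\<dots> = (\<Sum>q\<leftarrow>ys. \<Sum>q'\<leftarrow>ys. \<Sum>p\<leftarrow>xs. \<Sum>p'\<leftarrow>xs.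
        fst q * fst q' * (fst p * fst p' * g (snd p + snd p' + (snd q + snd q'))))"
      by (intro arg_cong[of _ _ sum_list] map_cong refl) (simp add: ac_simps)
    also have "\<dots> = (\<Sum>(c, x)\<leftarrow>ys. \<Sum>(d, y)\<leftarrow>ys. c * d * u (x + y))"
      by (simp add: u_def case_prod_unfold sum_list_const_mult)
    finally show "0 \<le> (\<Sum>(c, x)\<leftarrow>ys. \<Sum>(d, y)\<leftarrow>ys. c * d * u (x + y))" .
  next
    have "u z \<le> (\<Sum>(c, x)\<leftarrow>xs. \<Sum>(d, y)\<leftarrow>xs. \<bar>c * d\<bar> * M)" if z: "z \<in> S" for z
      unfolding u_def
    proof (intro sum_list_mono, clarsimp, intro sum_list_mono, clarsimp)
      fix c x d y assume "(c, x) \<in> set xs" "(d, y) \<in> set xs"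
      then have "x \<in> S" "y \<in> S" using xs by (auto simp: image_subset_iff)
      then have "x + y + z \<in> S" using z by (intro add_in)
      then have "0 \<le> g (x + y + z)" "g (x + y + z) \<le> M" using M pd_on_nonneg[OF g] by auto
      then show "c * d * g (x + y + z) \<le> \<bar>c * d\<bar> * M"
        by (meson abs_ge_self abs_ge_zero mult_mono)
    qed
    then show "\<exists>M. \<forall>z\<in>S. u z \<le> M" by blast
  qed
  from pd_on_le_zero[OF this a]
  show "0 \<le> (\<Sum>(c, x)\<leftarrow>xs. \<Sum>(d, y)\<leftarrow>xs. c * d * (g (x + y) - g (x + y + a)))"
    by (simp add: u_def right_diff_distrib case_prod_unfold sum_list_subtractf)
next
  obtain M where M: "\<And>x. x \<in> S \<Longrightarrow> g x \<le> M" using g unfolding pd_on_def by blast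
  have "g x - g (x + a) \<le> M" if "x \<in> S" for x
    using M[OF that] pd_on_nonneg[OF g add_in[OF that a]] by simp
  then show "\<exists>M. \<forall>x\<in>S. g x - g (x + a) \<le> M" by blast
qed

end

text \<open>A random walk which at each step moves with the commuting pair \<open>I - E\<^sub>a\<close> (stay),
  \<open>E\<^sub>a\<close> (step) of operators, \<open>E\<^sub>a g x = g (x + a)\<close>; it has the binomial closed form
  \<open>(N choose k) E\<^sub>a^k (I - E\<^sub>a)^(N-k) g\<close>.\<close>

fun bern :: "'a::real_vector \<Rightarrow> ('a \<Rightarrow> real) \<Rightarrow> nat \<Rightarrow> nat \<Rightarrow> 'a \<Rightarrow> real" where
  "bern a g 0 k x = (if k = 0 then g x else 0)"
| "bern a g (Suc N) k x =
     (bern a g N k x - bern a g N k (x + a)) + (if k = 0 then 0 else bern a g N (k - 1) (x + a))"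

lemma bern_gt: "N < k \<Longrightarrow> bern a g N k x = 0"
  by (induction N arbitrary: k x) auto

text \<open>A walker at k either stays or moves to k + 1, so the weight \<open>c k\<close> turns
  into \<open>c k\<close> on the first branch and \<open>c (Suc k)\<close> on the second. The
  weights 1, k and k^2 give the recursions of the three moments.\<close>

lemma bern_sum_Suc:
  fixes c :: "nat \<Rightarrow> real"
  shows "(\<Sum>k\<le>Suc N. c k * bern a g (Suc N) k x) =
    (\<Sum>k\<le>N. c k * bern a g N k x) - (\<Sum>k\<le>N. c k * bern a g N k (x + a))
    + (\<Sum>k\<le>N. c (Suc k) * bern a g N k (x + a))"
proof -
  have "(\<Sum>k\<le>Suc N. c k * bern a g (Suc N) k x) =
     (\<Sum>k\<le>Suc N. c k * (bern a g N k x - bern a g N k (x + a)))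
     + (\<Sum>k\<le>Suc N. c k * (if k = 0 then 0 else bern a g N (k - 1) (x + a)))"
    by (simp only: bern.simps distrib_left sum.distrib)
  also have "(\<Sum>k\<le>Suc N. c k * (bern a g N k x - bern a g N k (x + a))) =
     (\<Sum>k\<le>N. c k * bern a g N k x) - (\<Sum>k\<le>N. c k * bern a g N k (x + a))"
    by (simp add: bern_gt right_diff_distrib sum_subtractf)
  also have "(\<Sum>k\<le>Suc N. c k * (if k = 0 then 0 else bern a g N (k - 1) (x + a))) =
     (\<Sum>k\<le>N. c (Suc k) * bern a g N k (x + a))"
    by (subst sum.atMost_Suc_shift) simp
  finally show ?thesis .
qed

lemma bern_moment0: "(\<Sum>k\<le>N. bern a g N k x) = g x"
proof (induction N arbitrary: x)
  case (Suc N) then show ?case using bern_sum_Suc[of "\<lambda>k. 1" a g N x] by simp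
qed simp

lemma bern_moment1: "(\<Sum>k\<le>N. real k * bern a g N k x) = N * g (x + a)"
proof (induction N arbitrary: x)
  case (Suc N)
  have "(\<Sum>k\<le>N. real (Suc k) * bern a g N k (x + a)) =
      (\<Sum>k\<le>N. real k * bern a g N k (x + a)) + (\<Sum>k\<le>N. bern a g N k (x + a))"
    by (simp add: distrib_right sum.distrib)
  then show ?case using bern_sum_Suc[of real a g N x] Suc bern_moment0[of a g N]
    by (simp add: algebra_simps)
qed simp

text \<open>The second moment \<open>N p + N (N - 1) p^2\<close> of a binomial law, with the
  operator \<open>E\<^sub>a\<close> in place of the probability p.\<close>

lemma bern_moment2:
  "(\<Sum>k\<le>N. (real k)\<^sup>2 * bern a g N k x) = N * g (x + a) + real N * (real N - 1) * g (x + a + a)"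
proof (induction N arbitrary: x)
  case (Suc N)
  have "(\<Sum>k\<le>N. (real (Suc k))\<^sup>2 * bern a g N k (x + a)) =
      (\<Sum>k\<le>N. (real k)\<^sup>2 * bern a g N k (x + a)) + 2 * (\<Sum>k\<le>N. real k * bern a g N k (x + a))
      + (\<Sum>k\<le>N. bern a g N k (x + a))"
    by (simp add: power2_eq_square algebra_simps sum.distrib sum_distrib_left)
  then have "(\<Sum>k\<le>Suc N. (real k)\<^sup>2 * bern a g (Suc N) k x) =
     (\<Sum>k\<le>N. (real k)\<^sup>2 * bern a g N k x) + 2 * (N * g (x + a + a)) + g (x + a)"
    using bern_sum_Suc[of "\<lambda>k. (real k)\<^sup>2" a g N x] bern_moment0[of a g N] bern_moment1[of a g N]
    by simp
  then show ?case unfolding Suc by (simp add: algebra_simps)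
qed simp

context halvable_cone
begin

lemma pd_on_bern:
  assumes "pd_on S g" "a \<in> S"
  shows "pd_on S (bern a g N k)"
proof (induction N arbitrary: k)
  case 0
  have "bern a g 0 k = (if k = 0 then g else (\<lambda>x. 0))" by (auto simp: fun_eq_iff)
  then show ?case using assms pd_on_zero by simp
next
  case (Suc N)
  have "bern a g (Suc N) k = (\<lambda>x. (bern a g N k x - bern a g N k (x + a))
      + (if k = 0 then (\<lambda>x. 0) else (\<lambda>x. bern a g N (k - 1) (x + a))) x)"
    by (auto simp: fun_eq_iff)
  moreover have "pd_on S (if k = 0 then (\<lambda>x. 0) else (\<lambda>x. bern a g N (k - 1) (x + a)))"
    using pd_on_zero pd_on_shift[OF Suc assms(2)] by simp
  ultimately show ?case
    by (simp only: pd_on_add[OF pd_on_diff_shift[OF Suc assms(2)]])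
qed

text \<open>The spread \<open>((E\<^sub>a - t)\<^sup>2 G) 0\<close> of G at a around t; it vanishes if \<open>G\<close> is a multiple of
  a character with value t at a.\<close>

definition spread :: "('a \<Rightarrow> real) \<Rightarrow> 'a \<Rightarrow> real \<Rightarrow> real" where
  "spread G a t = G (a + a) - 2 * t * G a + t\<^sup>2 * G 0"

text \<open>Piece k gets the value t = k / N. The total spread is then the variance of k / N, that
  is \<open>(g a - g (a + a)) / N\<close>, and this is at most \<open>g 0 / N\<close>.\<close>

lemma pd_on_decompose_one:
  assumes g: "pd_on S g" and a: "a \<in> S" and N: "N > 0"
  shows "\<exists>Gs. (\<forall>(G, t)\<in>set Gs. pd_on S G \<and> 0 \<le> t \<and> t \<le> 1) \<and>
    (\<forall>x. g x = (\<Sum>(G, t)\<leftarrow>Gs. G x)) \<and> (\<Sum>(G, t)\<leftarrow>Gs. spread G a t) \<le> g 0 / real N"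
proof -
  define Gs where "Gs = map (\<lambda>k. (bern a g N k, real k / real N)) [0..<Suc N]"
  have sl: "(\<Sum>(G, t)\<leftarrow>Gs. F G t) = (\<Sum>k\<le>N. F (bern a g N k) (real k / real N))"
    for F :: "('a \<Rightarrow> real) \<Rightarrow> real \<Rightarrow> real"
    unfolding Gs_def by (simp add: o_def interv_sum_list_conv_sum_set_nat atLeast0LessThan
        lessThan_Suc_atMost del: upt_Suc)
  \<comment> \<open>The factor N^2 clears the denominators of k / N, so that the three moments
    apply.\<close>
  have "(real N)\<^sup>2 * (\<Sum>(G, t)\<leftarrow>Gs. spread G a t) =
     (\<Sum>k\<le>N. (real N)\<^sup>2 * bern a g N k (0 + a + a) - 2 * real N * (real k * bern a g N k (0 + a))
        + (real k)\<^sup>2 * bern a g N k 0)"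
    unfolding sl sum_distrib_left spread_def
    using N by (intro sum.cong refl) (simp add: field_simps power2_eq_square)
  also have "\<dots> = real N * (g a - g (a + a))"
    by (simp add: sum.distrib sum_subtractf sum_distrib_left[symmetric] bern_moment0 bern_moment1
        bern_moment2[where x = 0, simplified] )
       (simp add: algebra_simps power2_eq_square)
  also have "\<dots> \<le> real N * g 0"
    using pd_on_le_zero[OF g a] pd_on_nonneg[OF g add_in[OF a a]] by (intro mult_left_mono) auto
  finally have "(\<Sum>(G, t)\<leftarrow>Gs. spread G a t) \<le> g 0 / real N"
    using N by (simp add: power2_eq_square field_simps)
  moreover have "\<forall>(G, t)\<in>set Gs. pd_on S G \<and> 0 \<le> t \<and> t \<le> 1"
    using pd_on_bern[OF g a] N by (auto simp: Gs_def divide_le_eq_1 simp del: upt_Suc bern.simps)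
  moreover have "\<forall>x. g x = (\<Sum>(G, t)\<leftarrow>Gs. G x)"
    by (simp add: sl bern_moment0)
  ultimately show ?thesis by blast
qed

end

section \<open>Simultaneous approximate eigenvectors for finitely many translations\<close>

lemma sum_list_concat_map:
  fixes f :: "'c \<Rightarrow> 'd::comm_monoid_add"
  shows "(\<Sum>z\<leftarrow>concat (map h xs). f z) = (\<Sum>x\<leftarrow>xs. \<Sum>z\<leftarrow>h x. f z)"
  by (induction xs) simp_all

context halvable_cone
begin

text \<open>Each piece is split once more for every new point a. For a fixed value t the spread at b
  is linear in the function, so splitting a piece into summands that keep its value at b leaves the
  total spread at b unchanged.\<close>

lemma pd_on_decompose:
  assumes g: "pd_on S g" and F: "finite F" "F \<subseteq> S" and N: "N > 0"
  shows "\<exists>Gs. (\<forall>(G, t)\<in>set Gs. pd_on S G \<and> (\<forall>a. 0 \<le> t a \<and> t a \<le> 1)) \<and>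
    (\<forall>x. g x = (\<Sum>(G, t)\<leftarrow>Gs. G x)) \<and>
    (\<forall>a\<in>F. (\<Sum>(G, t)\<leftarrow>Gs. spread G a (t a)) \<le> g 0 / real N)"
  using F
proof (induction F rule: finite_induct)
  case empty
  show ?case using g by (intro exI[of _ "[(g, \<lambda>_. 0)]"]) auto
next
  case (insert a F)
  then obtain Gs where Gs: "\<forall>(G, t)\<in>set Gs. pd_on S G \<and> (\<forall>a. 0 \<le> t a \<and> t a \<le> 1)"
      "\<And>x. g x = (\<Sum>(G, t)\<leftarrow>Gs. G x)"
      "\<And>a. a \<in> F \<Longrightarrow> (\<Sum>(G, t)\<leftarrow>Gs. spread G a (t a)) \<le> g 0 / real N"
    by auto
  define Q where "Q G Hs \<longleftrightarrow> (\<forall>(H, t)\<in>set Hs. pd_on S H \<and> 0 \<le> t \<and> t \<le> 1) \<and>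
    (\<forall>x. G x = (\<Sum>(H, t)\<leftarrow>Hs. H x)) \<and> (\<Sum>(H, t)\<leftarrow>Hs. spread H a t) \<le> G 0 / real N"
    for G :: "'a \<Rightarrow> real" and Hs
  have "\<forall>G. \<exists>Hs. pd_on S G \<longrightarrow> Q G Hs"
    using pd_on_decompose_one[of _ a N] insert.prems N unfolding Q_def by auto
  from choice[OF this] obtain h where "\<And>G. pd_on S G \<Longrightarrow> Q G (h G)" by blast
  then have h: "\<And>G H t. pd_on S G \<Longrightarrow> (H, t) \<in> set (h G) \<Longrightarrow> pd_on S H \<and> 0 \<le> t \<and> t \<le> 1"
    "\<And>G x. pd_on S G \<Longrightarrow> G x = (\<Sum>(H, t)\<leftarrow>h G. H x)"
    "\<And>G. pd_on S G \<Longrightarrow> (\<Sum>(H, t)\<leftarrow>h G. spread H a t) \<le> G 0 / real N"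
    unfolding Q_def by blast+
  \<comment> \<open>A piece of \<open>G\<close> inherits the values of \<open>G\<close> at the
    earlier points and receives its own value at \<open>a\<close>.\<close>
  define Ks where "Ks = concat (map (\<lambda>(G, t). map (\<lambda>(H, s). (H, t(a := s))) (h G)) Gs)"
  have pdG: "pd_on S G" if "(G, t) \<in> set Gs" for G t using Gs(1) that by auto
  have sl: "(\<Sum>(G, t)\<leftarrow>Ks. P G t) = (\<Sum>(G, t)\<leftarrow>Gs. \<Sum>(H, s)\<leftarrow>h G. P H (t(a := s)))"
    for P :: "('a \<Rightarrow> real) \<Rightarrow> ('a \<Rightarrow> real) \<Rightarrow> real"
    unfolding Ks_def sum_list_concat_map by (simp add: case_prod_unfold o_def)
  have 1: "\<forall>(G, t)\<in>set Ks. pd_on S G \<and> (\<forall>a. 0 \<le> t a \<and> t a \<le> 1)"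
  proof clarify
    fix K t assume "(K, t) \<in> set Ks"
    then obtain G t' H s where *: "(G, t') \<in> set Gs" "(H, s) \<in> set (h G)" "K = H" "t = t'(a := s)"
      unfolding Ks_def by fastforce
    then show "pd_on S K \<and> (\<forall>a. 0 \<le> t a \<and> t a \<le> 1)"
      using Gs(1) h(1)[OF pdG[OF *(1)] *(2)] by auto
  qed
  have 2: "g x = (\<Sum>(G, t)\<leftarrow>Ks. G x)" for x
    unfolding sl Gs(2)[of x]
    using h(2)[OF pdG] by (intro arg_cong[of _ _ sum_list] map_cong refl) auto
  have 3: "(\<Sum>(G, t)\<leftarrow>Ks. spread G b (t b)) \<le> g 0 / real N" if b: "b \<in> insert a F" for b
  proof (cases "b = a")
    case True
    have "(\<Sum>(G, t)\<leftarrow>Ks. spread G b (t b)) = (\<Sum>(G, t)\<leftarrow>Gs. \<Sum>(H, s)\<leftarrow>h G. spread H a s)"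
      unfolding sl True by simp
    also have "\<dots> \<le> (\<Sum>(G, t)\<leftarrow>Gs. G 0 / real N)"
      using h(3)[OF pdG] by (intro sum_list_mono) auto
    also have "\<dots> = g 0 / real N"
      unfolding Gs(2)[of 0] divide_inverse by (simp add: case_prod_unfold sum_list_mult_const)
    finally show ?thesis .
  next
    case False
    then have bF: "b \<in> F" using b by simp
    have "(\<Sum>(G, t)\<leftarrow>Ks. spread G b (t b)) = (\<Sum>(G, t)\<leftarrow>Gs. \<Sum>(H, s)\<leftarrow>h G. spread H b (t b))"
      unfolding sl using False by simp
    also have "\<dots> = (\<Sum>(G, t)\<leftarrow>Gs. spread G b (t b))"
    proof (intro arg_cong[of _ _ sum_list] map_cong refl, clarify)
      fix G t assume "(G, t) \<in> set Gs"
      from h(2)[OF pdG[OF this]]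
      have "spread G b (t b) = (\<Sum>(H, s)\<leftarrow>h G. H (b + b)) - 2 * t b * (\<Sum>(H, s)\<leftarrow>h G. H b)
          + (t b)\<^sup>2 * (\<Sum>(H, s)\<leftarrow>h G. H 0)"
        unfolding spread_def by metis
      then show "(\<Sum>(H, s)\<leftarrow>h G. spread H b (t b)) = spread G b (t b)"
        by (simp add: spread_def case_prod_unfold sum_list_addf sum_list_subtractf sum_list_const_mult)
    qed
    also have "\<dots> \<le> g 0 / real N" by (rule Gs(3)[OF bF])
    finally show ?thesis .
  qed
  show ?case using 1 2 3 by blast
qed

text \<open>The Cauchy-Schwarz inequality between the point s and the combination a - t 0, whose
  form is the spread; \<open>G (s + s) \<le> G 0\<close> removes the dependence on s. The version
  with a parameter \<open>\<delta>\<close> instead of a square root is linear in \<open>G\<close>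
  and can be summed over the pieces.\<close>

lemma pd_on_spread_bound:
  assumes G: "pd_on S G" and a: "a \<in> S" and s: "s \<in> S" and \<delta>: "\<delta> > 0"
  shows "\<bar>G (a + s) - t * G s\<bar> \<le> (\<delta> * G 0 + spread G a t / \<delta>) / 2"
proof -
  have q: "0 \<le> c * c * G (s + s) + 2 * c * (G (a + s) - t * G s) + spread G a t" for c
    using pd_onD[OF G, of "[(c, s), (1, a), (- t, 0)]"] a s zero_in
    by (simp add: algebra_simps spread_def power2_eq_square)
  have m: "\<delta> * \<delta> * G (s + s) \<le> \<delta> * \<delta> * G 0"
    using \<delta> pd_on_le_zero[OF G add_in[OF s s]] by (intro mult_left_mono) auto
  have "2 * \<delta> * \<bar>G (a + s) - t * G s\<bar> \<le> \<delta> * \<delta> * G 0 + spread G a t"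
    using q[of \<delta>] q[of "-\<delta>"] m by (cases "G (a + s) - t * G s \<ge> 0") (auto simp: algebra_simps)
  then show ?thesis using \<delta> by (simp add: field_simps)
qed

text \<open>One summand is peeled off at a time: \<open>G (a + s)\<close> is replaced by
  \<open>t a * G s\<close>, and the error already made for s is multiplied by
  \<open>t a \<le> 1\<close>.\<close>

lemma pd_on_character_bound:
  assumes G: "pd_on S G" and as: "set as \<subseteq> S" and t: "\<And>a. 0 \<le> t a \<and> t a \<le> 1" and \<delta>: "\<delta> > 0"
  shows "\<bar>G (\<Sum>a\<leftarrow>as. a) - G 0 * (\<Prod>a\<leftarrow>as. t a)\<bar> \<le> (\<Sum>a\<leftarrow>as. (\<delta> * G 0 + spread G a (t a) / \<delta>) / 2)"
  using as
proof (induction as)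
  case (Cons a as)
  have s: "(\<Sum>a\<leftarrow>as. a) \<in> S" using Cons.prems by (induction as) (auto intro: zero_in add_in)
  have "\<bar>G (a + (\<Sum>a\<leftarrow>as. a)) - G 0 * (t a * (\<Prod>a\<leftarrow>as. t a))\<bar> \<le>
      \<bar>G (a + (\<Sum>a\<leftarrow>as. a)) - t a * G (\<Sum>a\<leftarrow>as. a)\<bar>
      + \<bar>t a * (G (\<Sum>a\<leftarrow>as. a) - G 0 * (\<Prod>a\<leftarrow>as. t a))\<bar>"
    by (rule order_trans[OF _ abs_triangle_ineq]) (simp add: algebra_simps)
  moreover have "\<bar>t a * (G (\<Sum>a\<leftarrow>as. a) - G 0 * (\<Prod>a\<leftarrow>as. t a))\<bar>
      \<le> \<bar>G (\<Sum>a\<leftarrow>as. a) - G 0 * (\<Prod>a\<leftarrow>as. t a)\<bar>"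
    using t[of a] by (simp add: abs_mult mult_left_le_one_le)
  moreover have "\<bar>G (a + (\<Sum>a\<leftarrow>as. a)) - t a * G (\<Sum>a\<leftarrow>as. a)\<bar> \<le> (\<delta> * G 0 + spread G a (t a) / \<delta>) / 2"
    using Cons.prems by (intro pd_on_spread_bound[OF G _ s \<delta>]) auto
  moreover have "\<bar>G (\<Sum>a\<leftarrow>as. a) - G 0 * (\<Prod>a\<leftarrow>as. t a)\<bar>
      \<le> (\<Sum>a\<leftarrow>as. (\<delta> * G 0 + spread G a (t a) / \<delta>) / 2)"
    using Cons by simp
  ultimately show ?case unfolding list.map sum_list.Cons prod_list.Cons by linarith
qed simp

text \<open>The functions t are nearly characters only in the mean. Hence a sum of points is
  compared with the product of the values of t along the list of summands, and true multiplicativity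
  is left to the limit.\<close>

lemma pd_on_approx_characters:
  fixes \<epsilon> :: real
  assumes g: "pd_on S g" and F: "finite F" "F \<subseteq> S" and \<epsilon>: "\<epsilon> > 0"
  shows "\<exists>ws. (\<forall>(w, t)\<in>set ws. 0 \<le> w \<and> (\<forall>a. 0 \<le> t a \<and> t a \<le> 1)) \<and> (\<Sum>(w, t)\<leftarrow>ws. w) = g 0 \<and>
    (\<forall>as. set as \<subseteq> F \<longrightarrow>
      \<bar>g (\<Sum>a\<leftarrow>as. a) - (\<Sum>(w, t)\<leftarrow>ws. w * (\<Prod>a\<leftarrow>as. t a))\<bar> \<le> length as * \<epsilon>)"
proof -
  have g0: "g 0 \<ge> 0" using pd_on_nonneg[OF g zero_in] .
  \<comment> \<open>The pieces together contribute \<open>\<delta> * g 0\<close> and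
    \<open>(g 0 / N) / \<delta>\<close>, and the choices of \<open>\<delta>\<close> and
    \<open>N\<close> bring both below \<open>\<epsilon>\<close>. The added 1 admits
    \<open>g 0 = 0\<close>.\<close>
  define \<delta> where "\<delta> = \<epsilon> / (g 0 + 1)"
  have \<delta>: "\<delta> > 0" using \<epsilon> g0 by (simp add: \<delta>_def)
  obtain n where n: "g 0 / (\<epsilon> * \<delta>) < real n" using reals_Archimedean2 by blast
  define N where "N = Suc n"
  have N: "N > 0" "g 0 / N \<le> \<epsilon> * \<delta>" using n \<epsilon> \<delta> by (auto simp: N_def field_simps add_increasing)
  obtain Gs where Gs: "\<forall>(G, t)\<in>set Gs. pd_on S G \<and> (\<forall>a. 0 \<le> t a \<and> t a \<le> 1)"
      "\<And>x. g x = (\<Sum>(G, t)\<leftarrow>Gs. G x)"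
      "\<And>a. a \<in> F \<Longrightarrow> (\<Sum>(G, t)\<leftarrow>Gs. spread G a (t a)) \<le> g 0 / real N"
    using pd_on_decompose[OF g F N(1)] by auto
  define ws where "ws = map (\<lambda>(G, t). (G 0, t)) Gs"
  have sl: "(\<Sum>(w, t)\<leftarrow>ws. P w t) = (\<Sum>(G, t)\<leftarrow>Gs. P (G 0) t)"
    for P :: "real \<Rightarrow> ('a \<Rightarrow> real) \<Rightarrow> real"
    unfolding ws_def by (simp add: case_prod_unfold o_def)
  have "\<bar>g (\<Sum>a\<leftarrow>as. a) - (\<Sum>(w, t)\<leftarrow>ws. w * (\<Prod>a\<leftarrow>as. t a))\<bar> \<le> length as * \<epsilon>"
    if as: "set as \<subseteq> F" for as
  proof -
    have "g (\<Sum>a\<leftarrow>as. a) - (\<Sum>(w, t)\<leftarrow>ws. w * (\<Prod>a\<leftarrow>as. t a)) =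
       (\<Sum>(G, t)\<leftarrow>Gs. G (\<Sum>a\<leftarrow>as. a) - G 0 * (\<Prod>a\<leftarrow>as. t a))"
      unfolding sl Gs(2)[of "\<Sum>a\<leftarrow>as. a"] by (simp add: case_prod_unfold sum_list_subtractf)
    also have "\<bar>\<dots>\<bar> \<le> (\<Sum>(G, t)\<leftarrow>Gs. \<bar>G (\<Sum>a\<leftarrow>as. a) - G 0 * (\<Prod>a\<leftarrow>as. t a)\<bar>)"
      by (rule order_trans[OF sum_list_abs]) (simp add: o_def case_prod_unfold)
    also have "\<dots> \<le> (\<Sum>(G, t)\<leftarrow>Gs. \<Sum>a\<leftarrow>as. (\<delta> * G 0 + spread G a (t a) / \<delta>) / 2)"
      using Gs(1) as F(2) pd_on_character_bound[OF _ _ _ \<delta>] by (intro sum_list_mono) fastforce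
    also have "\<dots> = (\<Sum>a\<leftarrow>as. \<Sum>(G, t)\<leftarrow>Gs. (\<delta> * G 0 + spread G a (t a) / \<delta>) / 2)"
      unfolding case_prod_unfold by (rule sum_list_swap)
    also have "\<dots> \<le> (\<Sum>a\<leftarrow>as. \<epsilon>)"
    proof (rule sum_list_mono)
      fix a assume "a \<in> set as"
      then have "(\<Sum>(G, t)\<leftarrow>Gs. spread G a (t a)) \<le> \<epsilon> * \<delta>" using Gs(3) as N(2) by fastforce
      moreover have "(\<Sum>(G, t)\<leftarrow>Hs. (\<delta> * G 0 + spread G a (t a) / \<delta>) / 2) =
          (\<delta> * (\<Sum>(G, t)\<leftarrow>Hs. G 0) + (\<Sum>(G, t)\<leftarrow>Hs. spread G a (t a)) / \<delta>) / 2" for Hs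
        by (induction Hs) (auto simp: add_divide_distrib distrib_left)
      then have eq: "(\<Sum>(G, t)\<leftarrow>Gs. (\<delta> * G 0 + spread G a (t a) / \<delta>) / 2) =
          (\<delta> * g 0 + (\<Sum>(G, t)\<leftarrow>Gs. spread G a (t a)) / \<delta>) / 2"
        unfolding Gs(2)[of 0] .
      moreover have half: "(x + y) / 2 \<le> \<epsilon>" if "x \<le> \<epsilon>" "y \<le> \<epsilon>" for x y using that by simp
      moreover have "\<delta> * g 0 \<le> \<epsilon>" using g0 \<epsilon> by (simp add: \<delta>_def field_simps)
      moreover have "(\<Sum>(G, t)\<leftarrow>Gs. spread G a (t a)) / \<delta> \<le> \<epsilon>"
        using calculation(1) \<delta> by (simp add: pos_divide_le_eq)
      ultimately show "(\<Sum>(G, t)\<leftarrow>Gs. (\<delta> * G 0 + spread G a (t a) / \<delta>) / 2) \<le> \<epsilon>"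
        unfolding eq by (intro half)
    qed
    also have "\<dots> = length as * \<epsilon>" by (simp add: sum_list_triv)
    finally show ?thesis .
  qed
  moreover have "\<forall>(w, t)\<in>set ws. 0 \<le> w \<and> (\<forall>a. 0 \<le> t a \<and> t a \<le> 1)"
    using Gs(1) pd_on_nonneg[OF _ zero_in] by (auto simp: ws_def)
  moreover have "(\<Sum>(w, t)\<leftarrow>ws. w) = g 0" unfolding sl Gs(2)[of 0] ..
  ultimately show ?thesis by blast
qed

end

section \<open>Limits of measures on a cube\<close>

text \<open>Schoenberg's space filling curve, with countably many coordinates: its coordinate number i
  reads off, in base 3, the digits at the positions \<open>prod_encode (i, k)\<close>.\<close>

definition schoenberg_bump :: "real \<Rightarrow> real" where
  "schoenberg_bump x = max 0 (min 1 (1/2 - cos (pi * x)))"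

definition schoenberg :: "nat \<Rightarrow> real \<Rightarrow> real" where
  "schoenberg i s = (\<Sum>k. schoenberg_bump (3 ^ prod_encode (i, k) * s) / 2 ^ Suc k)"

lemma schoenberg_bump_range: "0 \<le> schoenberg_bump x" "schoenberg_bump x \<le> 1"
  by (auto simp: schoenberg_bump_def)

lemma schoenberg_bump_even:
  "schoenberg_bump (2 * real n + y) = schoenberg_bump y"
proof -
  have "pi * (2 * real n + y) = 2 * real n * pi + pi * y" by (simp add: algebra_simps)
  then have "cos (pi * (2 * real n + y)) = cos (pi * y)"
    using cos_2npi[of n] sin_2npi[of n] by (simp add: cos_add)
  then show ?thesis by (simp add: schoenberg_bump_def)
qed

text \<open>On [0, 1/3] the cosine of pi x is at least 1/2, so clipping gives 0; on [2/3, 1] it is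
  at most -1/2, so clipping gives 1. These are the two intervals selected by a ternary digit 0 or
  2.\<close>

lemma schoenberg_bump_eq:
  assumes "0 \<le> r" "r \<le> 1/3" "c \<in> {0, 1}"
  shows "schoenberg_bump (2 * c / 3 + r) = c"
proof (cases "c = 0")
  case True
  have "cos (pi / 3) \<le> cos (pi * r)"
    using assms pi_gt_zero by (intro cos_monotone_0_pi_le) (auto simp: field_simps)
  then show ?thesis using True by (simp add: schoenberg_bump_def cos_60)
next
  case False
  then have c: "c = 1" using assms by simp
  have "cos (pi * (1 / 3 - r)) \<ge> cos (pi / 3)"
    using assms pi_gt_zero by (intro cos_monotone_0_pi_le) (auto simp: field_simps)
  moreover have "cos (pi * (2 / 3 + r)) = - cos (pi * (1 / 3 - r))"
    by (subst cos_pi_minus[symmetric]) (simp add: algebra_simps)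
  ultimately show ?thesis using c by (simp add: schoenberg_bump_def cos_60)
qed

lemma sums_half_powers: "(\<lambda>k. 1 / 2 ^ Suc k) sums (1::real)"
  using power_half_series by (simp add: power_divide)

lemma schoenberg_summable: "summable (\<lambda>k. schoenberg_bump (3 ^ prod_encode (i, k) * s) / 2 ^ Suc k)"
  by (rule summable_comparison_test'[OF sums_summable[OF sums_half_powers]])
     (use schoenberg_bump_range in \<open>auto simp: divide_simps\<close>)

lemma schoenberg_range: "0 \<le> schoenberg i s" "schoenberg i s \<le> 1"
proof -
  show "0 \<le> schoenberg i s"
    unfolding schoenberg_def by (intro suminf_nonneg schoenberg_summable) (simp add: schoenberg_bump_range)
  have "schoenberg i s \<le> (\<Sum>k. 1 / 2 ^ Suc k)"
    unfolding schoenberg_def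
    by (intro suminf_le schoenberg_summable sums_summable[OF sums_half_powers] divide_right_mono)
       (auto simp: schoenberg_bump_range)
  then show "schoenberg i s \<le> 1" using sums_half_powers sums_unique by metis
qed

lemma continuous_on_schoenberg: "continuous_on UNIV (schoenberg i)"
proof -
  have ul: "uniform_limit UNIV (\<lambda>n s. \<Sum>k<n. schoenberg_bump (3 ^ prod_encode (i, k) * s) / 2 ^ Suc k)
      (schoenberg i) sequentially"
    unfolding schoenberg_def
    by (rule Weierstrass_m_test[OF _ sums_summable[OF sums_half_powers]])
       (use schoenberg_bump_range in \<open>auto simp: divide_simps\<close>)
  have "continuous_on UNIV (\<lambda>s. \<Sum>k<n. schoenberg_bump (3 ^ prod_encode (i, k) * s) / 2 ^ Suc k)" for n
    unfolding schoenberg_bump_def by (intro continuous_intros) auto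
  then show ?thesis
    by (intro uniform_limit_theorem[OF _ ul]) auto
qed

lemma binary_expansion:
  fixes x :: real
  assumes "0 \<le> x" "x \<le> 1"
  shows "\<exists>a. range a \<subseteq> {0, 1} \<and> (\<lambda>k. a k / 2 ^ Suc k) sums x"
proof -
  \<comment> \<open>The doubling map. Taking the digit 1 from 1/2 on keeps the remainders in [0, 1];
    the point 1 is fixed and receives the digits 1, 1, 1, ....\<close>
  define r where "r = rec_nat x (\<lambda>_ y. 2 * y - (if y \<ge> 1/2 then 1 else 0))"
  define a where "a k = (if r k \<ge> 1/2 then 1 else 0 :: real)" for k
  have r0: "r 0 = x" and rS: "r (Suc k) = 2 * r k - a k" for k by (simp_all add: r_def a_def)
  have r: "0 \<le> r k \<and> r k \<le> 1" for k
    by (induction k) (use assms in \<open>auto simp: r0 rS a_def\<close>)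
  have eq: "(\<Sum>k<n. a k / 2 ^ Suc k) = x - r n / 2 ^ n" for n
    by (induction n) (auto simp: r0 rS field_simps)
  have "(\<lambda>n. r n / 2 ^ n) \<longlonglongrightarrow> 0"
  proof (rule tendsto_sandwich)
    show "\<forall>\<^sub>F n in sequentially. 0 \<le> r n / 2 ^ n" using r by simp
    show "\<forall>\<^sub>F n in sequentially. r n / 2 ^ n \<le> (1/2) ^ n" using r by (simp add: power_divide divide_right_mono)
  qed (auto intro: LIMSEQ_realpow_zero)
  then have "(\<lambda>n. \<Sum>k<n. a k / 2 ^ Suc k) \<longlonglongrightarrow> x - 0" unfolding eq by (intro tendsto_intros)
  then show ?thesis by (intro exI[of _ a]) (auto simp: sums_def a_def)
qed

text \<open>The binary digits of all coordinates are interleaved by \<open>prod_encode\<close> and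
  doubled to the ternary digits 0 and 2 of a point \<open>s\<close> of the Cantor set. Scaling by
  3^m moves digit m to the front, where the bump reads it.\<close>

lemma schoenberg_surj:
  assumes "\<And>i. 0 \<le> t i \<and> t i \<le> 1"
  shows "\<exists>s. 0 \<le> s \<and> s \<le> 1 \<and> (\<forall>i. schoenberg i s = t i)"
proof -
  have "\<forall>i. \<exists>a. range a \<subseteq> {0, 1} \<and> (\<lambda>k. a k / 2 ^ Suc k) sums t i"
    using binary_expansion assms by blast
  then obtain a where a: "\<And>i. range (a i) \<subseteq> {0, 1::real}" "\<And>i. (\<lambda>k. a i k / 2 ^ Suc k) sums t i"
    by metis
  define c where "c j = (case prod_decode j of (i, k) \<Rightarrow> a i k)" for j
  have c: "c j \<in> {0, 1}" for j using a(1) by (auto simp: c_def split: prod.split)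
  define s where "s = (\<Sum>j. 2 * c j / 3 ^ Suc j)"
  have geo: "(\<lambda>j. 2 / 3 ^ Suc j) sums (1::real)"
  proof -
    have "(\<lambda>j. 2 / 3 * (1 / 3) ^ j) sums (2 / 3 * (1 / (1 - 1 / 3)) :: real)"
      by (intro sums_mult geometric_sums) simp
    then show ?thesis by (simp add: power_divide)
  qed
  have summ: "summable (\<lambda>j. 2 * c (j + m) / 3 ^ Suc j)"
    and tail: "0 \<le> (\<Sum>j. 2 * c (j + m) / 3 ^ Suc j)" "(\<Sum>j. 2 * c (j + m) / 3 ^ Suc j) \<le> 1" for m
  proof -
    have b: "0 \<le> 2 * c (j + m) / 3 ^ Suc j \<and> 2 * c (j + m) / 3 ^ Suc j \<le> 2 / 3 ^ Suc j" for j
      using c[of "j + m"] by auto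
    show summ: "summable (\<lambda>j. 2 * c (j + m) / 3 ^ Suc j)"
      by (rule summable_comparison_test'[OF sums_summable[OF geo]])
         (use b in \<open>simp only: real_norm_def abs_of_nonneg\<close>)
    show "0 \<le> (\<Sum>j. 2 * c (j + m) / 3 ^ Suc j)" using b by (intro suminf_nonneg[OF summ]) auto
    have "(\<Sum>j. 2 * c (j + m) / 3 ^ Suc j) \<le> (\<Sum>j. 2 / 3 ^ Suc j)"
      using b by (intro suminf_le summ sums_summable[OF geo]) auto
    then show "(\<Sum>j. 2 * c (j + m) / 3 ^ Suc j) \<le> 1" using geo sums_unique by metis
  qed
  \<comment> \<open>All ternary digits are even, so the part of \<open>3 ^ m * s\<close> before the
    ternary point is an even integer, which the period 2 of the bump discards.\<close>
  have step: "\<exists>n. 3 ^ m * s = 2 * real n + (\<Sum>j. 2 * c (j + m) / 3 ^ Suc j)" for m :: nat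
  proof (induction m)
    case 0 then show ?case by (intro exI[of _ 0]) (simp add: s_def)
  next
    case (Suc m)
    then obtain n where n: "3 ^ m * s = 2 * real n + (\<Sum>j. 2 * c (j + m) / 3 ^ Suc j)" by blast
    have "(\<Sum>j. 2 * c (j + m) / 3 ^ Suc j) = 2 * c m / 3 + (\<Sum>j. 2 * c (Suc j + m) / 3 ^ Suc (Suc j))"
      using suminf_split_head[OF summ[of m]] by simp
    also have "(\<Sum>j. 2 * c (Suc j + m) / 3 ^ Suc (Suc j)) = (\<Sum>j. (1 / 3) * (2 * c (j + Suc m) / 3 ^ Suc j))"
      by (intro suminf_cong) simp
    also have "\<dots> = (1 / 3) * (\<Sum>j. 2 * c (j + Suc m) / 3 ^ Suc j)"
      by (rule suminf_mult[OF summ])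
    finally have "3 ^ Suc m * s = 2 * (3 * real n + c m) + (\<Sum>j. 2 * c (j + Suc m) / 3 ^ Suc j)"
      using n by simp
    moreover have "3 * real n + c m = real (3 * n + (if c m = 0 then 0 else 1))"
      using c[of m] by auto
    ultimately show ?case by metis
  qed
  have digit: "schoenberg_bump (3 ^ m * s) = c m" for m
  proof -
    obtain n where n: "3 ^ m * s = 2 * real n + (\<Sum>j. 2 * c (j + m) / 3 ^ Suc j)" using step by blast
    have "(\<Sum>j. 2 * c (j + m) / 3 ^ Suc j) = 2 * c m / 3 + (\<Sum>j. 2 * c (Suc j + m) / 3 ^ Suc (Suc j))"
      using suminf_split_head[OF summ[of m]] by simp
    also have "(\<Sum>j. 2 * c (Suc j + m) / 3 ^ Suc (Suc j)) = (\<Sum>j. (1 / 3) * (2 * c (j + Suc m) / 3 ^ Suc j))"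
      by (intro suminf_cong) simp
    also have "\<dots> = (1 / 3) * (\<Sum>j. 2 * c (j + Suc m) / 3 ^ Suc j)"
      by (rule suminf_mult[OF summ])
    finally show ?thesis
      unfolding n schoenberg_bump_even using tail[of "Suc m"] c[of m]
      by (simp only:) (intro schoenberg_bump_eq, auto)
  qed
  have "schoenberg i s = t i" for i
    unfolding schoenberg_def digit using sums_unique[OF a(2)[of i]] by (simp add: c_def)
  moreover have "0 \<le> s" "s \<le> 1" using tail[of 0] by (simp_all add: s_def)
  ultimately show ?thesis by blast
qed

section \<open>Finite mixtures as measures on the line, and their limit\<close>

lemma discrete_distribution:
  fixes ws :: "(real \<times> 'b) list" and \<sigma> :: "'b \<Rightarrow> real"
  assumes w: "\<And>w t. (w, t) \<in> set ws \<Longrightarrow> 0 \<le> w" and sum: "(\<Sum>(w, t)\<leftarrow>ws. w) = 1"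
  shows "\<exists>M. real_distribution M \<and>
    (\<forall>f\<in>borel_measurable borel. integral\<^sup>L M f = (\<Sum>(w, t)\<leftarrow>ws. w * f (\<sigma> t)))"
proof -
  let ?n = "length ws" and ?w = "\<lambda>k. fst (ws ! k)" and ?t = "\<lambda>k. snd (ws ! k)"
  \<comment> \<open>The mass sits on the indices of the list, so that equal entries keep their
    separate weights.\<close>
  define P where "P = point_measure {..<?n} (\<lambda>k. ennreal (?w k))"
  have w': "0 \<le> ?w k" if "k < ?n" for k using w[of "?w k" "?t k"] that by simp
  have sl: "(\<Sum>(w, t)\<leftarrow>ws. F w t) = (\<Sum>k<?n. F (?w k) (?t k))" for F :: "real \<Rightarrow> 'b \<Rightarrow> real"
    by (simp add: sum_list_sum_nth case_prod_unfold atLeast0LessThan)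
  have meas[measurable]: "(\<lambda>k. \<sigma> (?t k)) \<in> measurable P borel"
    unfolding P_def by simp
  have "emeasure P (space P) = 1"
    unfolding P_def using w' sum unfolding sl
    by (simp add: space_point_measure emeasure_point_measure_finite) (subst sum_ennreal, auto)
  then have "prob_space P" by (rule prob_spaceI)
  then interpret prob_space P .
  define M where "M = distr P borel (\<lambda>k. \<sigma> (?t k))"
  have "integral\<^sup>L M f = (\<Sum>(w, t)\<leftarrow>ws. w * f (\<sigma> t))" if "f \<in> borel_measurable borel" for f
  proof -
    have "integral\<^sup>L M f = integral\<^sup>L P (\<lambda>k. f (\<sigma> (?t k)))"
      unfolding M_def by (rule integral_distr[OF meas that])
    also have "\<dots> = (\<Sum>k<?n. ?w k * f (\<sigma> (?t k)))"
      unfolding P_def using w' by (subst lebesgue_integral_point_measure_finite) auto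
    finally show ?thesis unfolding sl .
  qed
  moreover have "real_distribution M" unfolding M_def by (rule real_distribution_distr) simp
  ultimately show ?thesis by blast
qed

text \<open>A weak limit of the approximations for growing finite sets of points. All of them live
  on [0, 1], which gives tightness, and products of coordinates of the curve are bounded and
  continuous, so their integrals converge.\<close>

lemma (in halvable_cone) pd_on_moment_measure:
  fixes q :: "nat \<Rightarrow> 'a"
  assumes g: "pd_on S g" and g0: "g 0 = 1" and q: "range q \<subseteq> S"
  shows "\<exists>M. real_distribution M \<and>
    (\<forall>is. integral\<^sup>L M (\<lambda>s. \<Prod>i\<leftarrow>is. schoenberg i s) = g (\<Sum>i\<leftarrow>is. q i))"
proof -
  \<comment> \<open>Stage p handles the indices up to p with an error of 1 / Suc p per factor. The
    interval \<open>{-1<..1}\<close> has the half-open shape used in \<open>tight\<close> and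
    contains [0, 1].\<close>
  define E where "E p M \<longleftrightarrow> real_distribution M \<and> measure M {-1<..1} = 1 \<and>
      (\<forall>is. set is \<subseteq> {..p} \<longrightarrow>
      \<bar>g (\<Sum>i\<leftarrow>is. q i) - integral\<^sup>L M (\<lambda>s. \<Prod>i\<leftarrow>is. schoenberg i s)\<bar> \<le> length is * (1 / Suc p))"
    for p :: nat and M
  have contp: "continuous_on UNIV (\<lambda>s. \<Prod>i\<leftarrow>is. schoenberg i s)" for "is"
    by (induction "is") (auto intro!: continuous_intros continuous_on_schoenberg)
  have rangep: "0 \<le> (\<Prod>i\<leftarrow>is. schoenberg i s) \<and> (\<Prod>i\<leftarrow>is. schoenberg i s) \<le> 1" for "is" s
    by (induction "is") (auto simp: schoenberg_range intro: mult_le_one)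
  have "\<exists>M. E p M" for p
  proof -
    have q': "q ` {..p} \<subseteq> S" using q by auto
    have fin: "finite (q ` {..p})" and pos: "1 / real (Suc p) > 0" by simp_all
    from pd_on_approx_characters[OF g fin q' pos, unfolded g0]
    obtain ws where ws: "\<forall>(w, t)\<in>set ws. 0 \<le> w \<and> (\<forall>a. 0 \<le> t a \<and> t a \<le> 1)"
      "(\<Sum>(w, t)\<leftarrow>ws. w) = 1"
      "\<forall>as. set as \<subseteq> q ` {..p} \<longrightarrow>
         \<bar>g (\<Sum>a\<leftarrow>as. a) - (\<Sum>(w, t)\<leftarrow>ws. w * (\<Prod>a\<leftarrow>as. t a))\<bar> \<le> length as * (1 / real (Suc p))"
      by (elim exE conjE) (rule that)
    \<comment> \<open>One parameter of the curve at which every coordinate i takes the value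
      \<open>t (q i)\<close>.\<close>
    define \<sigma> where "\<sigma> t = (SOME s. 0 \<le> s \<and> s \<le> 1 \<and> (\<forall>i. schoenberg i s = t (q i)))" for t
    have \<sigma>: "0 \<le> \<sigma> t \<and> \<sigma> t \<le> 1 \<and> (\<forall>i. schoenberg i (\<sigma> t) = t (q i))" if "(w, t) \<in> set ws" for w t
    proof -
      have "0 \<le> t (q i) \<and> t (q i) \<le> 1" for i using ws(1) that by blast
      from someI_ex[OF schoenberg_surj[OF this]] show ?thesis unfolding \<sigma>_def .
    qed
    have wn: "0 \<le> w" if "(w, t) \<in> set ws" for w t using ws(1) that by blast
    obtain M where M: "real_distribution M"
      "\<And>f. f \<in> borel_measurable borel \<Longrightarrow> integral\<^sup>L M f = (\<Sum>(w, t)\<leftarrow>ws. w * f (\<sigma> t))"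
      using discrete_distribution[of ws \<sigma>] wn ws(2) by blast
    interpret M: real_distribution M by (rule M)
    have "measure M {-1<..1} = integral\<^sup>L M (indicator {-1<..1})" by simp
    also have "\<dots> = (\<Sum>(w, t)\<leftarrow>ws. w)"
      by (subst M(2)) (use \<sigma> in \<open>force intro!: arg_cong[of _ _ sum_list] map_cong simp: indicator_def\<close>)+
    finally have "measure M {-1<..1} = 1" using ws(2) by simp
    moreover have "\<bar>g (\<Sum>i\<leftarrow>is. q i) - integral\<^sup>L M (\<lambda>s. \<Prod>i\<leftarrow>is. schoenberg i s)\<bar> \<le> length is * (1 / Suc p)"
      if "set is \<subseteq> {..p}" for "is"
    proof -
      have "integral\<^sup>L M (\<lambda>s. \<Prod>i\<leftarrow>is. schoenberg i s) = (\<Sum>(w, t)\<leftarrow>ws. w * (\<Prod>i\<leftarrow>is. schoenberg i (\<sigma> t)))"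
        by (intro M(2) borel_measurable_continuous_onI contp)
      also have "\<dots> = (\<Sum>(w, t)\<leftarrow>ws. w * (\<Prod>a\<leftarrow>map q is. t a))"
        using \<sigma> by (intro arg_cong[of _ _ sum_list] map_cong refl) (auto simp: o_def)
      finally show ?thesis using ws(3)[rule_format, of "map q is"] that by (auto simp: o_def)
    qed
    ultimately show ?thesis using M(1) unfolding E_def by blast
  qed
  then obtain \<mu> where \<mu>: "\<And>p. E p (\<mu> p)" by metis
  have "tight \<mu>" unfolding tight_def
  proof (intro conjI allI impI)
    fix \<epsilon> :: real assume "\<epsilon> > 0"
    then show "\<exists>a b. a < b \<and> (\<forall>n. measure (\<mu> n) {a<..b} > 1 - \<epsilon>)"
      using \<mu> unfolding E_def by (intro exI[of _ "-1"] exI[of _ "1::real"]) auto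
  qed (use \<mu> in \<open>simp add: E_def\<close>)
  from tight_imp_convergent_subsubsequence[OF this strict_mono_id]
  obtain r M where r: "strict_mono r" "real_distribution M" "weak_conv_m (\<mu> \<circ> r) M"
    by (auto simp: o_def)
  have "integral\<^sup>L M (\<lambda>s. \<Prod>i\<leftarrow>is. schoenberg i s) = g (\<Sum>i\<leftarrow>is. q i)" for "is"
  proof (rule LIMSEQ_unique)
    let ?f = "\<lambda>s. \<Prod>i\<leftarrow>is. schoenberg i s"
    show "(\<lambda>n. integral\<^sup>L ((\<mu> \<circ> r) n) ?f) \<longlonglongrightarrow> integral\<^sup>L M ?f"
    proof (rule weak_conv_imp_integral_bdd_continuous_conv)
      show "real_distribution ((\<mu> \<circ> r) n)" for n using \<mu> by (simp add: E_def)
      show "isCont ?f x" for x using contp[of "is"] by (simp add: continuous_on_eq_continuous_at)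
      show "norm (?f x) \<le> 1" for x using rangep[of x "is"] by simp
    qed (use r in \<open>simp_all only: o_def\<close>)
    \<comment> \<open>A single product involves finitely many indices; from stage \<open>p0\<close>
      on they are all covered, because \<open>n \<le> r n\<close>.\<close>
    obtain p0 where p0: "set is \<subseteq> {..p0}" using finite_nat_iff_bounded_le[of "set is"] by auto
    show "(\<lambda>n. integral\<^sup>L ((\<mu> \<circ> r) n) ?f) \<longlonglongrightarrow> g (\<Sum>i\<leftarrow>is. q i)"
    proof (rule Lim_transform_eventually[rotated], rule always_eventually, rule allI, rule refl,
        rule LIM_zero_cancel, rule Lim_null_comparison)
      show "\<forall>\<^sub>F n in sequentially. norm (integral\<^sup>L ((\<mu> \<circ> r) n) ?f - g (\<Sum>i\<leftarrow>is. q i))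
          \<le> length is * (1 / Suc n)"
        using eventually_ge_at_top[of p0]
      proof eventually_elim
        case (elim n)
        have rn: "n \<le> r n" using r(1) by (rule seq_suble)
        then have "set is \<subseteq> {..r n}" using p0 elim by auto
        then have "\<bar>g (\<Sum>i\<leftarrow>is. q i) - integral\<^sup>L (\<mu> (r n)) ?f\<bar> \<le> length is * (1 / Suc (r n))"
          using \<mu>[of "r n"] unfolding E_def by blast
        also have "\<dots> \<le> length is * (1 / Suc n)"
          using rn by (intro mult_left_mono divide_left_mono) auto
        finally show ?case by (simp add: abs_minus_commute)
      qed
      have "(\<lambda>n. real (length is) * (1 / Suc n)) \<longlonglongrightarrow> real (length is) * 0"
        by (intro tendsto_intros LIMSEQ_Suc lim_1_over_n)
      then show "(\<lambda>n. real (length is) * (1 / Suc n)) \<longlonglongrightarrow> 0" by simp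
    qed
  qed
  then show ?thesis using r(2) by blast
qed

section \<open>Bernstein's theorem for cones\<close>

text \<open>A countable dense additive group: countability lets statements that hold almost surely
  at each point hold at all points at once, and sums of points stay in the set.\<close>

definition rational_points :: "'a::euclidean_space set" where
  "rational_points = {x. \<forall>b\<in>Basis. x \<bullet> b \<in> \<rat>}"

lemma countable_rational_points: "countable (rational_points :: 'a::euclidean_space set)"
proof -
  let ?h = "\<lambda>x::'a. restrict (\<lambda>b. x \<bullet> b) Basis"
  have "countable (Basis \<rightarrow>\<^sub>E (\<rat> :: real set) :: ('a \<Rightarrow> real) set)"
    by (intro countable_PiE) (auto simp: countable_rat)
  moreover have "?h ` rational_points \<subseteq> Basis \<rightarrow>\<^sub>E \<rat>"
    by (auto simp: rational_points_def)
  moreover have "inj_on ?h rational_points"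
    by (rule inj_onI) (metis euclidean_eqI restrict_apply')
  ultimately show ?thesis by (meson countable_subset countable_image_inj_on)
qed

lemma rational_points_dense:
  assumes "open U" "x \<in> U" shows "\<exists>y\<in>U. y \<in> rational_points"
proof -
  obtain r where r: "r > 0" "ball x r \<subseteq> U" using assms openE by blast
  obtain a b where ab: "\<forall>i\<in>Basis. a \<bullet> i \<in> \<rat> \<and> b \<bullet> i \<in> \<rat>" "x \<in> box a b" "box a b \<subseteq> ball x r"
    using rational_boxes[OF r(1)] by blast
  have "(1/2) *\<^sub>R (a + b) \<in> box a b" using ab(2) by (fastforce simp: mem_box inner_add_left)
  moreover have "(1/2) *\<^sub>R (a + b) \<in> rational_points"
    using ab(1) by (auto simp: rational_points_def inner_add_left)
  ultimately show ?thesis using ab r by blast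
qed

lemma rational_points_add: "x \<in> rational_points \<Longrightarrow> y \<in> rational_points \<Longrightarrow> x + y \<in> rational_points"
  and rational_points_scaleR: "x \<in> rational_points \<Longrightarrow> c \<in> \<rat> \<Longrightarrow> c *\<^sub>R x \<in> rational_points"
  and rational_points_Basis: "b \<in> Basis \<Longrightarrow> b \<in> rational_points"
  and rational_points_zero: "0 \<in> rational_points"
  by (auto simp: rational_points_def inner_add_left inner_Basis)

lemma common_denominator:
  assumes "finite B" "\<And>b. b \<in> B \<Longrightarrow> f b \<in> (\<rat> :: real set)"
  shows "\<exists>m::nat. m > 0 \<and> (\<forall>b\<in>B. real m * f b \<in> \<int>)"
  using assms
proof (induction B rule: finite_induct)
  case empty then show ?case by (auto intro!: exI[of _ 1])
next
  case (insert b B)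
  then obtain m where m: "m > 0" "\<forall>b\<in>B. real m * f b \<in> \<int>" by auto
  obtain k :: int and n :: int where kn: "n > 0" "f b = of_int k / of_int n"
    using insert.prems[of b] by (auto elim: Rats_cases')
  have n: "real (nat n) = of_int n" using kn by simp
  have "real (m * nat n) * f c \<in> \<int>" if c: "c \<in> insert b B" for c
  proof (cases "c = b")
    case True
    have "real (m * nat n) * f b = of_int (int m * k)" using kn n by simp
    then show ?thesis using True by (metis Ints_of_int)
  next
    case False
    have "real (m * nat n) * f c = of_int n * (real m * f c)" using n by simp
    moreover have "real m * f c \<in> \<int>" using m(2) c False by blast
    ultimately show ?thesis by (simp only: Ints_mult Ints_of_int)
  qed
  then show ?case using m(1) kn(1) by (intro exI[of _ "m * nat n"]) auto
qed

section \<open>Open convex cones and linear functionals\<close>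

lemma open_convex_cone_add:
  assumes "open_convex_cone \<Omega>" "x \<in> \<Omega>" "y \<in> \<Omega>" shows "x + y \<in> \<Omega>"
proof -
  have "(1/2) *\<^sub>R x + (1/2) *\<^sub>R y \<in> \<Omega>"
    using assms by (intro convexD) (auto simp: open_convex_cone_def)
  then have "2 *\<^sub>R ((1/2) *\<^sub>R x + (1/2) *\<^sub>R y) \<in> \<Omega>"
    using assms(1) unfolding open_convex_cone_def by simp
  then show ?thesis by (simp add: scaleR_add_right)
qed

lemma open_convex_cone_halvable:
  assumes "open_convex_cone \<Omega>" shows "halvable_cone (insert 0 \<Omega>)"
  by standard (use assms open_convex_cone_add[OF assms] in \<open>auto simp: open_convex_cone_def\<close>)

text \<open>A ball around a rational point \<open>e0\<close> leaves room for b / n; scaling by n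
  turns this into room for b. The values at e and e + b will determine a linear functional.\<close>

lemma open_convex_cone_rational_center:
  assumes \<Omega>: "open_convex_cone (\<Omega> :: 'a::euclidean_space set)"
  shows "\<exists>e\<in>\<Omega>. e \<in> rational_points \<and> (\<forall>b\<in>Basis. e + b \<in> \<Omega>)"
proof -
  obtain e0 where e0: "e0 \<in> \<Omega>" "e0 \<in> rational_points"
    using \<Omega> rational_points_dense unfolding open_convex_cone_def by blast
  obtain r where r: "r > 0" "ball e0 r \<subseteq> \<Omega>"
    using \<Omega> e0(1) openE unfolding open_convex_cone_def by blast
  obtain n where n: "n > 0" "inverse (real n) < r" using real_arch_inverse[of r] r by auto
  let ?e = "real n *\<^sub>R e0"
  have "?e + b \<in> \<Omega>" if b: "b \<in> Basis" for b
  proof -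
    have "e0 + inverse (real n) *\<^sub>R b \<in> \<Omega>"
      using r n b by (intro subsetD[OF r(2)]) (auto simp: dist_norm)
    then have "real n *\<^sub>R (e0 + inverse (real n) *\<^sub>R b) \<in> \<Omega>"
      using \<Omega> n(1) unfolding open_convex_cone_def by simp
    then show ?thesis using n(1) by (simp add: scaleR_add_right)
  qed
  moreover have "?e \<in> \<Omega>" using \<Omega> n(1) e0 unfolding open_convex_cone_def by simp
  ultimately show ?thesis using rational_points_scaleR[OF e0(2), of "real n"] by auto
qed

text \<open>After clearing denominators both sides of the identity
  \<open>m x + \<Sum> z\<^sup>- (e + b) + z\<^sup>+ e = \<Sum> z\<^sup>+ (e + b) + z\<^sup>- e\<close>, where \<open>m x = \<Sum> z b\<close>, are
  sums of points of the semigroup.\<close>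

lemma additive_on_cone_linear:
  fixes \<phi> :: "'a::euclidean_space \<Rightarrow> real"
  assumes \<Omega>: "open_convex_cone \<Omega>" and Q: "Q = insert 0 \<Omega> \<inter> rational_points"
    and e: "e \<in> \<Omega>" "e \<in> rational_points" "\<And>b. b \<in> Basis \<Longrightarrow> e + b \<in> \<Omega>"
    and add: "\<And>x y. x \<in> Q \<Longrightarrow> y \<in> Q \<Longrightarrow> \<phi> (x + y) = \<phi> x + \<phi> y" and x: "x \<in> Q"
  shows "\<phi> x = (\<Sum>b\<in>Basis. (\<phi> (e + b) - \<phi> e) *\<^sub>R b) \<bullet> x"
proof -
  interpret halvable_cone "insert 0 \<Omega>" by (rule open_convex_cone_halvable[OF \<Omega>])
  have Q0: "0 \<in> Q" and Qadd: "\<And>x y. x \<in> Q \<Longrightarrow> y \<in> Q \<Longrightarrow> x + y \<in> Q"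
    using add_in unfolding Q by (auto simp del: insert_iff intro: rational_points_zero rational_points_add zero_in)
  have \<phi>0: "\<phi> 0 = 0" using add[OF Q0 Q0] by simp
  have nat: "real n *\<^sub>R y \<in> Q \<and> \<phi> (real n *\<^sub>R y) = real n * \<phi> y" if y: "y \<in> Q" for n y
    by (induction n) (auto simp: \<phi>0 Q0 scaleR_add_left add Qadd y algebra_simps)
  have sum: "(\<Sum>b\<in>B. y b) \<in> Q \<and> \<phi> (\<Sum>b\<in>B. y b) = (\<Sum>b\<in>B. \<phi> (y b))"
    if "finite B" "\<And>b. b \<in> B \<Longrightarrow> y b \<in> Q" for B :: "'a set" and y
    using that by (induction B rule: finite_induct) (auto simp: Q0 \<phi>0 add Qadd)
  obtain m where m: "m > 0" "\<And>b. b \<in> Basis \<Longrightarrow> real m * (x \<bullet> b) \<in> \<int>"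
    using common_denominator[of Basis "\<lambda>b. x \<bullet> b"] x unfolding Q rational_points_def by auto
  define z where "z b = \<lfloor>real m * (x \<bullet> b)\<rfloor>" for b
  have z: "of_int (z b) = real m * (x \<bullet> b)" if "b \<in> Basis" for b
    using m(2)[OF that] by (simp add: z_def)
  define p where "p b = nat (z b)" for b
  define k where "k b = nat (- z b)" for b
  have pk: "real (p b) - real (k b) = real m * (x \<bullet> b)" if "b \<in> Basis" for b
    using z[OF that] by (cases "z b \<ge> 0") (auto simp: p_def k_def)
  have eQ: "e \<in> Q" "\<And>b. b \<in> Basis \<Longrightarrow> e + b \<in> Q"
    using e rational_points_add rational_points_Basis by (auto simp: Q)
  let ?l = "\<lambda>b. real (k b) *\<^sub>R (e + b) + real (p b) *\<^sub>R e"
  let ?r = "\<lambda>b. real (p b) *\<^sub>R (e + b) + real (k b) *\<^sub>R e"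
  have lr: "?l b \<in> Q" "?r b \<in> Q" "\<phi> (?l b) = k b * \<phi> (e + b) + p b * \<phi> e"
    "\<phi> (?r b) = p b * \<phi> (e + b) + k b * \<phi> e" if "b \<in> Basis" for b
    using nat[OF eQ(1)] nat[OF eQ(2)[OF that]] by (simp_all only: Qadd add simp_thms)
  have "real m *\<^sub>R x + (\<Sum>b\<in>Basis. ?l b) = (\<Sum>b\<in>Basis. ?r b)"
  proof -
    have "(\<Sum>b\<in>Basis. ?r b) - (\<Sum>b\<in>Basis. ?l b) = (\<Sum>b\<in>Basis. (real (p b) - real (k b)) *\<^sub>R b)"
      by (simp add: sum_subtractf[symmetric] algebra_simps)
    also have "\<dots> = (\<Sum>b\<in>Basis. real m *\<^sub>R ((x \<bullet> b) *\<^sub>R b))"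
      by (intro sum.cong refl) (simp add: pk)
    also have "\<dots> = real m *\<^sub>R x" using euclidean_representation[of "real m *\<^sub>R x"] by simp
    finally show ?thesis by (simp add: algebra_simps)
  qed
  then have "\<phi> (real m *\<^sub>R x) + \<phi> (\<Sum>b\<in>Basis. ?l b) = \<phi> (\<Sum>b\<in>Basis. ?r b)"
    using add[of "real m *\<^sub>R x" "\<Sum>b\<in>Basis. ?l b"] nat[OF x, of m] sum[of Basis ?l] lr(1) by simp
  then have "real m * \<phi> x + (\<Sum>b\<in>Basis. k b * \<phi> (e + b) + p b * \<phi> e)
      = (\<Sum>b\<in>Basis. p b * \<phi> (e + b) + k b * \<phi> e)"
    using nat[OF x, of m] sum[of Basis ?l] sum[of Basis ?r] lr by simp
  then have "real m * \<phi> x = (\<Sum>b\<in>Basis. (real (p b) - real (k b)) * (\<phi> (e + b) - \<phi> e))"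
    by (simp add: algebra_simps sum.distrib sum_subtractf)
  also have "\<dots> = real m * (\<Sum>b\<in>Basis. (\<phi> (e + b) - \<phi> e) * (x \<bullet> b))"
    unfolding sum_distrib_left by (intro sum.cong refl) (simp add: pk)
  finally have "\<phi> x = (\<Sum>b\<in>Basis. (\<phi> (e + b) - \<phi> e) * (x \<bullet> b))" using m(1) by simp
  then show ?thesis by (simp add: inner_sum_left inner_commute[of x])
qed

lemma pd_on_cmult:
  assumes g: "pd_on S g" and c: "0 \<le> c"
  shows "pd_on S (\<lambda>x. c * g x)"
proof -
  have "(\<Sum>(a, x)\<leftarrow>xs. \<Sum>(b, y)\<leftarrow>xs. a * b * (c * g (x + y))) =
      c * (\<Sum>(a, x)\<leftarrow>xs. \<Sum>(b, y)\<leftarrow>xs. a * b * g (x + y))" for xs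
    by (simp add: case_prod_unfold sum_list_const_mult[symmetric] ac_simps)
  moreover obtain M where "\<forall>x\<in>S. g x \<le> M" using g unfolding pd_on_def by blast
  then have "\<forall>x\<in>S. c * g x \<le> c * M" using c by (auto intro: mult_left_mono)
  ultimately show ?thesis using g c unfolding pd_on_def by (auto intro!: exI[of _ "c * M"])
qed

lemma closed_dual_halfspaces: "closed {v::'a::euclidean_space. \<forall>x\<in>A. 0 \<le> v \<bullet> x}"
proof -
  have "{v::'a. \<forall>x\<in>A. 0 \<le> v \<bullet> x} = (\<Inter>x\<in>A. {v. 0 \<le> v \<bullet> x})" by auto
  moreover have "closed {v::'a. 0 \<le> v \<bullet> x}" for x
    by (intro closed_Collect_le continuous_intros)
  ultimately show ?thesis by auto
qed

text \<open>The coordinates \<open>t x\<close> of the limit measure \<open>P\<close> are random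
  variables with prescribed moments. Almost surely they are multiplicative and positive in x, so
  \<open>- ln (t x)\<close> is additive, hence given by a vector \<open>\<alpha>\<close>, and the
  law of \<open>\<alpha>\<close> is the measure sought.\<close>

lemma cone_bernstein_normalized:
  fixes g :: "'a::euclidean_space \<Rightarrow> real"
  assumes \<Omega>: "open_convex_cone \<Omega>" and g: "pd_on (insert 0 \<Omega>) g"
    and cont: "continuous_on (insert 0 \<Omega>) g" and g0: "g 0 = 1"
  shows "\<exists>M. prob_space M \<and> sets M = sets borel \<and> (AE v in M. \<forall>x\<in>\<Omega>. 0 \<le> v \<bullet> x) \<and>
    (\<forall>x\<in>insert 0 \<Omega>. g x = (LINT v|M. exp (- (v \<bullet> x))))"
proof -
  define S where "S = insert 0 \<Omega>"
  interpret halvable_cone S unfolding S_def by (rule open_convex_cone_halvable[OF \<Omega>])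
  have scale: "c *\<^sub>R x \<in> S" if "x \<in> S" "c > 0" for c x
    using that \<Omega> unfolding S_def open_convex_cone_def by auto
  define Q where "Q = S \<inter> rational_points"
  have "countable Q" unfolding Q_def using countable_rational_points by (intro countable_Int2)
  have Q0: "0 \<in> Q" by (simp add: Q_def zero_in rational_points_zero)
  have Qadd: "x + y \<in> Q" if "x \<in> Q" "y \<in> Q" for x y
    using that by (auto simp: Q_def add_in rational_points_add)
  have Qdiv: "(1 / real n) *\<^sub>R x \<in> Q" if "x \<in> Q" "n > 0" for x and n :: nat
    using that scale[of x "1 / real n"] by (auto simp: Q_def intro: rational_points_scaleR)
  define q where "q = from_nat_into Q"
  have rq: "range q = Q" unfolding q_def using Q0 \<open>countable Q\<close> by (intro range_from_nat_into) auto
  have "range q \<subseteq> S" unfolding rq Q_def by simp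
  from pd_on_moment_measure[OF g[folded S_def] g0 this]
  obtain P where P: "real_distribution P"
    "\<And>is. integral\<^sup>L P (\<lambda>s. \<Prod>i\<leftarrow>is. schoenberg i s) = g (\<Sum>i\<leftarrow>is. q i)" by blast
  interpret P: real_distribution P by (rule P)
  define t where "t x = schoenberg (SOME i. q i = x)" for x
  have ix: "q (SOME i. q i = x) = x" if "x \<in> Q" for x
    using that rq by (metis (mono_tags) imageE someI)
  have tr: "0 \<le> t x s" "t x s \<le> 1" for x s by (auto simp: t_def schoenberg_range)
  have tm[measurable]: "t x \<in> borel_measurable P" for x
    unfolding t_def by (simp add: borel_measurable_continuous_onI continuous_on_schoenberg)
  have mom: "integral\<^sup>L P (\<lambda>s. \<Prod>x\<leftarrow>xs. t x s) = g (\<Sum>x\<leftarrow>xs. x)" if "set xs \<subseteq> Q" for xs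
  proof -
    have "map q (map (\<lambda>x. SOME i. q i = x) xs) = xs" using that ix by (intro map_idI[THEN trans[OF map_map]]) auto
    then show ?thesis
      using P(2)[of "map (\<lambda>x. SOME i. q i = x) xs"] by (simp add: t_def o_def)
  qed
  have ti: "integrable P (\<lambda>s. \<Prod>x\<leftarrow>xs. t x s)" for xs
  proof (rule P.integrable_const_bound[of _ 1])
    have "0 \<le> (\<Prod>x\<leftarrow>xs. t x s) \<and> (\<Prod>x\<leftarrow>xs. t x s) \<le> 1" for s
      by (induction xs) (auto simp: tr intro: mult_le_one)
    then show "AE s in P. norm (\<Prod>x\<leftarrow>xs. t x s) \<le> 1" by simp
    show "(\<lambda>s. \<Prod>x\<leftarrow>xs. t x s) \<in> borel_measurable P"
      by (induction xs) auto
  qed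
  \<comment> \<open>The square expands into three moments, each equal to \<open>g\<close> at 2 x + 2
    y; they enter with the factors 1, -2 and 1, so the square has integral 0.\<close>
  have "AE s in P. t (x + y) s = t x s * t y s" if xy: "x \<in> Q" "y \<in> Q" for x y
  proof -
    let ?z = "x + y"
    let ?I = "\<lambda>xs s. \<Prod>x\<leftarrow>xs. t x s"
    have eq: "(t ?z s - t x s * t y s)\<^sup>2 = ?I [?z, ?z] s - 2 * ?I [?z, x, y] s + ?I [x, y, x, y] s" for s
      by (simp add: power2_eq_square algebra_simps)
    have int: "integrable P (\<lambda>s. (t ?z s - t x s * t y s)\<^sup>2)"
      unfolding eq by (intro Bochner_Integration.integrable_add Bochner_Integration.integrable_diff integrable_mult_right ti)
    have "integral\<^sup>L P (\<lambda>s. (t ?z s - t x s * t y s)\<^sup>2) =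
        integral\<^sup>L P (?I [?z, ?z]) - 2 * integral\<^sup>L P (?I [?z, x, y]) + integral\<^sup>L P (?I [x, y, x, y])"
      unfolding eq using ti by (simp del: list.map prod_list.Cons)
    also have "\<dots> = 0"
      using xy Qadd[OF xy] by (subst (1 2 3) mom) (auto simp: ac_simps)
    finally have "AE s in P. (t ?z s - t x s * t y s)\<^sup>2 = 0"
      using integral_nonneg_eq_0_iff_AE[OF int] by simp
    then show ?thesis by simp
  qed
  then have AE_mult: "AE s in P. \<forall>x\<in>Q. \<forall>y\<in>Q. t (x + y) s = t x s * t y s"
    using \<open>countable Q\<close> by (simp add: AE_ball_countable)
  have mult_nat: "t (real (Suc n) *\<^sub>R x) s = t x s ^ Suc n"
    if "\<forall>x\<in>Q. \<forall>y\<in>Q. t (x + y) s = t x s * t y s" "x \<in> Q" for n x s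
  proof -
    have "real (Suc n) *\<^sub>R x \<in> Q \<and> t (real (Suc n) *\<^sub>R x) s = t x s ^ Suc n"
    proof (induction n)
      case (Suc n)
      have "real (Suc (Suc n)) *\<^sub>R x = x + real (Suc n) *\<^sub>R x" by (simp add: scaleR_add_left scaleR_2)
      then show ?case using Suc that Qadd by simp
    qed (use that in simp)
    then show ?thesis by simp
  qed
  \<comment> \<open>Where \<open>t x\<close> vanishes, \<open>t\<close> vanishes at x / (n + 1) as
    well, since its power is \<open>t x\<close>. The probability of this event is thus at most
    \<open>1 - g (x / (n + 1))\<close>, which tends to \<open>1 - g 0 = 0\<close>.\<close>
  have "AE s in P. t x s > 0" if x: "x \<in> Q" for x
  proof -
    let ?A = "{s \<in> space P. t x s = 0}"
    have A[measurable]: "?A \<in> sets P" by measurable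
    have le: "measure P ?A \<le> 1 - g ((1 / real (Suc n)) *\<^sub>R x)" for n
    proof -
      let ?y = "(1 / real (Suc n)) *\<^sub>R x"
      have yQ: "?y \<in> Q" using Qdiv[OF x, of "Suc n"] by simp
      have "measure P ?A = integral\<^sup>L P (indicator ?A)" by simp
      also have "\<dots> \<le> integral\<^sup>L P (\<lambda>s. 1 - t ?y s)"
      proof (rule integral_mono_AE)
        show "integrable P (\<lambda>s. 1 - t ?y s)" using ti[of "[?y]"] by simp
        show "AE s in P. indicator ?A s \<le> 1 - t ?y s"
          using AE_mult
        proof eventually_elim
          case (elim s)
          have "t x s = t ?y s ^ Suc n" using mult_nat[OF elim yQ, of n] by simp
          then show ?case using tr[of ?y s] by (auto simp: indicator_def)
        qed
        show "integrable P (indicator ?A :: real \<Rightarrow> real)"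
          by (rule integrable_real_indicator[OF A]) (simp add: P.emeasure_eq_measure)
      qed
      also have "\<dots> = 1 - g ?y" using ti[of "[?y]"] mom[of "[?y]"] yQ P.prob_space by simp
      finally show ?thesis .
    qed
    have "(\<lambda>n. g ((1 / real (Suc n)) *\<^sub>R x)) \<longlonglongrightarrow> g 0"
    proof (rule continuous_on_tendsto_compose[OF cont])
      have "(\<lambda>n. (1 / real (Suc n)) *\<^sub>R x) \<longlonglongrightarrow> 0 *\<^sub>R x"
        by (intro tendsto_intros LIMSEQ_Suc lim_1_over_n)
      then show "(\<lambda>n. (1 / real (Suc n)) *\<^sub>R x) \<longlonglongrightarrow> 0" by simp
      show "\<forall>\<^sub>F n in sequentially. (1 / real (Suc n)) *\<^sub>R x \<in> insert 0 \<Omega>"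
        using Qdiv[OF x] unfolding Q_def S_def by (intro always_eventually) (metis IntD1 zero_less_Suc)
    qed simp
    then have "(\<lambda>n. 1 - g ((1 / real (Suc n)) *\<^sub>R x)) \<longlonglongrightarrow> 1 - g 0" by (intro tendsto_intros)
    then have "measure P ?A \<le> 0" using le g0
      by (intro LIMSEQ_le_const[where X = "\<lambda>n. 1 - g ((1 / real (Suc n)) *\<^sub>R x)"]) auto
    then have "emeasure P ?A = 0" by (simp add: P.emeasure_eq_measure measure_le_0_iff)
    then have "AE s in P. t x s \<noteq> 0" by (subst AE_iff_measurable[OF A]) auto
    then show ?thesis using tr by (auto simp: less_le)
  qed
  then have AE_pos: "AE s in P. \<forall>x\<in>Q. t x s > 0"
    using \<open>countable Q\<close> by (simp add: AE_ball_countable)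
  obtain e where e: "e \<in> \<Omega>" "e \<in> rational_points" "\<And>b. b \<in> Basis \<Longrightarrow> e + b \<in> \<Omega>"
    using open_convex_cone_rational_center[OF \<Omega>] by blast
  \<comment> \<open>The coordinate at b is the increment of \<open>- ln t\<close> from e to e +
    b.\<close>
  define \<alpha> where "\<alpha> s = (\<Sum>b\<in>Basis. (ln (t e s) - ln (t (e + b) s)) *\<^sub>R b)" for s
  have am[measurable]: "\<alpha> \<in> borel_measurable P" unfolding \<alpha>_def by measurable
  have AE_exp: "AE s in P. \<forall>x\<in>Q. t x s = exp (- (\<alpha> s \<bullet> x))"
    using AE_mult AE_pos
  proof eventually_elim
    case (elim s)
    show ?case
    proof
      fix x assume x: "x \<in> Q"
      have "- ln (t x s) = (\<Sum>b\<in>Basis. (- ln (t (e + b) s) - - ln (t e s)) *\<^sub>R b) \<bullet> x"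
        by (rule additive_on_cone_linear[OF \<Omega> Q_def[unfolded S_def] e _ x])
           (use elim in \<open>auto simp: ln_mult\<close>)
      then have "ln (t x s) = - (\<alpha> s \<bullet> x)" by (simp add: \<alpha>_def)
      then show "t x s = exp (- (\<alpha> s \<bullet> x))" using elim x by (metis exp_ln)
    qed
  qed
  define M where "M = distr P borel \<alpha>"
  interpret M: prob_space M unfolding M_def by (rule P.prob_space_distr) simp
  \<comment> \<open>If \<open>\<alpha> s\<close> were negative somewhere on \<Omega>, it would be so
    at a rational y, and then \<open>t y s > 1\<close>.\<close>
  have "AE s in P. \<forall>x\<in>\<Omega>. 0 \<le> \<alpha> s \<bullet> x"
    using AE_exp
  proof eventually_elim
    case (elim s)
    show ?case
    proof (rule ballI, rule ccontr)
      fix x assume x: "x \<in> \<Omega>" "\<not> 0 \<le> \<alpha> s \<bullet> x"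
      have "open \<Omega>" using \<Omega> unfolding open_convex_cone_def by blast
      then have "open (\<Omega> \<inter> {x. \<alpha> s \<bullet> x < 0})" by (intro open_Int open_halfspace_lt)
      moreover have "x \<in> \<Omega> \<inter> {x. \<alpha> s \<bullet> x < 0}" using x by simp
      ultimately obtain y where y: "y \<in> \<Omega>" "\<alpha> s \<bullet> y < 0" "y \<in> rational_points"
        using rational_points_dense by blast
      then have "t y s = exp (- (\<alpha> s \<bullet> y))" using elim by (auto simp: Q_def S_def)
      then show False using tr[of y s] y by simp
    qed
  qed
  then have AE_dual: "AE v in M. \<forall>x\<in>\<Omega>. 0 \<le> v \<bullet> x"
    unfolding M_def
    by (subst AE_distr_iff) (use closed_dual_halfspaces[of \<Omega>] in \<open>auto intro: borel_closed\<close>)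
  have rat: "g x = (LINT v|M. exp (- (v \<bullet> x)))" if x: "x \<in> Q" for x
  proof -
    have "(LINT v|M. exp (- (v \<bullet> x))) = (LINT s|P. exp (- (\<alpha> s \<bullet> x)))"
      unfolding M_def by (subst integral_distr) auto
    also have "\<dots> = (LINT s|P. t x s)"
      by (rule integral_cong_AE) (use AE_exp x in \<open>auto elim: eventually_mono\<close>)
    also have "\<dots> = g x" using mom[of "[x]"] x by simp
    finally show ?thesis by simp
  qed
  \<comment> \<open>Both sides are continuous along rational points tending to x; on the right the
    exponentials are dominated by 1, because v is almost surely nonnegative on \<Omega>.\<close>
  have "g x = (LINT v|M. exp (- (v \<bullet> x)))" if x: "x \<in> insert 0 \<Omega>" for x
  proof (cases "x = 0")
    case True then show ?thesis using rat[OF Q0] by simp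
  next
    case False
    then have x: "x \<in> \<Omega>" using x by simp
    have "x \<in> closure (\<Omega> \<inter> rational_points)"
      unfolding closure_iff_nhds_not_empty
    proof clarify
      fix A U assume "U \<subseteq> A" "open U" "x \<in> U" "\<Omega> \<inter> rational_points \<inter> A = {}"
      then show False using rational_points_dense[of "U \<inter> \<Omega>" x] x \<Omega>
        unfolding open_convex_cone_def by (metis IntD1 IntD2 IntI disjoint_iff open_Int subsetD)
    qed
    then obtain y where y: "\<And>n. y n \<in> \<Omega> \<inter> rational_points" "y \<longlonglongrightarrow> x"
      unfolding closure_sequential by blast
    have "(\<lambda>n. g (y n)) \<longlonglongrightarrow> g x"
      by (rule continuous_on_tendsto_compose[OF cont y(2)]) (use x y in auto)
    moreover have "(\<lambda>n. g (y n)) \<longlonglongrightarrow> (LINT v|M. exp (- (v \<bullet> x)))"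
    proof -
      have "(\<lambda>n. (LINT v|M. exp (- (v \<bullet> y n)))) \<longlonglongrightarrow> (LINT v|M. exp (- (v \<bullet> x)))"
      proof (rule integral_dominated_convergence[where w = "\<lambda>_. 1"])
        show "AE v in M. (\<lambda>n. exp (- (v \<bullet> y n))) \<longlonglongrightarrow> exp (- (v \<bullet> x))"
          by (intro AE_I2 tendsto_intros y(2))
        show "AE v in M. norm (exp (- (v \<bullet> y n))) \<le> 1" for n
          using AE_dual by eventually_elim (use y in auto)
        show "integrable M (\<lambda>_. 1 :: real)" by simp
      qed (auto simp: M_def)
      moreover have "(LINT v|M. exp (- (v \<bullet> y n))) = g (y n)" for n
        using rat[of "y n"] y(1)[of n] by (simp add: Q_def S_def)
      ultimately show ?thesis by simp
    qed
    ultimately show ?thesis by (rule LIMSEQ_unique)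
  qed
  then show ?thesis using AE_dual M.prob_space_axioms by (intro exI[of _ M]) (simp add: M_def)
qed

theorem cone_bernstein:
  fixes g :: "'a::euclidean_space \<Rightarrow> real"
  assumes \<Omega>: "open_convex_cone \<Omega>" and g: "pd_on (insert 0 \<Omega>) g"
    and cont: "continuous_on (insert 0 \<Omega>) g"
  shows "\<exists>M. finite_measure M \<and> sets M = sets borel \<and> (AE v in M. \<forall>x\<in>\<Omega>. 0 \<le> v \<bullet> x) \<and>
    (\<forall>x\<in>insert 0 \<Omega>. g x = (LINT v|M. exp (- (v \<bullet> x))))"
proof -
  interpret halvable_cone "insert 0 \<Omega>" by (rule open_convex_cone_halvable[OF \<Omega>])
  show ?thesis
  proof (cases "g 0 = 0")
    case True
    have "g x = 0" if "x \<in> insert 0 \<Omega>" for x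
      using pd_on_le_zero[OF g that] pd_on_nonneg[OF g that] True by simp
    moreover have "AE v in null_measure borel. \<forall>x\<in>\<Omega>. 0 \<le> v \<bullet> x"
      by (rule AE_I[of _ _ UNIV]) auto
    ultimately show ?thesis
      by (intro exI[of _ "null_measure borel"]) (auto intro!: finite_measureI simp: integral_null_measure)
  next
    case False
    then have p: "g 0 > 0" using pd_on_nonneg[OF g zero_in] by simp
    have "0 \<le> 1 / g 0" "continuous_on (insert 0 \<Omega>) (\<lambda>x. 1 / g 0 * g x)" "1 / g 0 * g 0 = 1"
      using p cont by (auto intro!: continuous_intros)
    from cone_bernstein_normalized[OF \<Omega> pd_on_cmult[OF g this(1)] this(2,3)]
    obtain M where M: "prob_space M" "sets M = sets borel" "AE v in M. \<forall>x\<in>\<Omega>. 0 \<le> v \<bullet> x"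
      "\<forall>x\<in>insert 0 \<Omega>. 1 / g 0 * g x = (LINT v|M. exp (- (v \<bullet> x)))"
      by (elim exE conjE) (rule that)
    interpret M: prob_space M by fact
    have meas[measurable]: "f \<in> borel_measurable M" if "f \<in> borel_measurable borel" for f :: "'a \<Rightarrow> real"
      using that measurable_cong_sets[OF M(2) refl] by blast
    let ?N = "density M (\<lambda>_. ennreal (g 0))"
    have "finite_measure ?N"
      by (rule finite_measureI) (simp add: emeasure_density_const M.emeasure_space_1 ennreal_mult_less_top p)
    moreover have "AE v in ?N. \<forall>x\<in>\<Omega>. 0 \<le> v \<bullet> x"
      using M(3) by (simp add: AE_density)
    moreover have "g x = (LINT v|?N. exp (- (v \<bullet> x)))" if "x \<in> insert 0 \<Omega>" for x
    proof -
      have "(LINT v|?N. exp (- (v \<bullet> x))) = (LINT v|M. g 0 * exp (- (v \<bullet> x)))"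
        using p by (intro integral_real_density) auto
      also have "\<dots> = g 0 * (1 / g 0 * g x)" using bspec[OF M(4) that] by simp
      finally show ?thesis using p by simp
    qed
    moreover have "sets ?N = sets borel" using M(2) by simp
    ultimately show ?thesis by blast
  qed
qed

section \<open>The convolution algebra of test functions\<close>

definition cc :: "('a::euclidean_space \<Rightarrow> complex) \<Rightarrow> bool" where
  "cc f \<longleftrightarrow> continuous_on UNIV f \<and> compact (supp f)"

lemma cc_continuous: "cc f \<Longrightarrow> continuous_on S f"
  unfolding cc_def using continuous_on_subset[of UNIV f S] by simp

lemma not_in_supp: "x \<notin> supp f \<Longrightarrow> f x = 0"
  unfolding supp_def using subsetD[OF closure_subset, of x "{x. f x \<noteq> 0}"] by auto

lemma compact_supp_subset:
  assumes "compact K" "\<And>x. x \<notin> K \<Longrightarrow> f x = 0"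
  shows "supp f \<subseteq> K" "compact (supp f)"
proof -
  show 1: "supp f \<subseteq> K"
    unfolding supp_def using assms by (intro closure_minimal compact_imp_closed) auto
  have "closed (supp f)" by (simp add: supp_def)
  then show "compact (supp f)"
    using 1 assms(1) compact_Int_closed[of K "supp f"] by (simp add: inf.absorb2)
qed

lemma ccI:
  assumes "continuous_on UNIV f" "compact K" "\<And>x. x \<notin> K \<Longrightarrow> f x = 0"
  shows "cc f"
  using assms compact_supp_subset[of K f] by (simp add: cc_def)

lemma cc_measurable: "cc f \<Longrightarrow> f \<in> borel_measurable borel"
  by (simp add: borel_measurable_continuous_onI cc_def)

lemma cc_uniform:
  assumes "cc f" "e > 0"
  shows "\<exists>d>0. \<forall>x y. dist x y < d \<longrightarrow> cmod (f x - f y) < e"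
proof -
  \<comment> \<open>The closed neighbourhood of the support of radius 1. If one of two points at
    distance below 1 lies in the support, both lie in \<open>K\<close>; otherwise f vanishes at
    both.\<close>
  define K where "K = {x + y |x y. x \<in> supp f \<and> y \<in> cball 0 1}"
  have "compact K" unfolding K_def using assms(1) by (intro compact_sums) (auto simp: cc_def)
  then have "uniformly_continuous_on K f"
    by (rule compact_uniformly_continuous[OF cc_continuous[OF assms(1)]])
  then obtain d where d: "d > 0" "\<And>x y. x \<in> K \<Longrightarrow> y \<in> K \<Longrightarrow> dist x y < d \<Longrightarrow> dist (f x) (f y) < e"
    using assms(2) unfolding uniformly_continuous_on_def by blast
  have near: "x \<in> K" if "y \<in> supp f" "dist x y < 1" for x y
  proof -
    have "x = y + (x - y)" "x - y \<in> cball 0 1" using that(2) by (auto simp: dist_norm norm_minus_commute)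
    then show ?thesis using that(1) unfolding K_def by blast
  qed
  have "cmod (f x - f y) < e" if xy: "dist x y < min d 1" for x y
  proof (cases "x \<in> supp f \<or> y \<in> supp f")
    case True
    then have "x \<in> K" "y \<in> K" using near[of x x] near[of y y] near[of x y] near[of y x] xy
      by (auto simp: dist_commute)
    then show ?thesis using d(2) xy by (simp add: dist_norm)
  next
    case False
    then show ?thesis using not_in_supp[of x f] not_in_supp[of y f] assms(2) by simp
  qed
  then show ?thesis using d(1) by (intro exI[of _ "min d 1"]) auto
qed

lemma continuous_compact_support_integrable:
  fixes f :: "'a::euclidean_space \<Rightarrow> 'b::{banach, second_countable_topology}"
  assumes "compact K" "continuous_on K f" "\<And>x. x \<notin> K \<Longrightarrow> f x = 0"
  shows "integrable lborel f"
proof -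
  have "(\<lambda>x. indicator K x *\<^sub>R f x) = f" using assms(3) by (auto simp: indicator_def fun_eq_iff)
  then show ?thesis using borel_integrable_compact[OF assms(1,2)] by simp
qed

lemma cc_integrable: "cc f \<Longrightarrow> integrable lborel f"
  by (rule continuous_compact_support_integrable[of "supp f"])
     (auto simp: cc_def not_in_supp cc_continuous)

lemma cc_mult_right: "cc f \<Longrightarrow> continuous_on UNIV g \<Longrightarrow> cc (\<lambda>x. f x * g x)"
  by (rule ccI[of _ "supp f"]) (auto simp: cc_def not_in_supp intro!: continuous_intros)

lemma cc_shift: assumes "cc f" shows "cc (\<lambda>x. f (x - y))"
proof (rule ccI[of _ "(\<lambda>x. x + y) ` supp f"])
  show "continuous_on UNIV (\<lambda>x. f (x - y))"
    using assms by (intro continuous_on_compose2[OF cc_continuous[OF assms]]) (auto intro!: continuous_intros)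
  show "compact ((\<lambda>x. x + y) ` supp f)"
    using assms by (intro compact_continuous_image continuous_intros) (auto simp: cc_def)
  show "f (x - y) = 0" if "x \<notin> (\<lambda>x. x + y) ` supp f" for x
  proof (rule not_in_supp[of "x - y" f], rule notI)
    assume "x - y \<in> supp f"
    then have "x \<in> (\<lambda>x. x + y) ` supp f" by (intro image_eqI[of _ _ "x - y"]) auto
    then show False using that by simp
  qed
qed

lemma continuous_on_reflect:
  assumes "cc f" shows "continuous_on UNIV (\<lambda>y. f (x - y))"
  by (intro continuous_on_compose2[OF cc_continuous[OF assms]]) (auto intro!: continuous_intros)

lemma cc_conv_integrand:
  assumes "cc f" "cc g" shows "cc (\<lambda>y. f y * g (x - y))"
  using assms by (intro cc_mult_right continuous_on_reflect)

lemmas conv_integrable = cc_integrable[OF cc_conv_integrand]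

lemma lborel_integral_reflect:
  fixes f :: "'a::euclidean_space \<Rightarrow> complex"
  assumes [measurable]: "f \<in> borel_measurable borel"
  shows "(LINT y|lborel. f (x - y)) = (LINT y|lborel. f y)"
proof -
  have "lborel = density (distr lborel borel (\<lambda>y::'a. x + (-1) *\<^sub>R y)) (\<lambda>_. ennreal (\<bar>-1 :: real\<bar> ^ DIM('a)))"
    by (rule lborel_affine) simp
  then have "lborel = distr lborel borel (\<lambda>y::'a. x - y)" by (simp add: density_1)
  then have "(LINT y|lborel. f y) = (LINT y|distr lborel borel (\<lambda>y. x - y). f y)" by simp
  also have "\<dots> = (LINT y|lborel. f (x - y))" by (intro integral_distr) auto
  finally show ?thesis by simp
qed

lemma lborel_integral_translate:
  fixes f :: "'a::euclidean_space \<Rightarrow> 'b::{banach, second_countable_topology}"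
  assumes [measurable]: "f \<in> borel_measurable borel"
  shows "(LINT y|lborel. f (y - x)) = (LINT y|lborel. f y)"
proof -
  have "(LINT y|lborel. f y) = (LINT y|distr lborel borel ((+) (- x)). f y)"
    by (simp add: lborel_distr_plus)
  also have "\<dots> = (LINT y|lborel. f (y - x))" by (subst integral_distr) auto
  finally show ?thesis by simp
qed

lemma convolution_commute:
  assumes "cc f" "cc g" shows "convolution f g = convolution g f"
proof
  fix x
  have "(LINT y|lborel. f y * g (x - y)) = (LINT y|lborel. f (x - y) * g (x - (x - y)))"
    by (rule lborel_integral_reflect[symmetric]) (use cc_measurable[OF cc_conv_integrand[OF assms]] in simp)
  then show "convolution f g x = convolution g f x"
    by (simp add: convolution_def mult.commute)
qed

lemma convolution_shift: "convolution f (\<lambda>z. g (z - a)) x = convolution f g (x - a)"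
  by (simp add: convolution_def algebra_simps)

lemma convolution_supp:
  assumes "cc f" "cc g"
  shows "supp (convolution f g) \<subseteq> {x + y |x y. x \<in> supp f \<and> y \<in> supp g}"
    and "compact (supp (convolution f g))"
proof -
  have "convolution f g z = 0" if "z \<notin> {x + y |x y. x \<in> supp f \<and> y \<in> supp g}" for z
  proof -
    have eq: "f y * g (z - y) = 0" for y
    proof (rule ccontr)
      assume "f y * g (z - y) \<noteq> 0"
      then have "y \<in> supp f" "z - y \<in> supp g" using not_in_supp[of y f] not_in_supp[of "z - y" g] by auto
      moreover have "z = y + (z - y)" by simp
      ultimately show False using that by blast
    qed
    show ?thesis by (simp only: convolution_def eq Bochner_Integration.integral_zero)
  qed
  note 1 = this
  have 2: "compact {x + y |x y. x \<in> supp f \<and> y \<in> supp g}"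
    using assms by (intro compact_sums) (auto simp: cc_def)
  show "supp (convolution f g) \<subseteq> {x + y |x y. x \<in> supp f \<and> y \<in> supp g}"
    "compact (supp (convolution f g))"
    by (rule compact_supp_subset(1)[OF 2 1], assumption) (rule compact_supp_subset(2)[OF 2 1])
qed

text \<open>Two functions and two points at once: with g = h this gives the continuity of a
  convolution, with x = z the estimate of the remainder in its derivative.\<close>

lemma convolution_diff_bound:
  assumes f: "cc f" and g: "cc g" and h: "cc h" and e: "\<And>y. cmod (g (x - y) - h (z - y)) \<le> e"
  shows "cmod (convolution f g x - convolution f h z) \<le> e * (LINT y|lborel. cmod (f y))"
proof -
  have "convolution f g x - convolution f h z = (LINT y|lborel. f y * (g (x - y) - h (z - y)))"
    unfolding convolution_def right_diff_distrib
    by (rule Bochner_Integration.integral_diff[symmetric]) (intro conv_integrable f g h)+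
  also have "cmod \<dots> \<le> (LINT y|lborel. cmod (f y * (g (x - y) - h (z - y))))"
    by (rule integral_norm_bound)
  also have "\<dots> \<le> (LINT y|lborel. e * cmod (f y))"
  proof (rule integral_mono)
    show "integrable lborel (\<lambda>y. cmod (f y * (g (x - y) - h (z - y))))"
      unfolding right_diff_distrib
      by (intro integrable_norm Bochner_Integration.integrable_diff conv_integrable f g h)
    show "integrable lborel (\<lambda>y. e * cmod (f y))" using cc_integrable[OF f] by simp
    show "cmod (f y * (g (x - y) - h (z - y))) \<le> e * cmod (f y)" for y
      using mult_left_mono[OF e[of y] norm_ge_zero[of "f y"]] by (simp add: norm_mult mult.commute[of e])
  qed
  finally show ?thesis by simp
qed

lemma cc_convolution:
  assumes f: "cc f" and g: "cc g" shows "cc (convolution f g)"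
proof -
  let ?L = "LINT y|lborel. cmod (f y)"
  have L: "?L \<ge> 0" by simp
  have "continuous_on UNIV (convolution f g)"
    unfolding continuous_on_iff
  proof (intro ballI allI impI)
    fix x e assume "(e::real) > 0"
    \<comment> \<open>Adding 1 covers the case that the norm \<open>?L\<close> is 0, and
      \<open>e / (?L + 1) * ?L\<close> is still below e.\<close>
    then have "e / (?L + 1) > 0" using L by (intro divide_pos_pos) linarith+
    from cc_uniform[OF g this] obtain d where d: "d > 0"
      "\<And>x y. dist x y < d \<Longrightarrow> cmod (g x - g y) < e / (?L + 1)" by blast
    have "dist (convolution f g y) (convolution f g x) < e" if "dist y x < d" for y
    proof -
      have "cmod (convolution f g y - convolution f g x) \<le> e / (?L + 1) * ?L"
        using d(2) that by (intro convolution_diff_bound f g) (auto simp: dist_norm intro: less_imp_le)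
      also have "\<dots> < e" using \<open>e > 0\<close> L by (simp add: field_simps add_pos_nonneg)
      finally show ?thesis by (simp add: dist_norm)
    qed
    then show "\<exists>d>0. \<forall>y\<in>UNIV. dist y x < d \<longrightarrow> dist (convolution f g y) (convolution f g x) < e"
      using d(1) by blast
  qed
  then show ?thesis using convolution_supp(2)[OF f g] by (simp add: cc_def)
qed

text \<open>Fubini for an integrand supported in the compact product of supp f and supp f + supp g.
  The third factor is merely continuous because \<open>laplace_convolution\<close> takes an
  exponential for it.\<close>

lemma convolution_assoc:
  assumes f: "cc f" and g: "cc g" and h: "continuous_on UNIV h"
  shows "convolution (convolution f g) h = convolution f (convolution g h)"
proof
  fix x
  define F where "F = (\<lambda>(y, z). f y * g (z - y) * h (x - z))"
  let ?K = "supp f \<times> {y + z |y z. y \<in> supp f \<and> z \<in> supp g}"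
  have "integrable lborel F"
  proof (rule continuous_compact_support_integrable[of ?K])
    show "compact ?K"
      using f g by (intro compact_Times compact_sums) (auto simp: cc_def)
    have "continuous_on UNIV F"
      unfolding F_def case_prod_unfold
      by (intro continuous_intros continuous_on_compose2[OF cc_continuous[OF f]]
         continuous_on_compose2[OF cc_continuous[OF g]] continuous_on_compose2[OF h]) auto
    then show "continuous_on ?K F" by (rule continuous_on_subset) simp
    show "F p = 0" if "p \<notin> ?K" for p
    proof -
      obtain y z where p: "p = (y, z)" by (cases p)
      have "z - y \<notin> supp g" if "y \<in> supp f"
      proof
        assume zy: "z - y \<in> supp g"
        have "z = y + (z - y)" by simp
        then have "z \<in> {y + z |y z. y \<in> supp f \<and> z \<in> supp g}" using zy that by blast
        then show False using that \<open>p \<notin> ?K\<close> p by blast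
      qed
      then show ?thesis using not_in_supp[of y f] not_in_supp[of "z - y" g] by (auto simp: F_def p)
    qed
  qed
  then have int: "integrable (lborel \<Otimes>\<^sub>M lborel) (\<lambda>(y, z). f y * g (z - y) * h (x - z))"
    by (simp add: lborel_prod F_def)
  have "convolution (convolution f g) h x = (LINT z|lborel. (LINT y|lborel. f y * g (z - y) * h (x - z)))"
    by (simp add: convolution_def)
  also have "\<dots> = (LINT y|lborel. (LINT z|lborel. f y * g (z - y) * h (x - z)))"
    by (rule lborel_pair.Fubini_integral[OF int])
  also have "\<dots> = (LINT y|lborel. f y * convolution g h (x - y))"
  proof (rule Bochner_Integration.integral_cong[OF refl])
    fix y
    have hc: "continuous_on UNIV (\<lambda>z. h (x - y - z))"
      by (intro continuous_on_compose2[OF h]) (auto intro!: continuous_intros)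
    have "(LINT z|lborel. f y * g (z - y) * h (x - z)) = f y * (LINT z|lborel. g (z - y) * h (x - y - (z - y)))"
      by (simp add: mult.assoc)
    also have "(LINT z|lborel. g (z - y) * h (x - y - (z - y))) = (LINT z|lborel. g z * h (x - y - z))"
      by (rule lborel_integral_translate) (rule cc_measurable[OF cc_mult_right[OF g hc]])
    finally show "(LINT z|lborel. f y * g (z - y) * h (x - z)) = f y * convolution g h (x - y)"
      by (simp add: convolution_def)
  qed
  finally show "convolution (convolution f g) h x = convolution f (convolution g h) x"
    by (simp add: convolution_def)
qed

section \<open>Iterated derivatives and smooth convolutions\<close>

lemma iter_deriv_append: "iter_deriv us (iter_deriv vs f) = iter_deriv (us @ vs) f"
  by (induction us) auto

lemma smooth_iter_deriv: "smooth f \<Longrightarrow> smooth (iter_deriv vs f)"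
  by (simp add: smooth_def iter_deriv_append)

lemma smooth_continuous: "smooth f \<Longrightarrow> continuous_on S f"
  using differentiable_imp_continuous_on[of f S]
  by (metis smooth_def iter_deriv.simps(1) differentiable_at_imp_differentiable_on)

lemma smooth_has_derivative: "smooth f \<Longrightarrow> (f has_derivative frechet_derivative f (at x)) (at x)"
  unfolding smooth_def by (metis frechet_derivative_works iter_deriv.simps(1))

lemma smooth_coinduct:
  assumes "P f" and d: "\<And>g x. P g \<Longrightarrow> g differentiable (at x)"
    and c: "\<And>g v. P g \<Longrightarrow> P (\<lambda>x. frechet_derivative g (at x) v)"
  shows "smooth f"
proof -
  have "P (iter_deriv vs f)" for vs by (induction vs) (auto simp: assms(1) c)
  then show ?thesis unfolding smooth_def using d by blast
qed

lemma iter_deriv_outside_supp: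
  assumes "x \<notin> supp f" shows "iter_deriv vs f x = 0"
  using assms
proof (induction vs arbitrary: x)
  case Nil then show ?case by (simp add: not_in_supp)
next
  case (Cons v vs)
  have "open (- supp f)" unfolding supp_def by (rule open_Compl[OF closed_closure])
  have "((\<lambda>_. 0) has_derivative (\<lambda>_. 0)) (at x)" by simp
  then have "(iter_deriv vs f has_derivative (\<lambda>_. 0)) (at x)"
    by (rule has_derivative_transform_within_open[OF _ \<open>open (- supp f)\<close>]) (use Cons in auto)
  from frechet_derivative_at[OF this, symmetric] show ?case by simp
qed

definition smooth_cc :: "('a::euclidean_space \<Rightarrow> complex) \<Rightarrow> bool" where
  "smooth_cc f \<longleftrightarrow> smooth f \<and> compact (supp f)"

lemma smooth_cc_imp_cc: "smooth_cc f \<Longrightarrow> cc f"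
  by (simp add: smooth_cc_def cc_def smooth_continuous)

lemma smooth_cc_iter_deriv: "smooth_cc f \<Longrightarrow> smooth_cc (iter_deriv vs f)"
  using compact_supp_subset(2)[of "supp f" "iter_deriv vs f"]
  by (auto simp: smooth_cc_def smooth_iter_deriv iter_deriv_outside_supp)

lemma cc_iter_deriv: "smooth_cc f \<Longrightarrow> cc (iter_deriv vs f)"
  by (intro smooth_cc_imp_cc smooth_cc_iter_deriv)

lemma test_functions_smooth_cc: "f \<in> test_functions \<Omega> \<Longrightarrow> smooth_cc f"
  by (simp add: test_functions_def smooth_cc_def)

lemma iter_deriv_shift:
  assumes "smooth f" shows "iter_deriv vs (\<lambda>x. f (x - y)) = (\<lambda>x. iter_deriv vs f (x - y))"
proof (induction vs)
  case (Cons v vs)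
  have "((\<lambda>x. iter_deriv vs f (x - y)) has_derivative frechet_derivative (iter_deriv vs f) (at (x - y))) (at x)" for x
  proof -
    have "((\<lambda>x. x - y) has_derivative (\<lambda>h. h)) (at x)" by (auto intro!: derivative_eq_intros)
    from has_derivative_compose[OF this smooth_has_derivative[OF smooth_iter_deriv[OF assms, of vs], of "x - y"]]
    show ?thesis .
  qed
  from frechet_derivative_at[OF this] show ?case by (simp add: Cons fun_eq_iff)
qed simp

lemma smooth_shift:
  assumes "smooth f" shows "smooth (\<lambda>x. f (x - y))"
  unfolding smooth_def iter_deriv_shift[OF assms]
proof (intro allI)
  fix vs x
  have "iter_deriv vs f differentiable (at (x - y))" using assms unfolding smooth_def by blast
  then show "(\<lambda>x. iter_deriv vs f (x - y)) differentiable (at x)"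
    using differentiable_chain_at[of "\<lambda>x. x - y" x "iter_deriv vs f"] by (simp add: o_def)
qed

lemma smooth_cc_shift: "smooth_cc f \<Longrightarrow> smooth_cc (\<lambda>x. f (x - y))"
  using cc_shift[of f y] by (simp add: smooth_cc_def smooth_shift cc_def smooth_continuous)

text \<open>The partial derivatives are continuous with compact support, hence uniformly continuous,
  so one d works for all base points z. This uniformity permits differentiation under the
  convolution integral.\<close>

lemma smooth_uniform_derivative:
  assumes f: "smooth_cc f" and e: "e > 0"
  shows "\<exists>d>0. \<forall>z h. norm h < d \<longrightarrow>
    cmod (f (z + h) - f z - frechet_derivative f (at z) h) \<le> e * norm h"
proof -
  have sm: "smooth f" using f by (simp add: smooth_cc_def)
  \<comment> \<open>The operator norm is bounded by a sum over \<open>DIM('a)\<close> partial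
    derivatives, each of which gets an equal share of e.\<close>
  let ?e = "e / DIM('a)"
  have e': "?e > 0" using e by simp
  have "\<forall>b\<in>Basis. \<exists>d>0. \<forall>x y. dist x y < d \<longrightarrow> cmod (iter_deriv [b] f x - iter_deriv [b] f y) < ?e"
    using cc_uniform[OF cc_iter_deriv[OF f] e'] by blast
  then obtain D where D: "\<And>b. b \<in> Basis \<Longrightarrow> D b > 0"
    "\<And>b x y. b \<in> Basis \<Longrightarrow> dist x y < D b \<Longrightarrow> cmod (iter_deriv [b] f x - iter_deriv [b] f y) < ?e"
    by metis
  define d where "d = Min (D ` Basis)"
  have d: "d > 0" "\<And>b. b \<in> Basis \<Longrightarrow> d \<le> D b" using D(1) by (auto simp: d_def)
  have "cmod (f (z + h) - f z - frechet_derivative f (at z) h) \<le> e * norm h" if h: "norm h < d" for z h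
  proof -
    have bl: "bounded_linear (frechet_derivative f (at x))" for x
      using smooth_has_derivative[OF sm] has_derivative_bounded_linear by blast
    have "norm (f (z + h) - f z - frechet_derivative f (at z) (z + h - z)) \<le> norm (z + h - z) * e"
    proof (rule differentiable_bound_linearization[where S = "ball z d"])
      show "z + t *\<^sub>R (z + h - z) \<in> ball z d" if "t \<in> {0..1}" for t
      proof -
        have "norm (t *\<^sub>R h) \<le> norm h" using that by (simp add: mult_left_le_one_le)
        then show ?thesis using h by (simp add: dist_norm)
      qed
      show "(f has_derivative frechet_derivative f (at x)) (at x within ball z d)" for x
        using smooth_has_derivative[OF sm] has_derivative_at_withinI by blast
      show "onorm (frechet_derivative f (at x) - frechet_derivative f (at z)) \<le> e" if x: "x \<in> ball z d" for x
      proof -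
        have "onorm (\<lambda>v. frechet_derivative f (at x) v - frechet_derivative f (at z) v)
           \<le> (\<Sum>b\<in>Basis. norm (frechet_derivative f (at x) b - frechet_derivative f (at z) b))"
          by (intro onorm_componentwise bounded_linear_sub bl)
        also have "\<dots> \<le> (\<Sum>b\<in>(Basis::'a set). ?e)"
        proof (rule sum_mono)
          fix b :: 'a assume b: "b \<in> Basis"
          then have "dist x z < D b" using x d(2)[OF b] by (simp add: dist_commute)
          from D(2)[OF b this] show "norm (frechet_derivative f (at x) b - frechet_derivative f (at z) b) \<le> ?e"
            by simp
        qed
        also have "\<dots> = e" by simp
        finally show ?thesis by (simp add: fun_diff_def)
      qed
    qed (use d(1) in auto)
    then show ?thesis by (simp add: mult.commute)
  qed
  then show ?thesis using d(1) by blast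
qed

lemma cc_add:
  assumes f: "cc f" and g: "cc g" shows "cc (\<lambda>x. f x + g x)"
  by (rule ccI[of _ "supp f \<union> supp g"])
     (use f g in \<open>auto simp: cc_def not_in_supp intro!: continuous_on_add\<close>)

lemma convolution_add:
  assumes f: "cc f" and g: "cc g" and h: "cc h"
  shows "convolution f (\<lambda>z. g z + h z) x = convolution f g x + convolution f h x"
  unfolding convolution_def distrib_left
  by (rule Bochner_Integration.integral_add[OF conv_integrable[OF f g] conv_integrable[OF f h]])

text \<open>All derivatives fall on the smooth factor. The remainder of g is uniformly small
  relative to the increment, and integration against f multiplies it by at most the norm
  \<open>?L\<close>.\<close>

lemma convolution_has_derivative:
  assumes f: "cc f" and g: "smooth_cc g"
  shows "(convolution f g has_derivative
     (\<lambda>h. convolution f (\<lambda>z. frechet_derivative g (at z) h) x)) (at x)"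
  unfolding has_derivative_at_alt
proof
  have sm: "smooth g" using g by (simp add: smooth_cc_def)
  let ?L = "LINT y|lborel. cmod (f y)"
  have L: "?L \<ge> 0" by simp
  have cg: "cc g" using g by (rule smooth_cc_imp_cc)
  have cd: "cc (\<lambda>z. frechet_derivative g (at z) h)" for h using cc_iter_deriv[OF g, of "[h]"] by simp
  have lin: "linear (frechet_derivative g (at z))" for z
    using smooth_has_derivative[OF sm] has_derivative_linear by blast
  have "linear (\<lambda>h. convolution f (\<lambda>z. frechet_derivative g (at z) h) x)"
  proof (rule linearI)
    fix h k :: 'a and c :: real
    show "convolution f (\<lambda>z. frechet_derivative g (at z) (h + k)) x =
      convolution f (\<lambda>z. frechet_derivative g (at z) h) x + convolution f (\<lambda>z. frechet_derivative g (at z) k) x"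
      unfolding linear_add[OF lin] by (rule convolution_add[OF f cd cd])
    show "convolution f (\<lambda>z. frechet_derivative g (at z) (c *\<^sub>R h)) x =
      c *\<^sub>R convolution f (\<lambda>z. frechet_derivative g (at z) h) x"
      unfolding convolution_def linear_scale[OF lin] by simp
  qed
  then show "bounded_linear (\<lambda>h. convolution f (\<lambda>z. frechet_derivative g (at z) h) x)"
    by (simp add: linear_conv_bounded_linear)
  show "\<forall>e>0. \<exists>d>0. \<forall>y. norm (y - x) < d \<longrightarrow>
    cmod (convolution f g y - convolution f g x
      - convolution f (\<lambda>z. frechet_derivative g (at z) (y - x)) x) \<le> e * norm (y - x)"
  proof (intro allI impI)
    fix e :: real assume e: "e > 0"
    then have "e / (?L + 1) > 0" using L by (intro divide_pos_pos) linarith+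
    from smooth_uniform_derivative[OF g this] obtain d where d: "d > 0"
      "\<And>z h. norm h < d \<Longrightarrow> cmod (g (z + h) - g z - frechet_derivative g (at z) h) \<le> e / (?L + 1) * norm h"
      by blast
    have "cmod (convolution f g y - convolution f g x
      - convolution f (\<lambda>z. frechet_derivative g (at z) (y - x)) x) \<le> e * norm (y - x)"
      if y: "norm (y - x) < d" for y
    proof -
      let ?w = "\<lambda>z. frechet_derivative g (at z) (y - x)"
      have "cc (\<lambda>z. g (z - (x - y)))" by (rule cc_shift[OF cg])
      then have cs: "cc (\<lambda>z. g (z + (y - x)))" by (simp add: algebra_simps)
      have 1: "convolution f g y = convolution f (\<lambda>z. g (z + (y - x))) x"
        by (simp add: convolution_def algebra_simps)
      have 2: "convolution f (\<lambda>z. g z + ?w z) x = convolution f g x + convolution f ?w x"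
        by (rule convolution_add[OF f cg cd])
      have "cmod (convolution f (\<lambda>z. g (z + (y - x))) x - convolution f (\<lambda>z. g z + ?w z) x)
          \<le> (e / (?L + 1) * norm (y - x)) * ?L"
      proof (intro convolution_diff_bound f cs cc_add cg cd)
        show "cmod (g (x - w + (y - x)) - (g (x - w) + ?w (x - w))) \<le> e / (?L + 1) * norm (y - x)" for w
          using d(2)[OF y, of "x - w"] by (simp only: diff_diff_eq)
      qed
      then have "cmod (convolution f g y - convolution f g x - convolution f ?w x)
          \<le> (e / (?L + 1) * norm (y - x)) * ?L"
        unfolding 1[symmetric] 2 by (simp only: diff_diff_eq)
      also have "\<dots> = (e / (?L + 1) * ?L) * norm (y - x)" by simp
      also have "\<dots> \<le> e * norm (y - x)"
      proof (rule mult_right_mono)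
        have "?L + 1 > 0" using L by linarith
        moreover have "e * ?L \<le> e * (?L + 1)" using e by (intro mult_left_mono) auto
        ultimately show "e / (?L + 1) * ?L \<le> e" by (simp add: pos_divide_le_eq)
      qed simp
      finally show ?thesis .
    qed
    then show "\<exists>d>0. \<forall>y. norm (y - x) < d \<longrightarrow>
      cmod (convolution f g y - convolution f g x
      - convolution f (\<lambda>z. frechet_derivative g (at z) (y - x)) x) \<le> e * norm (y - x)"
      using d(1) by blast
  qed
qed

lemma iter_deriv_convolution:
  assumes f: "cc f" and g: "smooth_cc g"
  shows "iter_deriv vs (convolution f g) = convolution f (iter_deriv vs g)"
proof (induction vs)
  case (Cons v vs)
  show ?case
    using frechet_derivative_at[OF convolution_has_derivative[OF f smooth_cc_iter_deriv[OF g, of vs]]]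
    by (simp add: Cons fun_eq_iff)
qed simp

lemma smooth_cc_convolution:
  assumes f: "cc f" and g: "smooth_cc g" shows "smooth_cc (convolution f g)"
proof -
  have "iter_deriv vs (convolution f g) differentiable (at x)" for vs x
    unfolding iter_deriv_convolution[OF f g] differentiable_def
    using convolution_has_derivative[OF f smooth_cc_iter_deriv[OF g, of vs]] by blast
  then show ?thesis using cc_convolution[OF f smooth_cc_imp_cc[OF g]]
    by (auto simp: smooth_cc_def smooth_def cc_def)
qed

lemma test_functions_convolution:
  assumes f: "f \<in> test_functions \<Omega>" and g: "g \<in> test_functions \<Omega>"
    and \<Omega>: "\<And>x y. x \<in> \<Omega> \<Longrightarrow> y \<in> \<Omega> \<Longrightarrow> x + y \<in> \<Omega>"
  shows "convolution f g \<in> test_functions \<Omega>"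
proof -
  have s: "smooth_cc f" "smooth_cc g" using f g by (auto intro: test_functions_smooth_cc)
  have c: "cc f" "cc g" using s by (auto intro: smooth_cc_imp_cc)
  have "{x + y |x y. x \<in> supp f \<and> y \<in> supp g} \<subseteq> \<Omega>"
    using f g \<Omega> by (auto simp: test_functions_def subset_iff)
  then have "supp (convolution f g) \<subseteq> \<Omega>" using convolution_supp(1)[OF c] by (rule order_trans[rotated])
  then show ?thesis
    using smooth_cc_convolution[OF c(1) s(2)] by (simp add: test_functions_def smooth_cc_def)
qed

lemma supp_shift: "supp (\<lambda>x. f (x - y)) = (\<lambda>x. x + y) ` supp f"
proof -
  have "{x. f (x - y) \<noteq> 0} = (\<lambda>x. y + x) ` {x. f x \<noteq> 0}"
    by (auto intro!: image_eqI[of _ _ "x - y" for x])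
  moreover have "(\<lambda>x. y + x) = (\<lambda>x. x + y)" by (simp add: fun_eq_iff add.commute)
  ultimately show ?thesis unfolding supp_def by (metis closure_translation)
qed

lemma test_functions_shift:
  assumes f: "f \<in> test_functions \<Omega>" and "\<And>x. x \<in> supp f \<Longrightarrow> x + y \<in> \<Omega>"
  shows "(\<lambda>x. f (x - y)) \<in> test_functions \<Omega>"
  using assms smooth_cc_shift[OF test_functions_smooth_cc[OF f], of y]
  by (auto simp: test_functions_def smooth_cc_def supp_shift)

section \<open>Smooth bump functions\<close>

definition flat :: "nat \<Rightarrow> real \<Rightarrow> real" where
  "flat k t = (if t \<le> 0 then 0 else inverse t ^ k / exp (inverse t))"

lemma flat_tendsto_0: "(flat k \<longlongrightarrow> 0) (at 0)"
proof (rule filterlim_split_at)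
  show "(flat k \<longlongrightarrow> 0) (at_left 0)"
    by (rule tendsto_eventually) (auto simp: eventually_at_filter flat_def)
  have "((\<lambda>t. inverse t ^ k / exp (inverse t)) \<longlongrightarrow> (0::real)) (at_right 0)"
    using filterlim_compose[OF tendsto_power_div_exp_0 filterlim_inverse_at_top_right] .
  then show "(flat k \<longlongrightarrow> 0) (at_right 0)"
    by (rule Lim_transform_eventually) (auto simp: eventually_at_filter flat_def)
qed

text \<open>The powers of \<open>inverse t\<close> are kept in the family to make it closed under
  derivatives: the exponential raises the order by 2, the power by 1. At 0 the difference quotient
  of \<open>flat k\<close> is \<open>flat (Suc k)\<close>, which tends to 0.\<close>

lemma flat_deriv:
  "(flat k has_real_derivative flat (k + 2) t - real k * flat (k + 1) t) (at t)"
proof -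
  consider "t < 0" | "t = 0" | "t > 0" by linarith
  then show ?thesis
  proof cases
    case 1
    have "((\<lambda>_. 0) has_real_derivative 0) (at t)" by simp
    then have "(flat k has_real_derivative 0) (at t)"
      by (rule has_field_derivative_transform_within_open[of _ _ _ "{..<0}"]) (use 1 in \<open>auto simp: flat_def\<close>)
    then show ?thesis using 1 by (simp add: flat_def)
  next
    case 2
    have "((\<lambda>h. (flat k (0 + h) - flat k 0) / h) \<longlongrightarrow> 0) (at 0)"
      by (rule Lim_transform_eventually[OF flat_tendsto_0[of "Suc k"]])
         (auto simp: eventually_at_filter flat_def divide_simps)
    then show ?thesis using 2 by (simp add: DERIV_def flat_def)
  next
    case 3
    have a1: "((\<lambda>t. inverse t ^ k) has_real_derivative
        real k * (- (inverse t ^ Suc (Suc 0)) * inverse t ^ (k - Suc 0))) (at t)"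
      using 3 by (intro DERIV_power DERIV_inverse) auto
    have a2: "real k * (- (inverse t ^ Suc (Suc 0)) * inverse t ^ (k - Suc 0))
        = - real k * inverse t ^ (k + 1)"
      by (cases k) (simp_all add: algebra_simps)
    have A: "((\<lambda>t. inverse t ^ k) has_real_derivative - real k * inverse t ^ (k + 1)) (at t)"
      using a1 unfolding a2 .
    have B: "((\<lambda>t. exp (- inverse t)) has_real_derivative exp (- inverse t) * (inverse t)\<^sup>2) (at t)"
      using 3 by (auto intro!: derivative_eq_intros simp: power2_eq_square)
    have "((\<lambda>t. inverse t ^ k * exp (- inverse t)) has_real_derivative
        flat (k + 2) t - real k * flat (k + 1) t) (at t)"
      using DERIV_mult[OF A B] 3
      by (simp add: flat_def exp_minus divide_inverse power_add power2_eq_square algebra_simps)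
    then show ?thesis
      by (rule has_field_derivative_transform_within_open[of _ _ _ "{0<..}"])
         (use 3 in \<open>auto simp: flat_def exp_minus divide_inverse\<close>)
  qed
qed

text \<open>Closed under directional derivatives; hence its members are smooth.\<close>

inductive bump_algebra :: "'a::euclidean_space \<Rightarrow> real \<Rightarrow> ('a \<Rightarrow> real) \<Rightarrow> bool" for c r where
  flat: "bump_algebra c r (\<lambda>x. flat k (r - (x - c) \<bullet> (x - c)))"
| lin: "bump_algebra c r (\<lambda>x. (x - c) \<bullet> v)"
| const: "bump_algebra c r (\<lambda>x. a)"
| mult: "bump_algebra c r f \<Longrightarrow> bump_algebra c r g \<Longrightarrow> bump_algebra c r (\<lambda>x. f x * g x)"
| add: "bump_algebra c r f \<Longrightarrow> bump_algebra c r g \<Longrightarrow> bump_algebra c r (\<lambda>x. f x + g x)"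

lemma bump_algebra_deriv:
  assumes "bump_algebra c r f"
  shows "\<exists>f'. (\<forall>x. (f has_derivative f' x) (at x)) \<and> (\<forall>v. bump_algebra c r (\<lambda>x. f' x v))"
  using assms
proof induction
  case (flat k)
  let ?q = "\<lambda>x. r - (x - c) \<bullet> (x - c)"
  let ?f' = "\<lambda>x v. (flat (k + 2) (?q x) + (- real k) * flat (k + 1) (?q x)) * ((-2) * ((x - c) \<bullet> v))"
  have "((\<lambda>x. flat k (?q x)) has_derivative ?f' x) (at x)" for x
  proof -
    have "(?q has_derivative (\<lambda>v. (-2) * ((x - c) \<bullet> v))) (at x)"
      by (auto intro!: derivative_eq_intros simp: inner_commute)
    from has_derivative_compose[OF this flat_deriv[of k "?q x", unfolded has_field_derivative_def]]
    show ?thesis by simp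
  qed
  moreover have "bump_algebra c r (\<lambda>x. ?f' x v)" for v
    by (intro bump_algebra.intros)
  ultimately show ?case by (intro exI[of _ ?f'] conjI allI)
next
  case (lin v)
  have "((\<lambda>x. (x - c) \<bullet> v) has_derivative (\<lambda>h. h \<bullet> v)) (at x)" for x
    by (auto intro!: derivative_eq_intros)
  moreover have "bump_algebra c r (\<lambda>x. h \<bullet> v)" for h by (rule bump_algebra.const)
  ultimately show ?case by (intro exI[of _ "\<lambda>x h. h \<bullet> v"]) auto
next
  case (const a)
  show ?case by (intro exI[of _ "\<lambda>x h. 0"]) (auto intro: bump_algebra.const)
next
  case (mult f g)
  then obtain f' g' where fg: "\<And>x. (f has_derivative f' x) (at x)" "\<And>v. bump_algebra c r (\<lambda>x. f' x v)"
    "\<And>x. (g has_derivative g' x) (at x)" "\<And>v. bump_algebra c r (\<lambda>x. g' x v)" by blast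
  have "((\<lambda>x. f x * g x) has_derivative (\<lambda>v. f x * g' x v + f' x v * g x)) (at x)" for x
    by (rule has_derivative_mult[OF fg(1,3)])
  moreover have "bump_algebra c r (\<lambda>x. f x * g' x v + f' x v * g x)" for v
    by (intro bump_algebra.add bump_algebra.mult mult.hyps fg)
  ultimately show ?case by (intro exI[of _ "\<lambda>x v. f x * g' x v + f' x v * g x"] conjI allI)
next
  case (add f g)
  then obtain f' g' where fg: "\<And>x. (f has_derivative f' x) (at x)" "\<And>v. bump_algebra c r (\<lambda>x. f' x v)"
    "\<And>x. (g has_derivative g' x) (at x)" "\<And>v. bump_algebra c r (\<lambda>x. g' x v)" by blast
  have "((\<lambda>x. f x + g x) has_derivative (\<lambda>v. f' x v + g' x v)) (at x)" for x
    by (rule has_derivative_add[OF fg(1,3)])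
  moreover have "bump_algebra c r (\<lambda>x. f' x v + g' x v)" for v
    by (intro bump_algebra.add fg)
  ultimately show ?case by (intro exI[of _ "\<lambda>x v. f' x v + g' x v"] conjI allI)
qed

lemma bump_algebra_smooth:
  assumes "bump_algebra c r f" shows "smooth (\<lambda>x. complex_of_real (f x))"
proof (rule smooth_coinduct[where P = "\<lambda>g. \<exists>f. bump_algebra c r f \<and> g = (\<lambda>x. complex_of_real (f x))"])
  show "\<exists>f'. bump_algebra c r f' \<and> (\<lambda>x. complex_of_real (f x)) = (\<lambda>x. complex_of_real (f' x))"
    using assms by blast
  fix g assume "\<exists>f. bump_algebra c r f \<and> g = (\<lambda>x. complex_of_real (f x))"
  then obtain f where f: "bump_algebra c r f" "g = (\<lambda>x. complex_of_real (f x))" by blast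
  obtain f' where f': "\<And>x. (f has_derivative f' x) (at x)" "\<And>v. bump_algebra c r (\<lambda>x. f' x v)"
    using bump_algebra_deriv[OF f(1)] by blast
  have g: "(g has_derivative (\<lambda>v. complex_of_real (f' x v))) (at x)" for x
    unfolding f(2) by (rule has_derivative_of_real[OF f'(1)])
  show "g differentiable (at x)" for x using g unfolding differentiable_def by blast
  show "\<exists>f. bump_algebra c r f \<and> (\<lambda>x. frechet_derivative g (at x) v) = (\<lambda>x. complex_of_real (f x))" for v
    using f'(2)[of v] frechet_derivative_at[OF g, symmetric] by auto
qed

lemma bump_function:
  fixes c :: "'a::euclidean_space"
  assumes r: "r > 0"
  obtains \<rho> :: "'a \<Rightarrow> real" where "smooth (\<lambda>x. complex_of_real (\<rho> x))" "\<And>x. 0 \<le> \<rho> x"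
    "supp (\<lambda>x. complex_of_real (\<rho> x)) \<subseteq> cball c r" "integrable lborel \<rho>" "(LINT x|lborel. \<rho> x) = 1"
proof -
  define f where "f x = flat 0 (r\<^sup>2 - (x - c) \<bullet> (x - c))" for x :: 'a
  have alg: "bump_algebra c (r\<^sup>2) f" unfolding f_def by (rule bump_algebra.flat)
  have iff: "(x - c) \<bullet> (x - c) < r\<^sup>2 \<longleftrightarrow> x \<in> ball c r" for x
    using norm_lt_square[of "x - c" r] r by (simp add: dist_norm norm_minus_commute)
  have f0: "0 \<le> f x" "f x = 0 \<longleftrightarrow> x \<notin> ball c r" for x
    unfolding iff[symmetric] by (auto simp: f_def flat_def)
  have cont: "continuous_on UNIV f"
    using bump_algebra_deriv[OF alg] by (metis continuous_at_imp_continuous_on has_derivative_continuous)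
  have int: "integrable lborel f"
    by (rule continuous_compact_support_integrable[of "cball c r"])
       (use continuous_on_subset[OF cont] f0(2) in auto)
  let ?I = "LINT x|lborel. f x"
  have "?I \<noteq> 0"
  proof
    assume "?I = 0"
    then have "AE x in lborel. f x = 0"
      using integral_nonneg_eq_0_iff_AE[OF int] f0(1) by simp
    then have "AE x in lborel. x \<notin> ball c r" by (simp add: f0(2))
    then have "emeasure lborel (ball c r) = 0"
      by (subst (asm) AE_iff_measurable[of "ball c r"]) auto
    then have "measure lborel (ball c r) = 0" by (simp add: measure_def)
    then show False using content_ball_pos[OF r, of c] by simp
  qed
  moreover have "?I \<ge> 0" using f0(1) by simp
  ultimately have I: "?I > 0" by simp
  have "bump_algebra c (r\<^sup>2) (\<lambda>x. (1 / ?I) * f x)"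
    by (intro bump_algebra.mult bump_algebra.const alg)
  from bump_algebra_smooth[OF this] have "smooth (\<lambda>x. complex_of_real ((1 / ?I) * f x))" .
  moreover have "0 \<le> (1 / ?I) * f x" for x using f0(1) I by simp
  moreover have "supp (\<lambda>x. complex_of_real ((1 / ?I) * f x)) \<subseteq> cball c r"
    by (rule compact_supp_subset) (use f0(2) in auto)
  moreover have "integrable lborel (\<lambda>x. (1 / ?I) * f x)" using int by simp
  moreover have "(LINT x|lborel. (1 / ?I) * f x) = 1" using I by simp
  ultimately show thesis by (rule that)
qed

section \<open>Distributions\<close>

lemma smooth_zero: "smooth (\<lambda>x. 0)"
proof (rule smooth_coinduct[where P = "\<lambda>g. g = (\<lambda>x. 0)"])
  show "(\<lambda>x. frechet_derivative g (at x) v) = (\<lambda>x. 0)" if "g = (\<lambda>x. 0)" for g :: "'a \<Rightarrow> complex" and v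
    unfolding that by (simp add: frechet_derivative_const)
qed auto

lemma test_functions_zero: "(\<lambda>x. 0) \<in> test_functions \<Omega>"
  by (simp add: test_functions_def smooth_zero supp_def)

lemma test_functions_sum:
  fixes f :: "'i \<Rightarrow> 'a::euclidean_space \<Rightarrow> complex"
  assumes "finite I" "\<And>i. i \<in> I \<Longrightarrow> f i \<in> test_functions \<Omega>"
  shows "(\<lambda>x. \<Sum>i\<in>I. c i * f i x) \<in> test_functions \<Omega> \<and>
    (\<forall>vs x. iter_deriv vs (\<lambda>x. \<Sum>i\<in>I. c i * f i x) x = (\<Sum>i\<in>I. c i * iter_deriv vs (f i) x))"
  using assms
proof (induction I rule: finite_induct)
  case empty
  have "iter_deriv vs (\<lambda>x::'a. 0) x = 0" for vs x
    by (rule iter_deriv_outside_supp) (simp add: supp_def)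
  then show ?case by (simp add: test_functions_zero)
next
  case (insert i I)
  let ?s = "\<lambda>x. \<Sum>i\<in>I. c i * f i x"
  have s: "?s \<in> test_functions \<Omega>" "f i \<in> test_functions \<Omega>" using insert by auto
  have eq: "(\<lambda>x. \<Sum>i\<in>insert i I. c i * f i x) = (\<lambda>x. c i * f i x + 1 * ?s x)"
    using insert by simp
  have "smooth (f i)" "smooth ?s" using s by (auto simp: test_functions_def)
  from iter_deriv_lincomb[OF this, of _ "c i" 1] show ?case
    unfolding eq using test_functions_lincomb[OF s(2,1), of "c i" 1] insert by simp
qed

lemma distribution_lincomb:
  assumes D: "distribution \<Omega> D" and "f \<in> test_functions \<Omega>" "g \<in> test_functions \<Omega>"
  shows "D (\<lambda>x. a * f x + b * g x) = cnj a * D f + cnj b * D g"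
proof -
  have sc: "(\<lambda>x. c * h x) \<in> test_functions \<Omega>" if "h \<in> test_functions \<Omega>" for c h
    using test_functions_lincomb[OF that that, of c 0] by simp
  show ?thesis using D assms(2,3) sc unfolding distribution_def by simp
qed

lemma distribution_zero:
  assumes D: "distribution \<Omega> D" shows "D (\<lambda>x. 0) = 0"
  using distribution_lincomb[OF D test_functions_zero test_functions_zero, of 0 0] by simp

lemma distribution_sum:
  assumes D: "distribution \<Omega> D" and "finite I" "\<And>i. i \<in> I \<Longrightarrow> f i \<in> test_functions \<Omega>"
  shows "D (\<lambda>x. \<Sum>i\<in>I. c i * f i x) = (\<Sum>i\<in>I. cnj (c i) * D (f i))"
  using assms(2,3)
proof (induction I rule: finite_induct)
  case empty show ?case by (simp add: distribution_zero[OF D])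
next
  case (insert i I)
  have "(\<lambda>x. \<Sum>i\<in>I. c i * f i x) \<in> test_functions \<Omega>"
    using test_functions_sum[of I f \<Omega> c] insert by auto
  from distribution_lincomb[OF D _ this, of "f i" "c i" 1] show ?case using insert by simp
qed

text \<open>The form in which the continuity of \<open>D\<close> is used: the preimage of a ball is
  open in the LF topology, hence contains a basic neighbourhood of 0 in each space of functions
  supported in a fixed compact set.\<close>

lemma distribution_seminorm:
  assumes D: "distribution \<Omega> D" and K: "compact K" "K \<subseteq> \<Omega>" and e: "e > 0"
  shows "\<exists>m. \<exists>d>0. \<forall>f\<in>frechet_nhd K m d. cmod (D f) < e"
proof -
  let ?U = "{f \<in> test_functions \<Omega>. D f \<in> ball 0 e}"
  have "openin (lf_topology \<Omega>) ?U"
    using D openin_continuous_map_preimage[of "lf_topology \<Omega>" euclidean D "ball 0 e"]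
    unfolding distribution_def topspace_lf_topology by simp
  moreover have "(\<lambda>x. 0) \<in> ?U" using e by (simp add: test_functions_zero distribution_zero[OF D])
  ultimately obtain W where W: "lf_nhd \<Omega> W" "\<And>f. f \<in> W \<Longrightarrow> (\<lambda>x. 0 + f x) \<in> ?U"
    unfolding openin_lf_topology by blast
  obtain m d where "d > 0" "frechet_nhd K m d \<subseteq> W"
    using W(1) K unfolding lf_nhd_def by blast
  then have "\<forall>f\<in>frechet_nhd K m d. cmod (D f) < e" using W(2) by auto
  then show ?thesis using \<open>d > 0\<close> by blast
qed

text \<open>The difference is written as a linear combination with coefficients 1 and -1, the shape
  to which \<open>iter_deriv_lincomb\<close> and \<open>distribution_lincomb\<close> apply.\<close>

lemma frechet_nhd_diff:
  assumes f: "f \<in> test_functions \<Omega>" "supp f \<subseteq> K" and g: "g \<in> test_functions \<Omega>" "supp g \<subseteq> K"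
    and K: "compact K"
    and lt: "\<And>vs x. set vs \<subseteq> Basis \<Longrightarrow> length vs \<le> m \<Longrightarrow> cmod (iter_deriv vs f x - iter_deriv vs g x) < d"
  shows "(\<lambda>x. 1 * f x + (-1) * g x) \<in> frechet_nhd K m d"
proof -
  have s: "smooth f" "smooth g" using f g by (auto simp: test_functions_def)
  have "supp (\<lambda>x. 1 * f x + (-1) * g x) \<subseteq> K"
  proof (rule compact_supp_subset(1)[OF K])
    fix x assume "x \<notin> K"
    then have "x \<notin> supp f" "x \<notin> supp g" using f g by auto
    then show "1 * f x + (-1) * g x = 0" by (simp add: not_in_supp)
  qed
  then show ?thesis
    using smooth_lincomb[OF s, of 1 "-1"] lt iter_deriv_lincomb[OF s, of _ 1 "-1"]
    by (simp add: frechet_nhd_def)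
qed

lemma iter_deriv_uniform:
  assumes h: "h \<in> test_functions \<Omega>" and e: "e > 0"
  shows "\<exists>d>0. \<forall>vs x y. set vs \<subseteq> Basis \<longrightarrow> length vs \<le> m \<longrightarrow> dist x y < d \<longrightarrow>
    cmod (iter_deriv vs h x - iter_deriv vs h y) < e"
proof -
  let ?V = "{vs::'a list. set vs \<subseteq> Basis \<and> length vs \<le> m}"
  have fin: "finite ?V" by (rule finite_lists_length_le) simp
  have "\<forall>vs. \<exists>d>0. \<forall>x y. dist x y < d \<longrightarrow> cmod (iter_deriv vs h x - iter_deriv vs h y) < e"
    using cc_uniform[OF cc_iter_deriv[OF test_functions_smooth_cc[OF h]] e] by blast
  from choice[OF this] obtain d where d: "\<And>vs. d vs > 0"
    "\<And>vs x y. dist x y < d vs \<Longrightarrow> cmod (iter_deriv vs h x - iter_deriv vs h y) < e" by blast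
  \<comment> \<open>The empty list makes the set nonempty, so that its minimum is
    meaningful.\<close>
  have "[] \<in> ?V" by simp
  then have "Min (d ` ?V) > 0" using fin d(1) by (subst Min_gr_iff) (auto intro: exI[of _ "[]"])
  moreover have "Min (d ` ?V) \<le> d vs" if "vs \<in> ?V" for vs using fin that by auto
  ultimately show ?thesis using d(2) by (intro exI[of _ "Min (d ` ?V)"]) fastforce
qed

section \<open>Smearing a distribution by a test function\<close>

definition translates :: "(('a::euclidean_space \<Rightarrow> complex) \<Rightarrow> complex) \<Rightarrow> ('a \<Rightarrow> complex) \<Rightarrow> 'a \<Rightarrow> complex" where
  "translates D h y = D (\<lambda>x. h (x - y))"

lemma shift_test_function:
  assumes \<Omega>: "open_convex_cone \<Omega>" and h: "h \<in> test_functions \<Omega>" and y: "y \<in> insert 0 \<Omega>"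
  shows "(\<lambda>x. h (x - y)) \<in> test_functions \<Omega>"
  using test_functions_shift[OF h, of y] h y open_convex_cone_add[OF \<Omega>]
  by (auto simp: test_functions_def)

text \<open>Continuity holds in the full space even at y = 0, where neighbours leave the semigroup:
  the support of the translate is compact in the open set \<Omega>, so small further shifts in any
  direction still give test functions, and their derivatives are uniformly close.\<close>

lemma translates_continuous:
  assumes \<Omega>: "open_convex_cone \<Omega>" and D: "distribution \<Omega> D" and h: "h \<in> test_functions \<Omega>"
    and y: "y \<in> insert 0 \<Omega>"
  shows "isCont (translates D h) y"
  unfolding continuous_at_eps_delta
proof (intro allI impI)
  fix e :: real assume e: "e > 0"
  have op: "open \<Omega>" using \<Omega> unfolding open_convex_cone_def by blast
  let ?h = "\<lambda>x. h (x - y)"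
  have hy: "?h \<in> test_functions \<Omega>" by (rule shift_test_function[OF \<Omega> h y])
  then have "compact (supp ?h)" "supp ?h \<subseteq> \<Omega>" by (auto simp: test_functions_def)
  then obtain r where r: "r > 0" "(\<Union>x\<in>supp ?h. cball x r) \<subseteq> \<Omega>"
    using compact_subset_open_imp_cball_epsilon_subset[OF _ op] by blast
  \<comment> \<open>One compact subset of \<Omega> that contains the supports of all translates by
    vectors within r of y.\<close>
  define K where "K = {x + z |x z. x \<in> supp ?h \<and> z \<in> cball 0 r}"
  have K: "compact K" unfolding K_def using \<open>compact (supp ?h)\<close> by (intro compact_sums) auto
  have "K \<subseteq> \<Omega>" unfolding K_def using r(2) by (force simp: dist_norm)
  from distribution_seminorm[OF D K this e] obtain m d where d: "d > 0"
    "\<And>f. f \<in> frechet_nhd K m d \<Longrightarrow> cmod (D f) < e" by blast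
  from iter_deriv_uniform[OF h d(1), of m] obtain s where s: "s > 0"
    "\<And>vs x y. set vs \<subseteq> Basis \<Longrightarrow> length vs \<le> m \<Longrightarrow> dist x y < s \<Longrightarrow>
      cmod (iter_deriv vs h x - iter_deriv vs h y) < d" by blast
  have "dist (translates D h z) (translates D h y) < e" if z: "dist z y < min r s" for z
  proof -
    have sh: "supp (\<lambda>x. h (x - z)) \<subseteq> K"
    proof
      fix x assume "x \<in> supp (\<lambda>x. h (x - z))"
      then obtain w where w: "w \<in> supp h" "x = w + z" unfolding supp_shift by blast
      have "w + y \<in> supp ?h" using w(1) unfolding supp_shift by blast
      moreover have "x = (w + y) + (z - y)" using w by simp
      moreover have "z - y \<in> cball 0 r" using z by (simp add: dist_norm norm_minus_commute)
      ultimately show "x \<in> K" unfolding K_def by blast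
    qed
    have "supp ?h \<subseteq> K"
    proof
      fix x assume "x \<in> supp ?h"
      moreover have "x = x + 0" "0 \<in> cball 0 r" using r(1) by auto
      ultimately show "x \<in> K" unfolding K_def by blast
    qed
    moreover have "smooth h" using h by (simp add: test_functions_def)
    moreover have hz: "(\<lambda>x. h (x - z)) \<in> test_functions \<Omega>"
    proof (rule test_functions_shift[OF h])
      fix x assume "x \<in> supp h"
      then have "x + z \<in> supp (\<lambda>x. h (x - z))" unfolding supp_shift by blast
      then show "x + z \<in> \<Omega>" using sh \<open>K \<subseteq> \<Omega>\<close> by blast
    qed
    ultimately have "(\<lambda>x. 1 * h (x - z) + (-1) * h (x - y)) \<in> frechet_nhd K m d"
      using z s(2) by (intro frechet_nhd_diff[OF hz sh hy _ K]) (auto simp: iter_deriv_shift dist_norm norm_minus_commute)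
    from d(2)[OF this] show ?thesis
      using distribution_lincomb[OF D hz hy, of 1 "-1"] by (simp add: translates_def dist_norm)
  qed
  then show "\<exists>d>0. \<forall>x'. dist x' y < d \<longrightarrow> dist (translates D h x') (translates D h y) < e"
    using r(1) s(1) by (intro exI[of _ "min r s"]) auto
qed

lemma compact_partition:
  fixes C :: "'a::euclidean_space set"
  assumes C: "compact C" and d: "d > 0"
  obtains n :: nat and y A where "\<And>j. j < n \<Longrightarrow> y j \<in> C" "\<And>j. A j \<in> sets borel"
    "\<And>j. A j \<subseteq> ball (y j) d" "\<And>x. x \<in> C \<Longrightarrow> \<exists>!j. j < n \<and> x \<in> A j"
proof -
  have "C \<subseteq> (\<Union>x\<in>C. ball x d)" using d by auto
  then obtain F where F: "F \<subseteq> C" "finite F" "C \<subseteq> (\<Union>x\<in>F. ball x d)"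
    by (rule compactE_image[OF C open_ball])
  obtain n :: nat and y where y: "F = y ` {i. i < n}" "inj_on y {i. i < n}"
    using finite_imp_nat_seg_image_inj_on[OF F(2)] by auto
  \<comment> \<open>A point belongs to the cell of the first ball that contains it.\<close>
  define A where "A j = ball (y j) d - (\<Union>i<j. ball (y i) d)" for j
  have "\<exists>!j. j < n \<and> x \<in> A j" if x: "x \<in> C" for x
  proof -
    let ?P = "\<lambda>j. j < n \<and> x \<in> ball (y j) d"
    have ex: "\<exists>j. ?P j" using F(3) x y(1) by blast
    define j where "j = (LEAST j. ?P j)"
    have j: "?P j" unfolding j_def by (rule LeastI_ex[OF ex])
    have least: "\<not> ?P i" if "i < j" for i using not_less_Least[of i ?P] that unfolding j_def by blast
    have "j < n \<and> x \<in> A j" using j least by (auto simp: A_def)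
    moreover have "k = j" if k: "k < n \<and> x \<in> A k" for k
    proof (rule ccontr)
      assume "k \<noteq> j"
      then consider "k < j" | "j < k" by linarith
      then show False using least[of k] k j by cases (auto simp: A_def)
    qed
    ultimately show ?thesis by blast
  qed
  note ex1 = this
  have yc: "y j \<in> C" if "j < n" for j using F(1) y(1) that by blast
  have Am: "A j \<in> sets borel" for j
    unfolding A_def by (intro sets.Diff sets.finite_UN) auto
  have As: "A j \<subseteq> ball (y j) d" for j unfolding A_def by blast
  show thesis by (rule that[OF yc Am As ex1])
qed

text \<open>Riemann sums with the integrals of \<open>\<psi>\<close> over the cells as weights. The
  bound depends on F only through its oscillation on the cells; it is applied to the derivatives of
  \<open>h\<close>, uniformly in the base point, and to the translates of \<open>h\<close> under
  \<open>D\<close>.\<close>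

lemma riemann_sum_bound:
  fixes \<psi> F :: "'a::euclidean_space \<Rightarrow> complex"
  assumes \<psi>: "integrable lborel \<psi>" "\<And>x. x \<notin> C \<Longrightarrow> \<psi> x = 0" and \<psi>F: "integrable lborel (\<lambda>x. \<psi> x * F x)"
    and A: "\<And>j. j < n \<Longrightarrow> A j \<in> sets borel" "\<And>x. x \<in> C \<Longrightarrow> \<exists>!j::nat. j < n \<and> x \<in> A j"
    and e: "\<And>j x. j < n \<Longrightarrow> x \<in> C \<Longrightarrow> x \<in> A j \<Longrightarrow> cmod (F x - F (y j)) \<le> e"
  shows "cmod ((LINT x|lborel. \<psi> x * F x) - (\<Sum>j<n. (LINT x|lborel. \<psi> x * indicator (A j) x) * F (y j)))
    \<le> e * (LINT x|lborel. cmod (\<psi> x))"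
proof -
  have int: "integrable lborel (\<lambda>x. \<psi> x * indicator (A j) x * F (y j))" if "j < n" for j
    using integrable_mult_indicator[of "A j" lborel \<psi>] A(1)[OF that] \<psi>(1)
    by (simp add: scaleR_conv_of_real of_real_indicator mult.commute)
  let ?R = "\<lambda>x. \<psi> x * F x - (\<Sum>j<n. \<psi> x * indicator (A j) x * F (y j))"
  have R: "integrable lborel ?R"
    by (intro Bochner_Integration.integrable_diff \<psi>F Bochner_Integration.integrable_sum int) auto
  have "(LINT x|lborel. \<psi> x * F x) - (\<Sum>j<n. (LINT x|lborel. \<psi> x * indicator (A j) x) * F (y j))
     = (LINT x|lborel. ?R x)"
  proof -
    have "(LINT x|lborel. ?R x) = (LINT x|lborel. \<psi> x * F x)
        - (LINT x|lborel. (\<Sum>j<n. \<psi> x * indicator (A j) x * F (y j)))"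
      by (rule Bochner_Integration.integral_diff[OF \<psi>F Bochner_Integration.integrable_sum]) (use int in auto)
    also have "(LINT x|lborel. (\<Sum>j<n. \<psi> x * indicator (A j) x * F (y j)))
        = (\<Sum>j<n. (LINT x|lborel. \<psi> x * indicator (A j) x * F (y j)))"
      by (rule Bochner_Integration.integral_sum) (use int in auto)
    finally show ?thesis by simp
  qed
  also have "cmod \<dots> \<le> (LINT x|lborel. cmod (?R x))" by (rule integral_norm_bound)
  also have "\<dots> \<le> (LINT x|lborel. e * cmod (\<psi> x))"
  proof (rule integral_mono)
    show "integrable lborel (\<lambda>x. cmod (?R x))" using R by simp
    show "integrable lborel (\<lambda>x. e * cmod (\<psi> x))" using \<psi>(1) by simp
    fix x
    show "cmod (?R x) \<le> e * cmod (\<psi> x)"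
    proof (cases "x \<in> C")
      case True
      from A(2)[OF True] obtain j where j0: "j < n \<and> x \<in> A j" "\<forall>k. k < n \<and> x \<in> A k \<longrightarrow> k = j"
        by (rule ex1E)
      have j: "j < n" "x \<in> A j" using j0(1) by simp_all
      have uniq: "k = j" if "k < n" "x \<in> A k" for k
        by (rule mp[OF spec[OF j0(2), of k] conjI[OF that]])
      have "(\<Sum>k<n. \<psi> x * indicator (A k) x * F (y k)) = (\<Sum>k<n. if k = j then \<psi> x * F (y j) else 0)"
      proof (intro sum.cong refl)
        fix k assume "k \<in> {..<n}"
        then show "\<psi> x * indicator (A k) x * F (y k) = (if k = j then \<psi> x * F (y j) else 0)"
        proof (cases "k = j")
          case True then show ?thesis using j(2) by simp
        next
          case False
          then have "x \<notin> A k" using uniq \<open>k \<in> {..<n}\<close> by blast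
          then show ?thesis using False by simp
        qed
      qed
      also have "\<dots> = \<psi> x * F (y j)" using j(1) by simp
      finally have "?R x = \<psi> x * (F x - F (y j))" by (simp add: algebra_simps)
      then show ?thesis
        using mult_left_mono[OF e[OF j(1) True j(2)] norm_ge_zero[of "\<psi> x"]] by (simp add: norm_mult mult.commute)
    next
      case False then show ?thesis using \<psi>(2) by simp
    qed
  qed
  finally show ?thesis by simp
qed

text \<open>\<open>D\<close> is moved under the integral
  \<open>\<integral> \<psi> y h (x - y) dy\<close>. Riemann sums of this integral converge together
  with all derivatives up to order m and have supports in one compact set, so \<open>D\<close> may
  be applied to them term by term. The conjugate of \<open>\<psi>\<close> appears because
  \<open>D\<close> is antilinear.\<close>

lemma distribution_convolution:
  assumes \<Omega>: "open_convex_cone \<Omega>" and D: "distribution \<Omega> D" and h: "h \<in> test_functions \<Omega>"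
    and \<psi>: "\<psi> \<in> test_functions \<Omega>"
  shows "integrable lborel (\<lambda>y. cnj (\<psi> y) * translates D h y)"
    and "D (convolution h \<psi>) = (LINT y|lborel. cnj (\<psi> y) * translates D h y)"
proof -
  let ?G = "translates D h" and ?C = "supp \<psi>"
  have ch: "smooth_cc h" "cc h" and c\<psi>: "cc \<psi>"
    using h \<psi> test_functions_smooth_cc smooth_cc_imp_cc by blast+
  have C: "compact ?C" "?C \<subseteq> \<Omega>" using \<psi> by (auto simp: test_functions_def)
  have contG: "continuous_on ?C ?G"
    using translates_continuous[OF \<Omega> D h] C(2) by (intro continuous_at_imp_continuous_on) auto
  have cont\<psi>: "continuous_on ?C \<psi>" using c\<psi> by (rule cc_continuous)
  show int: "integrable lborel (\<lambda>y. cnj (\<psi> y) * ?G y)"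
    by (rule continuous_compact_support_integrable[OF C(1)])
       (auto simp: not_in_supp intro!: continuous_intros contG cont\<psi>)
  have int': "integrable lborel (\<lambda>y. \<psi> y * cnj (?G y))"
    by (rule continuous_compact_support_integrable[OF C(1)])
       (auto simp: not_in_supp intro!: continuous_intros contG cont\<psi>)
  have conv: "convolution h \<psi> = convolution \<psi> h" by (rule convolution_commute[OF ch(2) c\<psi>])
  define L where "L = (LINT x|lborel. cmod (\<psi> x))"
  have L: "L \<ge> 0" by (simp add: L_def)
  define K where "K = {x + y |x y. x \<in> supp \<psi> \<and> y \<in> supp h}"
  have K: "compact K" unfolding K_def using ch(2) C by (intro compact_sums) (auto simp: cc_def)
  have "K \<subseteq> \<Omega>" unfolding K_def using C(2) h open_convex_cone_add[OF \<Omega>]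
    by (auto simp: test_functions_def)
  have "cmod (D (convolution h \<psi>) - (LINT y|lborel. cnj (\<psi> y) * ?G y)) \<le> e + e * L" if e: "e > 0" for e
  proof -
    from distribution_seminorm[OF D K \<open>K \<subseteq> \<Omega>\<close> e] obtain m d where d: "d > 0"
      "\<And>f. f \<in> frechet_nhd K m d \<Longrightarrow> cmod (D f) < e" by blast
    have "d / (L + 1) > 0" using d(1) L by (intro divide_pos_pos) linarith+
    from iter_deriv_uniform[OF h this, of m] obtain s where s: "s > 0"
      "\<And>vs x y. set vs \<subseteq> Basis \<Longrightarrow> length vs \<le> m \<Longrightarrow> dist x y < s \<Longrightarrow>
        cmod (iter_deriv vs h x - iter_deriv vs h y) < d / (L + 1)" by blast
    from compact_uniformly_continuous[OF contG C(1)] e obtain s' where s': "s' > 0"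
      "\<And>x y. x \<in> ?C \<Longrightarrow> y \<in> ?C \<Longrightarrow> dist y x < s' \<Longrightarrow> dist (?G y) (?G x) < e"
      unfolding uniformly_continuous_on_def by blast
    \<comment> \<open>One partition serves two Riemann sums: \<open>s\<close> controls the
      derivatives of \<open>h\<close>, and \<open>s'\<close> controls \<open>?G\<close>.\<close>
    have mn: "min s s' > 0" using s(1) s'(1) by simp
    obtain n y A where P: "\<And>j. j < n \<Longrightarrow> y j \<in> ?C" "\<And>j. A j \<in> sets borel"
      "\<And>j. A j \<subseteq> ball (y j) (min s s')" "\<And>x. x \<in> ?C \<Longrightarrow> \<exists>!j::nat. j < n \<and> x \<in> A j"
      by (rule compact_partition[OF C(1) mn]) (rule that)
    have yA: "y j \<in> ?C \<and> A j \<in> sets borel \<and> A j \<subseteq> ball (y j) (min s s')" if "j < n" for j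
      using P(1)[OF that] P(2,3) by blast
    define c where "c j = (LINT x|lborel. \<psi> x * indicator (A j) x)" for j
    let ?R = "\<lambda>x. \<Sum>j\<in>{..<n}. c j * h (x - y j)"
    have hy: "(\<lambda>x. h (x - y j)) \<in> test_functions \<Omega>" if "j \<in> {..<n}" for j
      using yA that C(2) by (intro shift_test_function[OF \<Omega> h]) auto
    have R: "?R \<in> test_functions \<Omega>"
      "\<And>vs x. iter_deriv vs ?R x = (\<Sum>j\<in>{..<n}. c j * iter_deriv vs (\<lambda>x. h (x - y j)) x)"
      using test_functions_sum[of "{..<n}" "\<lambda>j x. h (x - y j)" \<Omega> c] hy by auto
    have sm: "smooth h" using ch(1) by (simp add: smooth_cc_def)
    have close: "cmod (iter_deriv vs (convolution \<psi> h) x - iter_deriv vs ?R x) < d"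
      if vs: "set vs \<subseteq> Basis" "length vs \<le> m" for vs x
    proof -
      have cv: "cc (iter_deriv vs h)" by (rule cc_iter_deriv[OF ch(1)])
      have "cmod ((LINT z|lborel. \<psi> z * iter_deriv vs h (x - z))
          - (\<Sum>j<n. (LINT z|lborel. \<psi> z * indicator (A j) z) * iter_deriv vs h (x - y j)))
          \<le> d / (L + 1) * (LINT z|lborel. cmod (\<psi> z))"
      proof (rule riemann_sum_bound[where C = ?C])
        show "integrable lborel \<psi>" by (rule cc_integrable[OF c\<psi>])
        show "integrable lborel (\<lambda>z. \<psi> z * iter_deriv vs h (x - z))" by (rule conv_integrable[OF c\<psi> cv])
        show "\<exists>!j. j < n \<and> z \<in> A j" if "z \<in> ?C" for z by (rule P(4)[OF that])
        fix j z assume jz: "j < n" "z \<in> ?C" "z \<in> A j"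
        then have "dist (x - z) (x - y j) < s" using yA[OF jz(1)] by (auto simp: dist_norm norm_minus_commute)
        then show "cmod (iter_deriv vs h (x - z) - iter_deriv vs h (x - y j)) \<le> d / (L + 1)"
          using s(2)[OF vs] by (intro less_imp_le) blast
      qed (use P(2) in \<open>simp_all add: not_in_supp\<close>)
      then have "cmod (iter_deriv vs (convolution \<psi> h) x - iter_deriv vs ?R x) \<le> d / (L + 1) * L"
        unfolding R(2) iter_deriv_convolution[OF c\<psi> ch(1)]
        by (simp add: iter_deriv_shift[OF sm] c_def convolution_def L_def)
      also have "\<dots> < d" using d(1) L by (simp add: pos_divide_less_eq add_nonneg_pos)
      finally show ?thesis .
    qed
    have "(\<lambda>x. 1 * convolution \<psi> h x + (-1) * ?R x) \<in> frechet_nhd K m d"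
    proof (rule frechet_nhd_diff[OF _ _ R(1) _ K close])
      show "convolution \<psi> h \<in> test_functions \<Omega>"
        by (rule test_functions_convolution[OF \<psi> h open_convex_cone_add[OF \<Omega>]])
      show "supp (convolution \<psi> h) \<subseteq> K"
        unfolding K_def by (rule convolution_supp(1)[OF c\<psi> ch(2)])
      show "supp ?R \<subseteq> K"
      proof (rule compact_supp_subset(1)[OF K])
        fix x assume x: "x \<notin> K"
        have "h (x - y j) = 0" if j: "j \<in> {..<n}" for j
        proof (rule not_in_supp[of "x - y j" h], rule notI)
          assume "x - y j \<in> supp h"
          moreover have "y j \<in> supp \<psi>" using yA j by simp
          moreover have "x = y j + (x - y j)" by simp
          ultimately show False using x unfolding K_def by blast
        qed
        then show "?R x = 0" by simp
      qed
    qed auto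
    from d(2)[OF this]
    have 1: "cmod (D (convolution \<psi> h) - D ?R) < e"
      using distribution_lincomb[OF D test_functions_convolution[OF \<psi> h open_convex_cone_add[OF \<Omega>]] R(1), of 1 "-1"]
      by simp
    have DR: "D ?R = (\<Sum>j<n. cnj (c j) * ?G (y j))"
      using distribution_sum[OF D, of "{..<n}" "\<lambda>j x. h (x - y j)" c] hy by (simp add: translates_def)
    have "cmod ((LINT z|lborel. \<psi> z * cnj (?G z))
          - (\<Sum>j<n. (LINT z|lborel. \<psi> z * indicator (A j) z) * cnj (?G (y j))))
          \<le> e * (LINT z|lborel. cmod (\<psi> z))"
    proof (rule riemann_sum_bound[where C = ?C])
      show "integrable lborel \<psi>" by (rule cc_integrable[OF c\<psi>])
      show "\<exists>!j. j < n \<and> z \<in> A j" if "z \<in> ?C" for z by (rule P(4)[OF that])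
      fix j z assume jz: "j < n" "z \<in> ?C" "z \<in> A j"
      then have "dist z (y j) < s'" using yA[OF jz(1)] by (auto simp: dist_commute)
      then show "cmod (cnj (?G z) - cnj (?G (y j))) \<le> e"
        using s'(2)[of "y j" z] yA[OF jz(1)] jz
        by (simp flip: complex_cnj_diff add: dist_norm)
    qed (use P(2) int' in \<open>simp_all add: not_in_supp\<close>)
    then have "cmod (cnj ((LINT z|lborel. \<psi> z * cnj (?G z)) - (\<Sum>j<n. c j * cnj (?G (y j))))) \<le> e * L"
      by (simp only: complex_mod_cnj c_def L_def)
    moreover have "cnj (LINT z|lborel. \<psi> z * cnj (?G z)) = (LINT z|lborel. cnj (\<psi> z) * ?G z)"
      by (simp flip: Bochner_Integration.integral_cnj)
    ultimately have "cmod ((LINT z|lborel. cnj (\<psi> z) * ?G z) - D ?R) \<le> e * L"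
      by (simp add: DR)
    with 1 show ?thesis unfolding conv
      using norm_triangle_ineq4[of "D (convolution \<psi> h) - D ?R" "(LINT z|lborel. cnj (\<psi> z) * ?G z) - D ?R"]
      by simp
  qed
  note bound = this
  show "D (convolution h \<psi>) = (LINT y|lborel. cnj (\<psi> y) * ?G y)"
  proof (rule ccontr)
    assume "\<not> ?thesis"
    then have p: "cmod (D (convolution h \<psi>) - (LINT y|lborel. cnj (\<psi> y) * ?G y)) > 0" (is "?x > 0") by simp
    \<comment> \<open>For this e the bound \<open>e + e * L\<close> is half of
      \<open>?x\<close>.\<close>
    have "?x / (2 * (1 + L)) > 0" using p L by (intro divide_pos_pos) auto
    from bound[OF this] have "?x \<le> ?x / (2 * (1 + L)) * (1 + L)" by (simp add: distrib_left)
    also have "\<dots> = ?x / 2" using L by (simp add: field_simps add_nonneg_eq_0_iff)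
    finally show False using p by simp
  qed
qed

section \<open>The Laplace transform\<close>

text \<open>The dual cone, identified through the inner product with a set of vectors, so that
  measures can be handled on the Euclidean space itself. The transport to functionals comes at the
  end.\<close>

definition dual_points :: "'a::euclidean_space set \<Rightarrow> 'a set" where
  "dual_points \<Omega> = {v. \<forall>x\<in>\<Omega>. 0 \<le> v \<bullet> x}"

lemma closed_dual_points: "closed (dual_points \<Omega>)"
  unfolding dual_points_def by (rule closed_dual_halfspaces)

section \<open>Uniqueness of the Laplace transform\<close>

lemma finite_borel_measure_eqI:
  fixes M N :: "'b::metric_space measure"
  assumes "finite_measure M" "finite_measure N" "sets M = sets borel" "sets N = sets borel"
    and eq: "\<And>f :: 'b \<Rightarrow> real. continuous_on UNIV f \<Longrightarrow> (\<And>x. 0 \<le> f x \<and> f x \<le> 1) \<Longrightarrow>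
      (LINT x|M. f x) = (LINT x|N. f x)"
  shows "M = N"
proof -
  interpret M: finite_measure M by fact
  interpret N: finite_measure N by fact
  have sp: "space M = UNIV" "space N = UNIV" using sets_eq_imp_space_eq[OF assms(3)] sets_eq_imp_space_eq[OF assms(4)] by simp_all
  have meas: "measure M C = measure N C" if C: "closed C" "C \<noteq> {}" for C
  proof -
    \<comment> \<open>Continuous tents that decrease to the indicator of C. They need C nonempty,
      since \<open>infdist x {}\<close> is 0.\<close>
    define f where "f n x = max 0 (1 - real n * infdist x C)" for n x
    have fc: "continuous_on UNIV (f n)" for n
      unfolding f_def by (intro continuous_intros)
    have fr: "0 \<le> f n x \<and> f n x \<le> 1" for n x
      using infdist_nonneg[of x C] by (auto simp: f_def)
    have lim: "(\<lambda>n. f n x) \<longlonglongrightarrow> indicator C x" for x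
    proof (cases "x \<in> C")
      case True then show ?thesis by (simp add: f_def)
    next
      case False
      then have p: "infdist x C > 0" using in_closed_iff_infdist_zero[OF C, of x] infdist_nonneg[of x C] by simp
      obtain n0 where n0: "1 / infdist x C < real n0" using reals_Archimedean2 by blast
      have "f n x = 0" if "n \<ge> n0" for n
      proof -
        have "1 < real n0 * infdist x C" using n0 p by (simp add: field_simps)
        also have "\<dots> \<le> real n * infdist x C" using that p by simp
        finally show ?thesis by (simp add: f_def)
      qed
      then have "\<forall>\<^sub>F n in sequentially. f n x = 0" by (auto simp: eventually_sequentially)
      then show ?thesis using False by (simp add: tendsto_eventually)
    qed
    have conv: "(\<lambda>n. LINT x|K. f n x) \<longlonglongrightarrow> measure K C"
      if K: "finite_measure K" "sets K = sets borel" for K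
    proof -
      interpret K: finite_measure K by fact
      have Cm: "C \<in> sets K" using C K by simp
      have "(\<lambda>n. LINT x|K. f n x) \<longlonglongrightarrow> (LINT x|K. indicator C x)"
      proof (rule integral_dominated_convergence[where w = "\<lambda>_. 1"])
        show "f n \<in> borel_measurable K" for n
          using borel_measurable_continuous_onI[OF fc[of n]] measurable_cong_sets[OF K(2) refl] by blast
        show "(indicator C :: 'b \<Rightarrow> real) \<in> borel_measurable K" using Cm by simp
        show "AE x in K. norm (f n x) \<le> 1" for n using fr[of n] by simp
      qed (use lim in auto)
      then show ?thesis using Cm by (simp add: sets.Int_space_eq2)
    qed
    have "(\<lambda>n. LINT x|M. f n x) = (\<lambda>n. LINT x|N. f n x)" using eq[OF fc fr] by simp
    then show ?thesis
      using conv[OF assms(1,3)] conv[OF assms(2,4)] LIMSEQ_unique by metis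
  qed
  have "emeasure M C = emeasure N C" if "closed C" for C
    using meas[OF that] by (cases "C = {}") (auto simp: M.emeasure_eq_measure N.emeasure_eq_measure)
  then show ?thesis
    by (intro measure_eqI_generator_eq[where E = "Collect closed" and \<Omega> = UNIV and A = "\<lambda>_. UNIV"])
       (use assms in \<open>auto simp: Int_stable_def borel_eq_closed\<close>)
qed

text \<open>Polynomials, generated additively from monomials rather than as a ring: an induction
  about equal integrals then meets only monomials and sums. Closure under products is a
  lemma.\<close>

inductive laplace_monomials :: "('a::euclidean_space \<times> real \<Rightarrow> real) \<Rightarrow> bool" where
  mono: "laplace_monomials (\<lambda>p. c * snd p ^ k * (\<Prod>b\<in>Basis. (fst p \<bullet> b) ^ n b))"
| add: "laplace_monomials f \<Longrightarrow> laplace_monomials g \<Longrightarrow> laplace_monomials (\<lambda>p. f p + g p)"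

lemma laplace_monomials_mult_mono:
  assumes "laplace_monomials g"
  shows "laplace_monomials (\<lambda>p. (c * snd p ^ k * (\<Prod>b\<in>Basis. (fst p \<bullet> b) ^ n b)) * g p)"
  using assms
proof induction
  case (mono d l m)
  have "(\<lambda>p. (c * snd p ^ k * (\<Prod>b\<in>Basis. (fst p \<bullet> b) ^ n b))
        * (d * snd p ^ l * (\<Prod>b\<in>Basis. (fst p \<bullet> b) ^ m b))) =
     (\<lambda>p. (c * d) * snd p ^ (k + l) * (\<Prod>b\<in>Basis. (fst p \<bullet> b) ^ (n b + m b)))"
    by (simp add: power_add prod.distrib ac_simps fun_eq_iff)
  then show ?case using laplace_monomials.mono[of "c * d" "k + l" "\<lambda>b. n b + m b"] by simp
next
  case (add f g)
  show ?case unfolding distrib_left by (rule laplace_monomials.add[OF add.IH])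
qed

lemma laplace_monomials_mult:
  assumes "laplace_monomials f" "laplace_monomials g"
  shows "laplace_monomials (\<lambda>p. f p * g p)"
  using assms(1)
proof induction
  case (mono c k n) show ?case by (rule laplace_monomials_mult_mono[OF assms(2)])
next
  case (add f h) show ?case unfolding distrib_right by (rule laplace_monomials.add[OF add.IH])
qed

lemma laplace_monomials_continuous: "laplace_monomials f \<Longrightarrow> continuous_on S f"
  by (induction rule: laplace_monomials.induct) (auto intro!: continuous_intros)

text \<open>The map \<open>v \<mapsto> (exp (- v \<bullet> (e + b)), exp (- v \<bullet> e))\<close> embeds the dual cone into a cube, and
  turns the exponentials \<open>exp (- v \<bullet> x)\<close>, x in the semigroup generated by e and the \<open>e + b\<close>, into
  monomials, which span a dense algebra of continuous functions on the cube.\<close>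

lemma laplace_unique_finite:
  fixes M N :: "'a::euclidean_space measure"
  assumes \<Omega>: "open_convex_cone \<Omega>" and M: "finite_measure M" "sets M = sets borel" "AE v in M. v \<in> dual_points \<Omega>"
    and N: "finite_measure N" "sets N = sets borel" "AE v in N. v \<in> dual_points \<Omega>"
    and eq: "\<And>x. x \<in> insert 0 \<Omega> \<Longrightarrow> (LINT v|M. exp (- (v \<bullet> x))) = (LINT v|N. exp (- (v \<bullet> x)))"
  shows "M = N"
proof -
  interpret halvable_cone "insert 0 \<Omega>" by (rule open_convex_cone_halvable[OF \<Omega>])
  obtain e where e: "e \<in> \<Omega>" "\<And>b. b \<in> Basis \<Longrightarrow> e + b \<in> \<Omega>"
    using open_convex_cone_rational_center[OF \<Omega>] by blast
  define \<Psi> where "\<Psi> v = ((\<Sum>b\<in>Basis. exp (- (v \<bullet> (e + b))) *\<^sub>R b), exp (- (v \<bullet> e)))" for v :: 'a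
  \<comment> \<open>The inverse of \<open>\<Psi>\<close>: the logarithms of its entries differ by v
    \<bullet> b. It brings the equality of the image measures back to \<open>M\<close> and
    \<open>N\<close>.\<close>
  define \<Phi> where "\<Phi> p = (\<Sum>b\<in>Basis. (ln (snd p) - ln (fst p \<bullet> b)) *\<^sub>R b)" for p :: "'a \<times> real"
  have \<Psi>b: "fst (\<Psi> v) \<bullet> b = exp (- (v \<bullet> (e + b)))" if "b \<in> Basis" for v b
    unfolding \<Psi>_def using that by (simp add: inner_sum_left_Basis)
  have inv: "\<Phi> (\<Psi> v) = v" for v
  proof -
    have "\<Phi> (\<Psi> v) = (\<Sum>b\<in>Basis. (v \<bullet> b) *\<^sub>R b)"
      unfolding \<Phi>_def by (intro sum.cong refl) (simp add: \<Psi>b, simp add: \<Psi>_def inner_add_right)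
    then show ?thesis by (simp add: euclidean_representation)
  qed
  have \<Psi>m[measurable]: "\<Psi> \<in> borel_measurable borel"
    unfolding \<Psi>_def by (intro borel_measurable_continuous_onI continuous_intros)
  have \<Phi>m[measurable]: "\<Phi> \<in> borel_measurable borel"
  proof -
    have [measurable]: "(\<lambda>p::'a \<times> real. fst p) \<in> borel_measurable borel" "(\<lambda>p::'a \<times> real. snd p) \<in> borel_measurable borel"
      by (intro borel_measurable_continuous_onI continuous_intros)+
    show ?thesis unfolding \<Phi>_def by measurable
  qed
  define K :: "('a \<times> real) set" where "K = {p. (\<forall>b\<in>Basis. 0 \<le> fst p \<bullet> b \<and> fst p \<bullet> b \<le> 1)} \<inter> {p. 0 \<le> snd p \<and> snd p \<le> 1}"
  have K: "compact K"
  proof -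
    have "K = cbox 0 (\<Sum>b\<in>Basis. b) \<times> cbox 0 1"
      by (auto simp: K_def mem_box inner_sum_left_Basis)
    then show ?thesis by (simp add: compact_Times)
  qed
  have \<Psi>K: "\<Psi> v \<in> K" if "v \<in> dual_points \<Omega>" for v
    using that e unfolding K_def dual_points_def by (auto simp: \<Psi>b) (auto simp: \<Psi>_def)
  interpret R: function_ring_on "Collect laplace_monomials" K
  proof
    show "compact K" by (rule K)
    show "continuous_on K f" if "f \<in> Collect laplace_monomials" for f
      using that laplace_monomials_continuous by auto
    show "(\<lambda>x. f x + g x) \<in> Collect laplace_monomials" "(\<lambda>x. f x * g x) \<in> Collect laplace_monomials"
      if "f \<in> Collect laplace_monomials" "g \<in> Collect laplace_monomials" for f g :: "'a \<times> real \<Rightarrow> real"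
      using that laplace_monomials.add laplace_monomials_mult by auto
    show "(\<lambda>_. c) \<in> Collect laplace_monomials" for c
      using laplace_monomials.mono[of c 0 "\<lambda>_. 0"] by simp
    show "\<exists>f\<in>Collect laplace_monomials. f x \<noteq> f y" if "x \<in> K" "y \<in> K" "x \<noteq> y" for x y
    proof (cases "snd x = snd y")
      case False
      have "laplace_monomials (snd :: 'a \<times> real \<Rightarrow> real)"
        using laplace_monomials.mono[of 1 1 "\<lambda>_. 0"] by simp
      then show ?thesis using False by (intro bexI[of _ snd]) simp_all
    next
      case True
      then have "fst x \<noteq> fst y" using that by (simp add: prod_eq_iff)
      then obtain b where b: "b \<in> Basis" "fst x \<bullet> b \<noteq> fst y \<bullet> b" using euclidean_eqI by blast
      have pr: "(\<Prod>c\<in>Basis. (fst p \<bullet> c) ^ (if c = b then 1 else 0)) = fst p \<bullet> b" for p :: "'a \<times> real"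
        using b(1) by (subst prod.remove[OF finite_Basis b(1)]) (auto intro!: prod.neutral)
      have "laplace_monomials (\<lambda>p::'a \<times> real. fst p \<bullet> b)"
        using laplace_monomials.mono[of 1 0 "\<lambda>c. if c = b then 1 else 0"]
        unfolding pr mult_1_left power_0 .
      then show ?thesis using b(2) by (intro bexI[of _ "\<lambda>p. fst p \<bullet> b"]) simp_all
    qed
  qed
  have meas: "(\<lambda>v. f (\<Psi> v)) \<in> borel_measurable L" if "sets L = sets borel" "continuous_on UNIV f" for L and f :: "_ \<Rightarrow> real"
  proof -
    have "(\<lambda>v. f (\<Psi> v)) \<in> borel_measurable borel"
      using borel_measurable_continuous_onI[OF that(2)] \<Psi>m by measurable
    then show ?thesis using measurable_cong_sets[OF that(1) refl] by blast
  qed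
  \<comment> \<open>A polynomial is bounded only on the cube, but almost every v is mapped into
    \<open>K\<close>.\<close>
  have int: "integrable L (\<lambda>v. f (\<Psi> v))"
    if L: "finite_measure L" "sets L = sets borel" "AE v in L. v \<in> dual_points \<Omega>" and f: "continuous_on UNIV f"
    for L and f :: "_ \<Rightarrow> real"
  proof -
    interpret L: finite_measure L by fact
    have "compact (f ` K)" using K f by (intro compact_continuous_image) (auto intro: continuous_on_subset)
    then obtain B where B: "\<And>p. p \<in> K \<Longrightarrow> \<bar>f p\<bar> \<le> B"
      using compact_imp_bounded bounded_iff by (metis image_eqI real_norm_def)
    show ?thesis
    proof (rule L.integrable_const_bound[of _ B])
      show "AE v in L. norm (f (\<Psi> v)) \<le> B"
        using L(3) by eventually_elim (use B \<Psi>K in auto)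
    qed (rule meas[OF L(2) f])
  qed
  have mono_eq: "(LINT v|M. f (\<Psi> v)) = (LINT v|N. f (\<Psi> v))" if "laplace_monomials f" for f
    using that
  proof induction
    case (mono c k n)
    \<comment> \<open>The exponents count how often e and the e + b occur. If all of them vanish,
      then \<open>?x\<close> is 0, and the hypothesis at 0 compares the total masses.\<close>
    let ?x = "real k *\<^sub>R e + (\<Sum>b\<in>Basis. real (n b) *\<^sub>R (e + b))"
    have pr: "(\<Prod>b\<in>Basis. (fst (\<Psi> v) \<bullet> b) ^ n b) = exp (- (v \<bullet> (\<Sum>b\<in>Basis. real (n b) *\<^sub>R (e + b))))" for v
      by (simp add: \<Psi>b inner_sum_right exp_sum sum_negf[symmetric] exp_of_nat_mult[symmetric])
    have eq1: "c * snd (\<Psi> v) ^ k * (\<Prod>b\<in>Basis. (fst (\<Psi> v) \<bullet> b) ^ n b) = c * exp (- (v \<bullet> ?x))" for v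
      unfolding pr by (simp add: \<Psi>_def exp_of_nat_mult[symmetric] exp_add[symmetric] inner_add_right)
    have xin: "?x \<in> insert 0 \<Omega>"
    proof -
      have n: "real m *\<^sub>R y \<in> insert 0 \<Omega>" if "y \<in> \<Omega>" for m y
        using that \<Omega> unfolding open_convex_cone_def by (cases "m = 0") auto
      have "(\<Sum>b\<in>B. real (n b) *\<^sub>R (e + b)) \<in> insert 0 \<Omega>" if "finite B" "B \<subseteq> Basis" for B
        using that
      proof (induction B rule: finite_induct)
        case (insert b B)
        then have "real (n b) *\<^sub>R (e + b) \<in> insert 0 \<Omega>" using n e(2) by auto
        then have "real (n b) *\<^sub>R (e + b) + (\<Sum>b\<in>B. real (n b) *\<^sub>R (e + b)) \<in> insert 0 \<Omega>"
          using insert by (intro add_in) auto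
        then show ?case unfolding sum.insert[OF insert.hyps(1,2)] .
      qed simp
      then show ?thesis using n[OF e(1)] by (intro add_in) auto
    qed
    show ?case unfolding eq1 using eq[OF xin] by (simp only: integral_mult_right_zero)
  next
    case (add f g)
    have "continuous_on UNIV f" "continuous_on UNIV g"
      using add.hyps laplace_monomials_continuous by auto
    then show ?case
      using add.IH int[OF M] int[OF N] by simp
  qed
  have cont_eq: "(LINT v|M. f (\<Psi> v)) = (LINT v|N. f (\<Psi> v))" if f: "continuous_on UNIV f" for f :: "'a \<times> real \<Rightarrow> real"
  proof -
    have "continuous_on K f" using f by (rule continuous_on_subset) simp
    from R.Stone_Weierstrass[OF this]
    obtain F where F: "\<And>n. laplace_monomials (F n)" "uniform_limit K F f sequentially" by auto
    have conv: "(\<lambda>n. LINT v|L. F n (\<Psi> v)) \<longlonglongrightarrow> (LINT v|L. f (\<Psi> v))"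
      if L: "finite_measure L" "sets L = sets borel" "AE v in L. v \<in> dual_points \<Omega>" for L
      unfolding tendsto_iff
    proof (intro allI impI)
      interpret L: finite_measure L by fact
      fix r :: real assume r: "r > 0"
      let ?m = "measure L (space L)"
      have "r / (?m + 1) > 0" using r by (intro divide_pos_pos) (auto intro: add_nonneg_pos)
      from uniform_limitD[OF F(2) this]
      show "\<forall>\<^sub>F n in sequentially. dist (LINT v|L. F n (\<Psi> v)) (LINT v|L. f (\<Psi> v)) < r"
      proof eventually_elim
        case (elim n)
        have Fc: "continuous_on UNIV (F n)" using F(1) laplace_monomials_continuous by blast
        have "\<bar>(LINT v|L. F n (\<Psi> v)) - (LINT v|L. f (\<Psi> v))\<bar> = \<bar>LINT v|L. F n (\<Psi> v) - f (\<Psi> v)\<bar>"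
          using int[OF L Fc] int[OF L f] by simp
        also have "\<dots> \<le> (LINT v|L. \<bar>F n (\<Psi> v) - f (\<Psi> v)\<bar>)" by (rule integral_abs_bound)
        also have "\<dots> \<le> (LINT v|L. r / (?m + 1))"
        proof (rule integral_mono_AE)
          show "integrable L (\<lambda>v. \<bar>F n (\<Psi> v) - f (\<Psi> v)\<bar>)" using int[OF L Fc] int[OF L f] by simp
          show "AE v in L. \<bar>F n (\<Psi> v) - f (\<Psi> v)\<bar> \<le> r / (?m + 1)"
            using L(3)
          proof eventually_elim
            case (elim v)
            then show ?case using \<open>\<forall>x\<in>K. dist (F n x) (f x) < r / (?m + 1)\<close> \<Psi>K by (force simp: dist_real_def)
          qed
        qed simp
        also have "\<dots> = ?m * r / (?m + 1)" by simp
        also have "\<dots> < r"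
        proof -
          have "?m + 1 > 0" using measure_nonneg[of L "space L"] by linarith
          then show ?thesis using r by (simp add: pos_divide_less_eq distrib_left mult.commute)
        qed
        finally show ?case by (simp add: dist_real_def)
      qed
    qed
    have "(\<lambda>n. LINT v|M. F n (\<Psi> v)) = (\<lambda>n. LINT v|N. F n (\<Psi> v))" using mono_eq[OF F(1)] by simp
    then show ?thesis using conv[OF M] conv[OF N] LIMSEQ_unique by metis
  qed
  have \<Psi>M: "\<Psi> \<in> measurable M borel" "\<Psi> \<in> measurable N borel"
    using \<Psi>m measurable_cong_sets[OF M(2) refl] measurable_cong_sets[OF N(2) refl] by blast+
  have "distr M borel \<Psi> = distr N borel \<Psi>"
  proof (rule finite_borel_measure_eqI)
    show "finite_measure (distr M borel \<Psi>)" "finite_measure (distr N borel \<Psi>)"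
      using M(1) N(1) \<Psi>M by (auto intro: finite_measure.finite_measure_distr)
    fix f :: "'a \<times> real \<Rightarrow> real" assume f: "continuous_on UNIV f"
    then show "(LINT x|distr M borel \<Psi>. f x) = (LINT x|distr N borel \<Psi>. f x)"
      using cont_eq[OF f] borel_measurable_continuous_onI[OF f] \<Psi>M by (simp add: integral_distr)
  qed auto
  moreover have "distr (distr L borel \<Psi>) borel \<Phi> = L" if "sets L = sets borel" "\<Psi> \<in> measurable L borel" for L
  proof -
    have "distr (distr L borel \<Psi>) borel \<Phi> = distr L borel (\<Phi> \<circ> \<Psi>)"
      using that(2) by (intro distr_distr) auto
    also have "\<Phi> \<circ> \<Psi> = (\<lambda>v. v)" using inv by (simp add: fun_eq_iff)
    also have "distr L borel (\<lambda>v. v) = L" using that(1) by (intro distr_id2) simp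
    finally show ?thesis .
  qed
  ultimately show ?thesis using M(2) N(2) \<Psi>M by metis
qed

text \<open>Weighting by \<open>exp (- (v \<bullet> x0))\<close> with x0 in \<Omega> makes both
  measures finite and shifts their transforms by x0, into \<Omega>. The weight is positive and can
  be divided out afterwards.\<close>

lemma laplace_unique:
  fixes M N :: "'a::euclidean_space measure"
  assumes \<Omega>: "open_convex_cone \<Omega>" and M: "sets M = sets borel" "AE v in M. v \<in> dual_points \<Omega>"
    and N: "sets N = sets borel" "AE v in N. v \<in> dual_points \<Omega>"
    and iM: "\<And>x. x \<in> \<Omega> \<Longrightarrow> integrable M (\<lambda>v. exp (- (v \<bullet> x)))"
    and iN: "\<And>x. x \<in> \<Omega> \<Longrightarrow> integrable N (\<lambda>v. exp (- (v \<bullet> x)))"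
    and eq: "\<And>x. x \<in> \<Omega> \<Longrightarrow> (LINT v|M. exp (- (v \<bullet> x))) = (LINT v|N. exp (- (v \<bullet> x)))"
  shows "M = N"
proof -
  obtain x0 where x0: "x0 \<in> \<Omega>" using \<Omega> unfolding open_convex_cone_def by blast
  let ?D = "\<lambda>L. density L (\<lambda>v. ennreal (exp (- (v \<bullet> x0))))"
  have meas: "(\<lambda>v. exp (c * (v \<bullet> x))) \<in> borel_measurable L" if "sets L = sets borel" for L and x :: 'a and c
  proof -
    have "(\<lambda>v. exp (c * (v \<bullet> x))) \<in> borel_measurable borel"
      by (intro borel_measurable_continuous_onI continuous_intros)
    then show ?thesis using measurable_cong_sets[OF that refl] by blast
  qed
  have fin: "finite_measure (?D L)" if L: "sets L = sets borel" "integrable L (\<lambda>v. exp (- (v \<bullet> x0)))" for L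
  proof (rule finite_measureI)
    have "emeasure (?D L) (space (?D L)) = (\<integral>\<^sup>+ v. ennreal (exp (- (v \<bullet> x0))) \<partial>L)"
      using meas[OF L(1), of "-1" x0] by (simp add: emeasure_density cong: nn_integral_cong)
    also have "\<dots> = ennreal (LINT v|L. exp (- (v \<bullet> x0)))" using L(2) by (intro nn_integral_eq_integral) auto
    finally show "emeasure (?D L) (space (?D L)) \<noteq> \<infinity>" by simp
  qed
  have AEd: "AE v in ?D L. v \<in> dual_points \<Omega>" if "sets L = sets borel" "AE v in L. v \<in> dual_points \<Omega>" for L
    using that meas[OF that(1), of "-1" x0] by (auto simp: AE_density elim: eventually_mono)
  have int: "(LINT v|?D L. exp (- (v \<bullet> x))) = (LINT v|L. exp (- (v \<bullet> (x + x0))))" if "sets L = sets borel" for L x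
  proof -
    have "(LINT v|?D L. exp (- (v \<bullet> x))) = (LINT v|L. exp (- (v \<bullet> x0)) * exp (- (v \<bullet> x)))"
      using meas[OF that, of "-1" x0] meas[OF that, of "-1" x] by (intro integral_real_density) auto
    then show ?thesis by (simp add: exp_add[symmetric] inner_add_right algebra_simps)
  qed
  have "?D M = ?D N"
  proof (rule laplace_unique_finite[OF \<Omega> fin[OF M(1) iM[OF x0]] _ AEd[OF M] fin[OF N(1) iN[OF x0]] _ AEd[OF N]])
    fix x assume "x \<in> insert 0 \<Omega>"
    then have "x + x0 \<in> \<Omega>" using x0 open_convex_cone_add[OF \<Omega>] by auto
    then show "(LINT v|?D M. exp (- (v \<bullet> x))) = (LINT v|?D N. exp (- (v \<bullet> x)))"
      using eq int[OF M(1)] int[OF N(1)] by simp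
  qed (use M N in auto)
  moreover have "density (?D L) (\<lambda>v. ennreal (exp (v \<bullet> x0))) = L" if L: "sets L = sets borel" for L
  proof -
    have "density (?D L) (\<lambda>v. ennreal (exp (v \<bullet> x0))) = density L (\<lambda>v. ennreal (exp (- (v \<bullet> x0))) * ennreal (exp (v \<bullet> x0)))"
      using meas[OF L, of "-1" x0] meas[OF L, of 1 x0] by (intro density_density_eq) auto
    also have "(\<lambda>v::'a. ennreal (exp (- (v \<bullet> x0))) * ennreal (exp (v \<bullet> x0))) = (\<lambda>_. 1)"
      by (simp add: ennreal_mult[symmetric] exp_add[symmetric])
    finally show ?thesis by (simp add: density_1)
  qed
  ultimately show ?thesis using M(1) N(1) by metis
qed

lemma exp_inner_measurable:
  fixes M :: "'a::euclidean_space measure"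
  assumes "sets M = sets borel" shows "(\<lambda>v. exp (- (v \<bullet> x))) \<in> borel_measurable M"
proof -
  have "(\<lambda>v::'a. exp (- (v \<bullet> x))) \<in> borel_measurable borel"
    by (intro borel_measurable_continuous_onI continuous_intros)
  then show ?thesis using measurable_cong_sets[OF assms refl] by blast
qed

text \<open>Near a the exponentials \<open>exp (- v \<bullet> x)\<close> are dominated by \<open>exp (- v \<bullet> (a / 2))\<close> on the dual cone.\<close>

lemma laplace_continuous:
  fixes M :: "'a::euclidean_space measure"
  assumes \<Omega>: "open_convex_cone \<Omega>" and M: "sets M = sets borel" "AE v in M. v \<in> dual_points \<Omega>"
    and int: "\<And>x. x \<in> \<Omega> \<Longrightarrow> integrable M (\<lambda>v. exp (- (v \<bullet> x)))" and a: "a \<in> \<Omega>"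
  shows "isCont (\<lambda>x. LINT v|M. exp (- (v \<bullet> x))) a"
  unfolding continuous_at_sequentially o_def
proof (intro allI impI)
  fix u :: "nat \<Rightarrow> 'a" assume u: "u \<longlonglongrightarrow> a"
  let ?h = "(1/2) *\<^sub>R a"
  have h: "?h \<in> \<Omega>" using \<Omega> a unfolding open_convex_cone_def by simp
  \<comment> \<open>a is the sum of two copies of a / 2, so it lies in the open set a / 2 +
    \<Omega>; nearby points are a / 2 plus a vector of \<Omega>, on which v is nonnegative.\<close>
  have op: "open ((\<lambda>x. ?h + x) ` \<Omega>)"
    using \<Omega> unfolding open_convex_cone_def by (intro open_translation) blast
  have aa: "a = ?h + ?h" by (simp flip: scaleR_left_distrib)
  have "a \<in> (\<lambda>x. ?h + x) ` \<Omega>" using aa h by blast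
  from topological_tendstoD[OF u op this]
  obtain N where N: "\<And>n. n \<ge> N \<Longrightarrow> u n \<in> (\<lambda>x. ?h + x) ` \<Omega>"
    unfolding eventually_sequentially by blast
  have "(\<lambda>n. LINT v|M. exp (- (v \<bullet> u (n + N)))) \<longlonglongrightarrow> (LINT v|M. exp (- (v \<bullet> a)))"
  proof (rule integral_dominated_convergence[where w = "\<lambda>v. exp (- (v \<bullet> ?h))"])
    show "AE v in M. norm (exp (- (v \<bullet> u (n + N)))) \<le> exp (- (v \<bullet> ?h))" for n
    proof -
      obtain x where x: "x \<in> \<Omega>" "u (n + N) = ?h + x" using N[of "n + N"] by auto
      show ?thesis using M(2)
        by eventually_elim (use x in \<open>auto simp: dual_points_def inner_add_right\<close>)
    qed
    show "AE v in M. (\<lambda>n. exp (- (v \<bullet> u (n + N)))) \<longlonglongrightarrow> exp (- (v \<bullet> a))"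
      by (intro AE_I2 tendsto_intros LIMSEQ_ignore_initial_segment u)
  qed (use int[OF h] exp_inner_measurable[OF M(1)] in auto)
  then show "(\<lambda>n. LINT v|M. exp (- (v \<bullet> u n))) \<longlonglongrightarrow> (LINT v|M. exp (- (v \<bullet> a)))"
    by (rule LIMSEQ_offset)
qed

section \<open>Analyticity of Laplace transforms\<close>

lemma exp_partial_sum_le:
  fixes y :: real
  assumes "0 \<le> y" shows "(\<Sum>j\<le>N. y ^ j / fact j) \<le> exp y"
proof -
  have s: "(\<lambda>j. y ^ j / fact j) sums exp y"
    using exp_converges[of y] by (simp add: divide_inverse mult.commute)
  show ?thesis
    using sum_le_suminf[OF sums_summable[OF s], of "{..N}"] assms sums_unique[OF s] by simp
qed

text \<open>\<open>exp (- (v \<bullet> z))\<close> is expanded coordinate by coordinate, and the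
  multiple series is integrated term by term. The function w dominates all finite sums of absolute
  values: this gives absolute summability, and dominated convergence along boxes of multi-indices
  identifies the sum.\<close>

lemma laplace_has_sum:
  fixes M :: "'a::euclidean_space measure"
  assumes M: "sets M = sets borel" and w: "integrable M w"
    and le: "\<And>v. exp (- (v \<bullet> a)) * exp (\<Sum>b\<in>Basis. \<bar>(v \<bullet> b) * (z \<bullet> b)\<bar>) \<le> w v"
  shows "((\<lambda>k. (LINT v|M. exp (- (v \<bullet> a)) * (\<Prod>b\<in>Basis. (- (v \<bullet> b)) ^ k b / fact (k b)))
      * (\<Prod>b\<in>Basis. (z \<bullet> b) ^ k b)) has_sum (LINT v|M. exp (- (v \<bullet> (a + z)))))
      (Basis \<rightarrow>\<^sub>E (UNIV :: nat set))"
proof -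
  let ?P = "Basis \<rightarrow>\<^sub>E (UNIV :: nat set) :: ('a \<Rightarrow> nat) set"
  define u where "u k v = exp (- (v \<bullet> a)) * (\<Prod>b\<in>Basis. (- (v \<bullet> b) * (z \<bullet> b)) ^ k b / fact (k b))"
    for k and v :: 'a
  define P :: "nat \<Rightarrow> ('a \<Rightarrow> nat) set" where "P N = Basis \<rightarrow>\<^sub>E {..N}" for N
  have finP: "finite (P N)" and subP: "P N \<subseteq> ?P" for N unfolding P_def by (auto intro: finite_PiE)
  have cover: "\<exists>N. A \<subseteq> P N" if A: "finite A" "A \<subseteq> ?P" for A
  proof -
    have "finite (\<Union>k\<in>A. k ` Basis)"
      by (rule finite_UN_I[OF A(1) finite_imageI[OF finite_Basis]])
    then obtain N where N: "(\<Union>k\<in>A. k ` Basis) \<subseteq> {..N}" using finite_nat_iff_bounded_le by blast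
    have "k \<in> P N" if "k \<in> A" for k
      unfolding P_def
    proof (rule PiE_I)
      show "k b \<in> {..N}" if "b \<in> Basis" for b using N \<open>k \<in> A\<close> that by blast
      have "k \<in> ?P" using A(2) \<open>k \<in> A\<close> by blast
      then show "k b = undefined" if "b \<notin> Basis" for b using that by (rule PiE_arb)
    qed
    then show ?thesis by blast
  qed
  have um: "u k \<in> borel_measurable M" for k
  proof -
    have "u k \<in> borel_measurable borel"
      unfolding u_def by (intro borel_measurable_continuous_onI continuous_intros) auto
    then show ?thesis using measurable_cong_sets[OF M refl] by blast
  qed
  \<comment> \<open>Over a box the sum of products is a product of partial sums of exponential
    series, each at most the full exponential.\<close>
  have absP: "(\<Sum>k\<in>P N. \<bar>u k v\<bar>) \<le> w v" for N v
  proof -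
    have "(\<Sum>k\<in>P N. \<Prod>b\<in>Basis. \<bar>(v \<bullet> b) * (z \<bullet> b)\<bar> ^ k b / fact (k b))
        = (\<Prod>b\<in>Basis. \<Sum>j\<le>N. \<bar>(v \<bullet> b) * (z \<bullet> b)\<bar> ^ j / fact j)"
      unfolding P_def by (rule prod_sum_PiE[symmetric]) auto
    also have "\<dots> \<le> (\<Prod>b\<in>Basis. exp \<bar>(v \<bullet> b) * (z \<bullet> b)\<bar>)"
      by (intro prod_mono conjI exp_partial_sum_le sum_nonneg) auto
    also have "\<dots> = exp (\<Sum>b\<in>Basis. \<bar>(v \<bullet> b) * (z \<bullet> b)\<bar>)" by (simp add: exp_sum)
    finally have 1: "exp (- (v \<bullet> a)) * (\<Sum>k\<in>P N. \<Prod>b\<in>Basis. \<bar>(v \<bullet> b) * (z \<bullet> b)\<bar> ^ k b / fact (k b))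
        \<le> exp (- (v \<bullet> a)) * exp (\<Sum>b\<in>Basis. \<bar>(v \<bullet> b) * (z \<bullet> b)\<bar>)"
      by (rule mult_left_mono) simp
    have "(\<Sum>k\<in>P N. \<bar>u k v\<bar>) = exp (- (v \<bullet> a)) *
        (\<Sum>k\<in>P N. \<Prod>b\<in>Basis. \<bar>(v \<bullet> b) * (z \<bullet> b)\<bar> ^ k b / fact (k b))"
      by (simp add: u_def abs_mult abs_prod power_abs sum_distrib_left)
    then show ?thesis using 1 le[of v] by linarith
  qed
  have absA: "(\<Sum>k\<in>A. \<bar>u k v\<bar>) \<le> w v" if "finite A" "A \<subseteq> ?P" for A v
  proof -
    from cover[OF that] obtain N where N: "A \<subseteq> P N" ..
    have "(\<Sum>k\<in>A. \<bar>u k v\<bar>) \<le> (\<Sum>k\<in>P N. \<bar>u k v\<bar>)" by (rule sum_mono2[OF finP N]) simp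
    then show ?thesis using absP[of v N] by linarith
  qed
  have iu: "integrable M (u k)" if k: "k \<in> ?P" for k
  proof (rule Bochner_Integration.integrable_bound[OF w um])
    have "\<bar>u k v\<bar> \<le> w v" for v using absA[of "{k}" v] k by simp
    then show "AE v in M. norm (u k v) \<le> norm (w v)"
      by (intro AE_I2) (metis abs_ge_self order_trans real_norm_def)
  qed
  define U where "U k = (LINT v|M. u k v)" for k
  have "(\<lambda>k. norm (U k)) summable_on ?P"
  proof (rule nonneg_bdd_above_summable_on)
    show "bdd_above (sum (\<lambda>k. norm (U k)) ` {F. F \<subseteq> ?P \<and> finite F})"
    proof (rule bdd_aboveI2)
      fix F assume "F \<in> {F. F \<subseteq> ?P \<and> finite F}"
      then have F: "F \<subseteq> ?P" "finite F" by auto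
      have "(\<Sum>k\<in>F. norm (U k)) \<le> (\<Sum>k\<in>F. (LINT v|M. \<bar>u k v\<bar>))"
        unfolding U_def by (intro sum_mono) (simp add: integral_abs_bound)
      also have "\<dots> = (LINT v|M. (\<Sum>k\<in>F. \<bar>u k v\<bar>))"
        using F iu by (subst Bochner_Integration.integral_sum) auto
      also have "\<dots> \<le> (LINT v|M. w v)"
        using F iu absA w by (intro integral_mono Bochner_Integration.integrable_sum) auto
      finally show "(\<Sum>k\<in>F. norm (U k)) \<le> (LINT v|M. w v)" .
    qed
  qed simp
  then have "U summable_on ?P" by (rule abs_summable_summable)
  then have hs: "(U has_sum infsum U ?P) ?P" by (rule has_sum_infsum)
  \<comment> \<open>Every finite set of multi-indices lies in some box, so the unordered sum is the
    limit along the boxes.\<close>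
  have "filterlim P (finite_subsets_at_top ?P) sequentially"
    unfolding filterlim_finite_subsets_at_top
  proof (intro allI impI)
    fix A assume A: "finite A \<and> A \<subseteq> ?P"
    from cover[OF conjunct1[OF A] conjunct2[OF A]] obtain N where N: "A \<subseteq> P N" ..
    have PN: "P N \<subseteq> P n" if "n \<ge> N" for n using that unfolding P_def by (intro PiE_mono) auto
    show "\<forall>\<^sub>F n in sequentially. finite (P n) \<and> A \<subseteq> P n \<and> P n \<subseteq> ?P"
      unfolding eventually_sequentially
      by (intro exI[of _ N] allI impI conjI finP subP order_trans[OF N] PN)
  qed
  from filterlim_compose[OF hs[unfolded has_sum_def] this]
  have 1: "(\<lambda>N. \<Sum>k\<in>P N. U k) \<longlonglongrightarrow> infsum U ?P" .
  have "(\<lambda>N. LINT v|M. (\<Sum>k\<in>P N. u k v)) \<longlonglongrightarrow> (LINT v|M. exp (- (v \<bullet> (a + z))))"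
  proof (rule integral_dominated_convergence[where w = w])
    show "(\<lambda>v. \<Sum>k\<in>P N. u k v) \<in> borel_measurable M" for N using um by auto
    show "(\<lambda>v. exp (- (v \<bullet> (a + z)))) \<in> borel_measurable M" by (rule exp_inner_measurable[OF M])
    show "AE v in M. norm (\<Sum>k\<in>P N. u k v) \<le> w v" for N
      unfolding real_norm_def by (intro AE_I2 order_trans[OF sum_abs absP])
    show "AE v in M. (\<lambda>N. \<Sum>k\<in>P N. u k v) \<longlonglongrightarrow> exp (- (v \<bullet> (a + z)))"
    proof (intro AE_I2)
      fix v
      have s: "(\<lambda>N. \<Sum>j\<le>N. y ^ j / fact j) \<longlonglongrightarrow> exp y" for y :: real
        using exp_converges[of y] by (simp add: divide_inverse mult.commute sums_def_le)
      have "(\<Sum>k\<in>P N. u k v) = exp (- (v \<bullet> a)) * (\<Prod>b\<in>Basis. \<Sum>j\<le>N. (- (v \<bullet> b) * (z \<bullet> b)) ^ j / fact j)" for N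
        unfolding u_def sum_distrib_left[symmetric] P_def by (subst prod_sum_PiE) auto
      moreover have "(\<lambda>N. exp (- (v \<bullet> a)) * (\<Prod>b\<in>Basis. \<Sum>j\<le>N. (- (v \<bullet> b) * (z \<bullet> b)) ^ j / fact j))
          \<longlonglongrightarrow> exp (- (v \<bullet> a)) * (\<Prod>b\<in>Basis. exp (- (v \<bullet> b) * (z \<bullet> b)))"
        by (intro tendsto_intros s)
      moreover have "exp (- (v \<bullet> a)) * (\<Prod>b\<in>Basis. exp (- (v \<bullet> b) * (z \<bullet> b))) = exp (- (v \<bullet> (a + z)))"
        by (simp add: exp_sum[symmetric] exp_add[symmetric] inner_add_right sum_negf euclidean_inner[of v z])
      ultimately show "(\<lambda>N. \<Sum>k\<in>P N. u k v) \<longlonglongrightarrow> exp (- (v \<bullet> (a + z)))" by (simp only:)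
    qed
  qed (rule w)
  moreover have "(LINT v|M. (\<Sum>k\<in>P N. u k v)) = (\<Sum>k\<in>P N. U k)" for N
    unfolding U_def using iu subP[of N] by (subst Bochner_Integration.integral_sum) auto
  ultimately have Uinf: "infsum U ?P = (LINT v|M. exp (- (v \<bullet> (a + z))))"
    using 1 LIMSEQ_unique by simp
  have "U k = (LINT v|M. exp (- (v \<bullet> a)) * (\<Prod>b\<in>Basis. (- (v \<bullet> b)) ^ k b / fact (k b)))
      * (\<Prod>b\<in>Basis. (z \<bullet> b) ^ k b)" for k
  proof -
    have "u k v = exp (- (v \<bullet> a)) * (\<Prod>b\<in>Basis. (- (v \<bullet> b)) ^ k b / fact (k b)) * (\<Prod>b\<in>Basis. (z \<bullet> b) ^ k b)" for v
      unfolding u_def power_mult_distrib times_divide_eq_left[symmetric] prod.distrib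
      by (simp add: prod.distrib prod_dividef ac_simps)
    then have "u k = (\<lambda>v. exp (- (v \<bullet> a)) * (\<Prod>b\<in>Basis. (- (v \<bullet> b)) ^ k b / fact (k b)) * (\<Prod>b\<in>Basis. (z \<bullet> b) ^ k b))"
      by (rule ext)
    then show ?thesis unfolding U_def by (simp only: integral_mult_left_zero)
  qed
  then have Uf: "U = (\<lambda>k. (LINT v|M. exp (- (v \<bullet> a)) * (\<Prod>b\<in>Basis. (- (v \<bullet> b)) ^ k b / fact (k b)))
      * (\<Prod>b\<in>Basis. (z \<bullet> b) ^ k b))"
    by (rule ext)
  show ?thesis using hs[unfolded Uinf] unfolding Uf .
qed

text \<open>The dominating function is a sum of exponentials at finitely many points of \<Omega>.
  For given v only its largest coordinate c matters: the absolute series is at most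
  \<open>exp (n * r * \<bar>v \<bullet> c\<bar>)\<close>, and one of the two shifts of a along c has
  this exponent.\<close>

lemma laplace_real_analytic:
  fixes M :: "'a::euclidean_space measure"
  assumes \<Omega>: "open_convex_cone \<Omega>" and M: "sets M = sets borel"
    and int: "\<And>x. x \<in> \<Omega> \<Longrightarrow> integrable M (\<lambda>v. exp (- (v \<bullet> x)))"
  shows "real_analytic_on (\<lambda>x. complex_of_real (LINT v|M. exp (- (v \<bullet> x)))) \<Omega>"
  unfolding real_analytic_on_def
proof
  fix a assume a: "a \<in> \<Omega>"
  obtain R where R: "R > 0" "ball a R \<subseteq> \<Omega>"
    using a \<Omega> openE unfolding open_convex_cone_def by blast
  define n where "n = real DIM('a)"
  have n: "n \<ge> 1" unfolding n_def using DIM_positive[where 'a='a] by simp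
  \<comment> \<open>The sum over n coordinates costs a factor n, and \<open>n * r < R\<close> keeps
    the shifted points in the ball.\<close>
  define r where "r = R / (2 * n)"
  have r: "r > 0" "n * r < R" "r \<le> R" using R(1) n by (auto simp: r_def field_simps)
  define w where "w v = (\<Sum>b\<in>Basis. exp (- (v \<bullet> (a + (n * r) *\<^sub>R b))) + exp (- (v \<bullet> (a - (n * r) *\<^sub>R b))))" for v
  have w: "integrable M w"
    unfolding w_def
  proof (intro Bochner_Integration.integrable_sum Bochner_Integration.integrable_add int)
    fix b :: 'a assume "b \<in> Basis"
    then show "a + (n * r) *\<^sub>R b \<in> \<Omega>" "a - (n * r) *\<^sub>R b \<in> \<Omega>"
      using r n by (auto intro!: subsetD[OF R(2)] simp: dist_norm abs_mult)
  qed
  have le: "exp (- (v \<bullet> a)) * exp (\<Sum>b\<in>Basis. \<bar>(v \<bullet> b) * (z \<bullet> b)\<bar>) \<le> w v" if z: "norm z < r" for v z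
  proof -
    obtain c where c: "c \<in> Basis" "\<And>b. b \<in> Basis \<Longrightarrow> \<bar>v \<bullet> b\<bar> \<le> \<bar>v \<bullet> c\<bar>"
    proof -
      have "Max ((\<lambda>b. \<bar>v \<bullet> b\<bar>) ` Basis) \<in> (\<lambda>b. \<bar>v \<bullet> b\<bar>) ` Basis" by (intro Max_in) auto
      then obtain c where c: "c \<in> Basis" "Max ((\<lambda>b. \<bar>v \<bullet> b\<bar>) ` Basis) = \<bar>v \<bullet> c\<bar>" by blast
      have "\<bar>v \<bullet> b\<bar> \<le> \<bar>v \<bullet> c\<bar>" if "b \<in> Basis" for b
        unfolding c(2)[symmetric] using that by (intro Max_ge) auto
      then show thesis using that c(1) by blast
    qed
    have "(\<Sum>b\<in>Basis. \<bar>(v \<bullet> b) * (z \<bullet> b)\<bar>) \<le> (\<Sum>b\<in>(Basis::'a set). \<bar>v \<bullet> c\<bar> * r)"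
    proof (rule sum_mono)
      fix b :: 'a assume b: "b \<in> Basis"
      have "\<bar>z \<bullet> b\<bar> \<le> r" using Basis_le_norm[OF b, of z] z by simp
      then show "\<bar>(v \<bullet> b) * (z \<bullet> b)\<bar> \<le> \<bar>v \<bullet> c\<bar> * r"
        unfolding abs_mult using c(2)[OF b] by (intro mult_mono) auto
    qed
    also have "\<dots> = n * r * \<bar>v \<bullet> c\<bar>" by (simp add: n_def)
    finally have "exp (- (v \<bullet> a)) * exp (\<Sum>b\<in>Basis. \<bar>(v \<bullet> b) * (z \<bullet> b)\<bar>)
        \<le> exp (- (v \<bullet> a)) * exp (n * r * \<bar>v \<bullet> c\<bar>)" by simp
    also have "\<dots> \<le> exp (- (v \<bullet> (a + (n * r) *\<^sub>R c))) + exp (- (v \<bullet> (a - (n * r) *\<^sub>R c)))"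
    proof (cases "v \<bullet> c \<ge> 0")
      case True
      then have "exp (- (v \<bullet> a)) * exp (n * r * \<bar>v \<bullet> c\<bar>) = exp (- (v \<bullet> (a - (n * r) *\<^sub>R c)))"
        by (simp add: exp_add[symmetric] inner_diff_right)
      then show ?thesis by simp
    next
      case False
      then have "exp (- (v \<bullet> a)) * exp (n * r * \<bar>v \<bullet> c\<bar>) = exp (- (v \<bullet> (a + (n * r) *\<^sub>R c)))"
        by (simp add: exp_add[symmetric] inner_add_right)
      then show ?thesis by simp
    qed
    also have "\<dots> \<le> w v"
      unfolding w_def using c(1)
      by (intro member_le_sum[of c Basis "\<lambda>b. exp (- (v \<bullet> (a + (n * r) *\<^sub>R b))) + exp (- (v \<bullet> (a - (n * r) *\<^sub>R b)))"]) (auto intro: add_nonneg_nonneg)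
    finally show ?thesis .
  qed
  define c where "c k = (LINT v|M. exp (- (v \<bullet> a)) * (\<Prod>b\<in>Basis. (- (v \<bullet> b)) ^ k b / fact (k b)))" for k :: "'a \<Rightarrow> nat"
  have "((\<lambda>k. complex_of_real (c k) * (\<Prod>b\<in>Basis. of_real ((x - a) \<bullet> b) ^ k b)) has_sum
      complex_of_real (LINT v|M. exp (- (v \<bullet> x)))) (Basis \<rightarrow>\<^sub>E UNIV)" if x: "x \<in> ball a r" for x
  proof -
    have "norm (x - a) < r" using x by (simp add: dist_norm norm_minus_commute)
    from laplace_has_sum[OF M w le[OF this]]
    have "((\<lambda>k. c k * (\<Prod>b\<in>Basis. ((x - a) \<bullet> b) ^ k b)) has_sum (LINT v|M. exp (- (v \<bullet> x)))) (Basis \<rightarrow>\<^sub>E UNIV)"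
      by (simp add: c_def)
    then have "((\<lambda>k. complex_of_real (c k * (\<Prod>b\<in>Basis. ((x - a) \<bullet> b) ^ k b))) has_sum
        complex_of_real (LINT v|M. exp (- (v \<bullet> x)))) (Basis \<rightarrow>\<^sub>E UNIV)"
      by (rule has_sum_of_real)
    then show ?thesis by (simp add: of_real_prod)
  qed
  moreover have "ball a r \<subseteq> \<Omega>" using R(2) r(3) by auto
  ultimately show "\<exists>r>0. \<exists>c. ball a r \<subseteq> \<Omega> \<and> (\<forall>x\<in>ball a r.
        ((\<lambda>k. c k * (\<Prod>b\<in>Basis. of_real ((x - a) \<bullet> b) ^ k b)) has_sum
         complex_of_real (LINT v|M. exp (- (v \<bullet> x)))) (Basis \<rightarrow>\<^sub>E UNIV))"
    using r(1) by (intro exI[of _ r] conjI exI[of _ "\<lambda>k. complex_of_real (c k)"]) auto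
qed

section \<open>Representation of one-bounded positive definite distributions\<close>

lemma convolution_shift_both:
  assumes f: "cc f" and g: "cc g"
  shows "convolution (\<lambda>z. f (z - a)) (\<lambda>z. g (z - b)) x = convolution f g (x - (a + b))"
proof -
  have "(LINT y|lborel. f (y - a) * g (x - y - b)) = (LINT y|lborel. (\<lambda>w. f w * g (x - (a + b) - w)) (y - a))"
    by (simp add: algebra_simps)
  also have "\<dots> = (LINT y|lborel. f y * g (x - (a + b) - y))"
    by (rule lborel_integral_translate) (rule cc_measurable[OF cc_conv_integrand[OF f g]])
  finally show ?thesis by (simp add: convolution_def)
qed

lemma convolution_sum:
  assumes I: "finite I" and f: "\<And>i. i \<in> I \<Longrightarrow> cc (f i)"
  shows "convolution (\<lambda>z. \<Sum>i\<in>I. c i * f i z) (\<lambda>z. \<Sum>i\<in>I. c i * f i z) x =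
    (\<Sum>p\<in>I \<times> I. (c (fst p) * c (snd p)) * convolution (f (fst p)) (f (snd p)) x)"
proof -
  have "(LINT y|lborel. (\<Sum>i\<in>I. c i * f i y) * (\<Sum>i\<in>I. c i * f i (x - y))) =
      (LINT y|lborel. (\<Sum>p\<in>I \<times> I. (c (fst p) * c (snd p)) * (f (fst p) y * f (snd p) (x - y))))"
    by (simp add: sum_product sum.cartesian_product case_prod_unfold ac_simps)
  also have "\<dots> = (\<Sum>p\<in>I \<times> I. (LINT y|lborel. (c (fst p) * c (snd p)) * (f (fst p) y * f (snd p) (x - y))))"
    using f by (intro Bochner_Integration.integral_sum integrable_mult_right conv_integrable) auto
  finally show ?thesis by (simp add: convolution_def)
qed

text \<open>The estimate behind each approximate identity below: functions \<open>\<psi>\<close>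
  near a point mass, Laplace transforms of bumps near 1, and smeared test functions.\<close>

lemma bump_average:
  fixes \<eta> :: "'a::euclidean_space \<Rightarrow> real" and F :: "'a \<Rightarrow> 'b::{banach, second_countable_topology}"
  assumes \<eta>: "\<And>x. 0 \<le> \<eta> x" "integrable lborel \<eta>" "(LINT x|lborel. \<eta> x) = 1" "\<And>x. x \<notin> K \<Longrightarrow> \<eta> x = 0"
    and F: "integrable lborel (\<lambda>x. \<eta> x *\<^sub>R F x)" and e: "\<And>x. x \<in> K \<Longrightarrow> norm (F x - z) \<le> e"
  shows "norm ((LINT x|lborel. \<eta> x *\<^sub>R F x) - z) \<le> e"
proof -
  have "(LINT x|lborel. \<eta> x *\<^sub>R F x) - z = (LINT x|lborel. \<eta> x *\<^sub>R F x) - (LINT x|lborel. \<eta> x *\<^sub>R z)"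
    using \<eta>(2,3) by (subst integral_scaleR_left) auto
  also have "\<dots> = (LINT x|lborel. \<eta> x *\<^sub>R F x - \<eta> x *\<^sub>R z)"
    using F \<eta>(2) by (intro Bochner_Integration.integral_diff[symmetric]) auto
  also have "norm \<dots> \<le> (LINT x|lborel. norm (\<eta> x *\<^sub>R F x - \<eta> x *\<^sub>R z))" by (rule integral_norm_bound)
  also have "\<dots> \<le> (LINT x|lborel. \<eta> x * e)"
  proof (rule integral_mono)
    show "integrable lborel (\<lambda>x. norm (\<eta> x *\<^sub>R F x - \<eta> x *\<^sub>R z))"
      using F \<eta>(2) by (intro integrable_norm Bochner_Integration.integrable_diff) auto
    show "integrable lborel (\<lambda>x. \<eta> x * e)" using \<eta>(2) by simp
    show "norm (\<eta> x *\<^sub>R F x - \<eta> x *\<^sub>R z) \<le> \<eta> x * e" for x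
      using \<eta>(1,4)[of x] e[of x]
      by (cases "x \<in> K") (auto simp: scaleR_diff_right[symmetric] intro: mult_left_mono)
  qed
  also have "\<dots> = e" using \<eta>(3) by simp
  finally show ?thesis .
qed

text \<open>The integrand is nonnegative, so integrability of the iterated integral, which is
  \<open>int\<close>, already yields integrability on the product, and Fubini applies.\<close>

lemma laplace_average:
  fixes M :: "'a::euclidean_space measure" and \<phi> :: "'a \<Rightarrow> real"
  assumes M: "finite_measure M" "sets M = sets borel" "AE v in M. v \<in> dual_points \<Omega>"
    and \<phi>: "\<phi> \<in> borel_measurable borel" "\<And>x. 0 \<le> \<phi> x" "\<And>x. x \<notin> \<Omega> \<Longrightarrow> \<phi> x = 0"
    and int: "integrable lborel (\<lambda>y. \<phi> y * (LINT v|M. exp (- (v \<bullet> y))))"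
  shows "(LINT y|lborel. \<phi> y * (LINT v|M. exp (- (v \<bullet> y)))) =
    (LINT v|M. (LINT y|lborel. \<phi> y * exp (- (v \<bullet> y))))"
proof -
  interpret M: finite_measure M by fact
  interpret P: pair_sigma_finite lborel M ..
  let ?F = "\<lambda>(y, v). \<phi> y * exp (- (v \<bullet> y))"
  have iM: "integrable M (\<lambda>v. \<phi> y * exp (- (v \<bullet> y)))" for y
  proof (cases "y \<in> \<Omega>")
    case True
    have "integrable M (\<lambda>v. exp (- (v \<bullet> y)))"
      by (rule M.integrable_const_bound[of _ 1, OF _ exp_inner_measurable[OF M(2)]])
         (use M(3) True in \<open>auto simp: dual_points_def elim!: eventually_mono\<close>)
    then show ?thesis by simp
  qed (simp add: \<phi>(3))
  have meas: "?F \<in> borel_measurable (lborel \<Otimes>\<^sub>M M)"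
  proof -
    have "sets (lborel \<Otimes>\<^sub>M M) = sets (borel \<Otimes>\<^sub>M borel :: ('a \<times> 'a) measure)"
      by (rule sets_pair_measure_cong) (simp_all add: M(2))
    moreover have "?F \<in> borel_measurable (borel \<Otimes>\<^sub>M borel)"
      using \<phi>(1) by measurable
    ultimately show ?thesis using measurable_cong_sets[OF _ refl] by blast
  qed
  have "integrable (lborel \<Otimes>\<^sub>M M) ?F"
  proof (rule P.Fubini_integrable[OF meas])
    have "(LINT v|M. norm (?F (y, v))) = \<phi> y * (LINT v|M. exp (- (v \<bullet> y)))" for y
      using \<phi>(2) by (simp add: abs_mult)
    then show "integrable lborel (\<lambda>y. LINT v|M. norm (?F (y, v)))" using int by simp
  qed (use iM in simp)
  from P.Fubini_integral[OF this] show ?thesis by simp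
qed

text \<open>A bump around 0 would leave the cone. Its centre is therefore moved along a ray to a
  point of norm at most d / 2, and its radius is kept below d / 2 and small enough to stay in
  \<Omega>.\<close>

lemma bump_functions_in_cone:
  fixes \<Omega> :: "'a::euclidean_space set"
  assumes \<Omega>: "open_convex_cone \<Omega>" and d: "d > 0"
  obtains \<rho> :: "'a \<Rightarrow> real" where "(\<lambda>x. complex_of_real (\<rho> x)) \<in> test_functions \<Omega>" "\<And>x. 0 \<le> \<rho> x"
    "supp (\<lambda>x. complex_of_real (\<rho> x)) \<subseteq> cball 0 d" "(LINT x|lborel. \<rho> x) = 1"
proof -
  obtain x0 where x0: "x0 \<in> \<Omega>" using \<Omega> unfolding open_convex_cone_def by blast
  define t where "t = d / (2 * (norm x0 + 1))"
  have t: "t > 0" unfolding t_def using d by (intro divide_pos_pos) (auto intro: add_nonneg_pos)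
  have "t * (norm x0 + 1) = d / 2"
    unfolding t_def using norm_ge_zero[of x0] by (simp add: field_simps add_nonneg_eq_0_iff)
  then have tn: "norm (t *\<^sub>R x0) \<le> d / 2" using t by (simp add: distrib_left)
  have "t *\<^sub>R x0 \<in> \<Omega>" "open \<Omega>" using \<Omega> x0 t unfolding open_convex_cone_def by auto
  then obtain s where s: "s > 0" "cball (t *\<^sub>R x0) s \<subseteq> \<Omega>" using open_contains_cball by blast
  define r where "r = min s (d / 2)"
  have r: "r > 0" using s d by (simp add: r_def)
  obtain \<rho> :: "'a \<Rightarrow> real" where \<rho>: "smooth (\<lambda>x. complex_of_real (\<rho> x))" "\<And>x. 0 \<le> \<rho> x"
    "supp (\<lambda>x. complex_of_real (\<rho> x)) \<subseteq> cball (t *\<^sub>R x0) r" "integrable lborel \<rho>" "(LINT x|lborel. \<rho> x) = 1"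
    by (rule bump_function[OF r, of "t *\<^sub>R x0"]) (rule that)
  have "compact (supp (\<lambda>x. complex_of_real (\<rho> x)))"
  proof (rule compact_supp_subset(2)[OF compact_cball])
    show "complex_of_real (\<rho> x) = 0" if "x \<notin> cball (t *\<^sub>R x0) r" for x
    proof (rule not_in_supp[of x "\<lambda>x. complex_of_real (\<rho> x)"])
      show "x \<notin> supp (\<lambda>x. complex_of_real (\<rho> x))" using \<rho>(3) that by blast
    qed
  qed
  moreover have "cball (t *\<^sub>R x0) r \<subseteq> \<Omega>" using s(2) by (auto simp: r_def)
  ultimately have test: "(\<lambda>x. complex_of_real (\<rho> x)) \<in> test_functions \<Omega>"
    using \<rho>(1,3) unfolding test_functions_def by blast
  have "cball (t *\<^sub>R x0) r \<subseteq> cball 0 d"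
  proof
    fix x assume "x \<in> cball (t *\<^sub>R x0) r"
    then have "norm (t *\<^sub>R x0 - x) \<le> d / 2" by (auto simp: r_def dist_norm)
    then show "x \<in> cball 0 d" using tn norm_triangle_sub[of x "t *\<^sub>R x0"] by (simp add: norm_minus_commute)
  qed
  then have "supp (\<lambda>x. complex_of_real (\<rho> x)) \<subseteq> cball 0 d" using \<rho>(3) by blast
  then show thesis by (rule that[OF test \<rho>(2) _ \<rho>(5)])
qed

locale one_bounded_distribution =
  fixes \<tau> :: "'a::euclidean_space \<Rightarrow> 'a" and \<Omega> :: "'a set" and D :: "('a \<Rightarrow> complex) \<Rightarrow> complex"
  assumes \<tau>: "\<tau> = (\<lambda>x. - x)" and \<Omega>: "open_convex_cone \<Omega>" and D: "distribution \<Omega> D"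
    and pos: "positive_definite \<tau> \<Omega> D" and bdd: "one_bounded \<tau> \<Omega> D"
begin

lemma \<Omega>_add: "x \<in> \<Omega> \<Longrightarrow> y \<in> \<Omega> \<Longrightarrow> x + y \<in> \<Omega>"
  by (rule open_convex_cone_add[OF \<Omega>])

sublocale halvable_cone "insert 0 \<Omega>"
  by (rule open_convex_cone_halvable[OF \<Omega>])

context
  fixes \<rho> :: "'a \<Rightarrow> real" and r h :: "'a \<Rightarrow> complex"
  assumes r_def: "r = (\<lambda>x. complex_of_real (\<rho> x))" and r: "r \<in> test_functions \<Omega>"
    and h_def: "h = convolution r r"
begin

lemma sharp_r: "sharp \<tau> r = r"
  by (simp add: sharp_def \<tau> r_def fun_eq_iff)

lemma cc_r: "cc r" by (rule smooth_cc_imp_cc[OF test_functions_smooth_cc[OF r]])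

lemma h_test: "h \<in> test_functions \<Omega>"
  unfolding h_def by (rule test_functions_convolution[OF r r \<Omega>_add])

lemma cc_h: "cc h" by (rule smooth_cc_imp_cc[OF test_functions_smooth_cc[OF h_test]])

text \<open>The sum is \<open>D\<close> of the square of \<open>\<phi>\<close>, the real combination
  of the translates of \<open>r\<close> by the \<open>x i\<close>: convolution adds the shifts, and
  \<open>sharp\<close> fixes \<open>\<phi>\<close>. An index set is used so that points may repeat,
  as they may in the lists of \<open>pd_on\<close>.\<close>

lemma translates_square:
  fixes c :: "'i \<Rightarrow> real" and x :: "'i \<Rightarrow> 'a"
  assumes I: "finite I" and x: "\<And>i. i \<in> I \<Longrightarrow> x i \<in> insert 0 \<Omega>"
  shows "(\<Sum>p\<in>I \<times> I. complex_of_real (c (fst p) * c (snd p)) * translates D h (x (fst p) + x (snd p))) \<in> \<real>\<^sub>\<ge>\<^sub>0"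
proof -
  define \<phi> where "\<phi> = (\<lambda>z. \<Sum>i\<in>I. complex_of_real (c i) * r (z - x i))"
  have ri: "(\<lambda>z. r (z - x i)) \<in> test_functions \<Omega>" if "i \<in> I" for i
    by (rule shift_test_function[OF \<Omega> r x[OF that]])
  have \<phi>: "\<phi> \<in> test_functions \<Omega>"
    unfolding \<phi>_def
    using test_functions_sum[of I "\<lambda>i z. r (z - x i)" \<Omega> "\<lambda>i. complex_of_real (c i)", OF I ri] by (rule conjunct1)
  have hp: "(\<lambda>z. h (z - (x (fst p) + x (snd p)))) \<in> test_functions \<Omega>" if "p \<in> I \<times> I" for p
    using that by (intro shift_test_function[OF \<Omega> h_test] add_in x) auto
  have "sharp \<tau> \<phi> = \<phi>"
    by (simp add: sharp_def \<tau> \<phi>_def r_def fun_eq_iff)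
  moreover have "convolution \<phi> \<phi> = (\<lambda>z. \<Sum>p\<in>I \<times> I. complex_of_real (c (fst p) * c (snd p)) * h (z - (x (fst p) + x (snd p))))"
  proof
    fix z
    have "convolution \<phi> \<phi> z = (\<Sum>p\<in>I \<times> I. (complex_of_real (c (fst p)) * complex_of_real (c (snd p)))
        * convolution (\<lambda>z. r (z - x (fst p))) (\<lambda>z. r (z - x (snd p))) z)"
      unfolding \<phi>_def by (rule convolution_sum[OF I cc_shift[OF cc_r]])
    then show "convolution \<phi> \<phi> z = (\<Sum>p\<in>I \<times> I. complex_of_real (c (fst p) * c (snd p)) * h (z - (x (fst p) + x (snd p))))"
      by (simp add: convolution_shift_both[OF cc_r cc_r] h_def)
  qed
  moreover have "D (\<lambda>z. \<Sum>p\<in>I \<times> I. complex_of_real (c (fst p) * c (snd p)) * h (z - (x (fst p) + x (snd p)))) =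
      (\<Sum>p\<in>I \<times> I. complex_of_real (c (fst p) * c (snd p)) * translates D h (x (fst p) + x (snd p)))"
    using distribution_sum[OF D, of "I \<times> I" "\<lambda>p z. h (z - (x (fst p) + x (snd p)))" "\<lambda>p. complex_of_real (c (fst p) * c (snd p))"] I hp
    by (simp add: translates_def)
  ultimately show ?thesis using pos \<phi> unfolding positive_definite_def by (metis (no_types, lifting))
qed

lemma translates_nonneg:
  assumes "x \<in> insert 0 \<Omega>" shows "translates D h x \<in> \<real>\<^sub>\<ge>\<^sub>0"
  using translates_square[of "{()}" "\<lambda>_. (1/2) *\<^sub>R x" "\<lambda>_. 1"] half_in[OF assms] half_add[of x] by simp

lemma translates_bound:
  assumes x: "x \<in> \<Omega>" shows "cmod (translates D h x) \<le> Re (translates D h 0)"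
proof (rule field_le_epsilon)
  fix e :: real assume e: "e > 0"
  have "isCont (translates D h) x" by (rule translates_continuous[OF \<Omega> D h_test]) (use x in simp)
  then obtain d where d: "d > 0" "\<And>y. dist y x < d \<Longrightarrow> dist (translates D h y) (translates D h x) < e"
    using e unfolding continuous_at_eps_delta by blast
  have "open \<Omega>" using \<Omega> unfolding open_convex_cone_def by blast
  then obtain s where s: "s > 0" "cball x s \<subseteq> \<Omega>" using x open_contains_cball by blast
  define R where "R = min (d / 2) s"
  have R: "R > 0" "R < d" "cball x R \<subseteq> \<Omega>" using d(1) s by (auto simp: R_def)
  obtain \<eta> :: "'a \<Rightarrow> real" where \<eta>: "smooth (\<lambda>x. complex_of_real (\<eta> x))" "\<And>x. 0 \<le> \<eta> x"
    "supp (\<lambda>x. complex_of_real (\<eta> x)) \<subseteq> cball x R" "integrable lborel \<eta>" "(LINT x|lborel. \<eta> x) = 1"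
    by (rule bump_function[OF R(1), of x]) (rule that)
  define \<psi> where "\<psi> = (\<lambda>x. complex_of_real (\<eta> x))"
  have \<eta>0: "\<eta> y = 0" if "y \<notin> cball x R" for y
  proof -
    have "y \<notin> supp (\<lambda>x. complex_of_real (\<eta> x))" using \<eta>(3) that by blast
    from not_in_supp[OF this] show ?thesis by simp
  qed
  have "compact (supp \<psi>)"
    unfolding \<psi>_def by (rule compact_supp_subset(2)[of "cball x R"]) (auto simp: \<eta>0)
  then have \<psi>: "\<psi> \<in> test_functions \<Omega>" using \<eta>(1,3) R(3) by (auto simp: test_functions_def \<psi>_def)
  have c\<psi>: "cc \<psi>" by (rule smooth_cc_imp_cc[OF test_functions_smooth_cc[OF \<psi>]])
  \<comment> \<open>Commutativity moves \<open>\<psi>\<close> out of the middle, so that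
    1-boundedness bounds \<open>D (h * \<psi>)\<close>, an average of translates of \<open>h\<close>
    near x.\<close>
  have "convolution (convolution r \<psi>) r = convolution (convolution \<psi> r) r"
    by (simp add: convolution_commute[OF cc_r c\<psi>])
  also have "\<dots> = convolution \<psi> h"
    unfolding h_def by (rule convolution_assoc[OF c\<psi> cc_r cc_continuous[OF cc_r]])
  also have "\<dots> = convolution h \<psi>" by (rule convolution_commute[OF c\<psi> cc_h])
  finally have eq: "convolution (convolution r \<psi>) r = convolution h \<psi>" .
  have L1: "(LINT x:\<Omega>|lborel. cmod (\<psi> x)) = 1"
  proof -
    have "indicator \<Omega> y *\<^sub>R cmod (\<psi> y) = \<eta> y" for y
    proof (cases "y \<in> \<Omega>")
      case True then show ?thesis using \<eta>(2)[of y] by (simp add: \<psi>_def)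
    next
      case False
      then have "y \<notin> cball x R" using R(3) by blast
      then show ?thesis using False \<eta>0 by simp
    qed
    then show ?thesis using \<eta>(5) by (simp add: set_lebesgue_integral_def)
  qed
  have "cmod (D (convolution h \<psi>)) \<le> Re (D h)"
    using bdd r \<psi> unfolding one_bounded_def by (metis L1 eq sharp_r h_def mult_1)
  then have le: "cmod (D (convolution h \<psi>)) \<le> Re (translates D h 0)" by (simp add: translates_def)
  have cs: "cnj (\<psi> y) * translates D h y = \<eta> y *\<^sub>R translates D h y" for y
    by (simp add: \<psi>_def scaleR_conv_of_real)
  have "cmod ((LINT y|lborel. \<eta> y *\<^sub>R translates D h y) - translates D h x) \<le> e"
  proof (rule bump_average[OF \<eta>(2,4,5) \<eta>0])
    show "integrable lborel (\<lambda>y. \<eta> y *\<^sub>R translates D h y)"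
      using distribution_convolution(1)[OF \<Omega> D h_test \<psi>] unfolding cs .
    show "cmod (translates D h y - translates D h x) \<le> e" if "y \<in> cball x R" for y
      using d(2)[of y] that R(2) by (simp add: dist_norm norm_minus_commute)
  qed
  then have "cmod (D (convolution h \<psi>) - translates D h x) \<le> e"
    unfolding distribution_convolution(2)[OF \<Omega> D h_test \<psi>] cs .
  then show "cmod (translates D h x) \<le> Re (translates D h 0) + e"
    using le norm_triangle_sub[of "translates D h x" "D (convolution h \<psi>)"] by (simp add: norm_minus_commute)
qed

lemma translates_pd: "pd_on (insert 0 \<Omega>) (\<lambda>x. Re (translates D h x))"
  unfolding pd_on_def
proof (intro conjI allI impI exI ballI)
  fix xs :: "(real \<times> 'a) list" assume xs: "set (map snd xs) \<subseteq> insert 0 \<Omega>"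
  let ?I = "{..<length xs}"
  have "xs ! i \<in> set xs" if "i \<in> ?I" for i using that by simp
  then have in_S: "snd (xs ! i) \<in> insert 0 \<Omega>" if "i \<in> ?I" for i
    using xs that by (metis image_eqI list.set_map subsetD)
  have "(\<Sum>(c, x)\<leftarrow>xs. \<Sum>(d, y)\<leftarrow>xs. c * d * Re (translates D h (x + y))) =
     (\<Sum>i\<in>?I. \<Sum>j\<in>?I. fst (xs ! i) * fst (xs ! j) * Re (translates D h (snd (xs ! i) + snd (xs ! j))))"
    by (simp add: sum_list_sum_nth case_prod_unfold atLeast0LessThan)
  also have "\<dots> = Re (\<Sum>p\<in>?I \<times> ?I. complex_of_real (fst (xs ! fst p) * fst (xs ! snd p))
      * translates D h (snd (xs ! fst p) + snd (xs ! snd p)))"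
    by (simp add: sum.cartesian_product case_prod_unfold)
  also have "\<dots> \<ge> 0"
    using translates_square[of ?I "\<lambda>i. snd (xs ! i)" "\<lambda>i. fst (xs ! i)"] in_S
    by (auto simp: complex_nonneg_Reals_iff)
  finally show "0 \<le> (\<Sum>(c, x)\<leftarrow>xs. \<Sum>(d, y)\<leftarrow>xs. c * d * Re (translates D h (x + y)))" .
next
  fix x assume "x \<in> insert 0 \<Omega>"
  then show "Re (translates D h x) \<le> Re (translates D h 0)"
    using translates_bound[of x] complex_Re_le_cmod[of "translates D h x"] by auto
qed

lemma translates_laplace:
  obtains M where "finite_measure M" "sets M = sets borel" "AE v in M. v \<in> dual_points \<Omega>"
    "\<And>x. x \<in> insert 0 \<Omega> \<Longrightarrow> translates D h x = complex_of_real (LINT v|M. exp (- (v \<bullet> x)))"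
proof -
  have "continuous_on (insert 0 \<Omega>) (\<lambda>x. Re (translates D h x))"
    using translates_continuous[OF \<Omega> D h_test]
    by (intro continuous_at_imp_continuous_on ballI continuous_intros) auto
  from cone_bernstein[OF \<Omega> translates_pd this] obtain M where
    M: "finite_measure M" "sets M = sets borel" "AE v in M. \<forall>x\<in>\<Omega>. 0 \<le> v \<bullet> x"
    "\<forall>x\<in>insert 0 \<Omega>. Re (translates D h x) = (LINT v|M. exp (- (v \<bullet> x)))"
    by (elim exE conjE) (rule that)
  have "translates D h x = complex_of_real (LINT v|M. exp (- (v \<bullet> x)))" if "x \<in> insert 0 \<Omega>" for x
    using bspec[OF M(4) that] translates_nonneg[OF that]
    by (auto simp: complex_nonneg_Reals_iff complex_eq_iff)
  then show thesis using that M(1-3) unfolding dual_points_def by simp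
qed

end

end

section \<open>Laplace transforms of bump functions and of their squares\<close>

definition bump_laplace :: "('a::euclidean_space \<Rightarrow> real) \<Rightarrow> 'a \<Rightarrow> real" where
  "bump_laplace \<rho> v = (LINT y|lborel. \<rho> y * exp (- (v \<bullet> y)))"

definition is_bump :: "'a::euclidean_space set \<Rightarrow> ('a \<Rightarrow> real) \<Rightarrow> bool" where
  "is_bump \<Omega> \<rho> \<longleftrightarrow> (\<lambda>x. complex_of_real (\<rho> x)) \<in> test_functions \<Omega> \<and> (\<forall>x. 0 \<le> \<rho> x) \<and> (LINT x|lborel. \<rho> x) = 1"

text \<open>The Laplace transform at v is the convolution with \<open>exp (v \<bullet> z)\<close>
  evaluated at 0, and convolution of f with this exponential reproduces it up to that value.
  Multiplicativity is thus an instance of associativity.\<close>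

lemma laplace_convolution:
  assumes f: "cc f"
  shows "(LINT y|lborel. convolution f f y * complex_of_real (exp (- (v \<bullet> y)))) =
    (LINT y|lborel. f y * complex_of_real (exp (- (v \<bullet> y))))\<^sup>2"
proof -
  let ?k = "\<lambda>z. complex_of_real (exp (v \<bullet> z))"
  let ?I = "LINT y|lborel. f y * complex_of_real (exp (- (v \<bullet> y)))"
  have k: "continuous_on UNIV ?k" by (intro continuous_intros)
  have eq: "convolution f ?k (- y) = complex_of_real (exp (- (v \<bullet> y))) * ?I" for y
  proof -
    have "f z * ?k (- y - z) = complex_of_real (exp (- (v \<bullet> y))) * (f z * complex_of_real (exp (- (v \<bullet> z))))" for z
      by (simp add: inner_diff_right exp_diff exp_minus divide_inverse)
    then show ?thesis unfolding convolution_def by (simp only: integral_mult_right_zero)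
  qed
  have "(LINT y|lborel. convolution f f y * complex_of_real (exp (- (v \<bullet> y)))) = convolution (convolution f f) ?k 0"
    by (simp add: convolution_def[of "convolution f f"])
  also have "\<dots> = convolution f (convolution f ?k) 0" by (simp only: convolution_assoc[OF f f k])
  also have "\<dots> = (LINT y|lborel. f y * complex_of_real (exp (- (v \<bullet> y))) * ?I)"
    unfolding convolution_def[of f "convolution f ?k"] diff_0 eq by (simp only: mult.assoc)
  also have "\<dots> = ?I * ?I" by (rule integral_mult_left_zero)
  finally show ?thesis by (simp only: power2_eq_square)
qed

context
  fixes \<Omega> :: "'a::euclidean_space set" and \<rho> :: "'a \<Rightarrow> real"
  assumes b: "is_bump \<Omega> \<rho>"
begin

abbreviation "bump_r \<equiv> \<lambda>x. complex_of_real (\<rho> x)"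

lemma bump_test: "bump_r \<in> test_functions \<Omega>" and bump_nonneg: "0 \<le> \<rho> x"
  and bump_integral: "(LINT x|lborel. \<rho> x) = 1"
  using b by (auto simp: is_bump_def)

lemma bump_cc: "cc bump_r"
  by (rule smooth_cc_imp_cc[OF test_functions_smooth_cc[OF bump_test]])

lemma bump_integrable: "integrable lborel \<rho>"
  using bump_integral not_integrable_integral_eq by fastforce

lemma bump_continuous: "continuous_on UNIV \<rho>"
  using continuous_on_Re[OF cc_continuous[OF bump_cc, of UNIV]] by simp

lemma bump_outside: "x \<notin> supp bump_r \<Longrightarrow> \<rho> x = 0"
  using not_in_supp[of x bump_r] by simp

lemma bump_laplace_integrable: "integrable lborel (\<lambda>y. \<rho> y * exp (- (v \<bullet> y)))"
proof (rule continuous_compact_support_integrable[of "supp bump_r"])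
  show "compact (supp bump_r)" using bump_cc by (simp add: cc_def)
  show "continuous_on (supp bump_r) (\<lambda>y. \<rho> y * exp (- (v \<bullet> y)))"
    by (intro continuous_intros continuous_on_subset[OF bump_continuous]) simp
qed (simp add: bump_outside)

lemma bump_laplace_pos: "bump_laplace \<rho> v > 0"
proof -
  have ge: "bump_laplace \<rho> v \<ge> 0" unfolding bump_laplace_def by (simp add: bump_nonneg)
  have "bump_laplace \<rho> v \<noteq> 0"
  proof
    assume "bump_laplace \<rho> v = 0"
    then have "AE y in lborel. \<rho> y * exp (- (v \<bullet> y)) = 0"
      using integral_nonneg_eq_0_iff_AE[OF bump_laplace_integrable[of v]] bump_nonneg
      by (simp add: bump_laplace_def)
    then have "AE y in lborel. \<rho> y = 0" by simp
    then have "(LINT x|lborel. \<rho> x) = 0" by (rule integral_eq_zero_AE)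
    then show False using bump_integral by simp
  qed
  then show ?thesis using ge by simp
qed

text \<open>For c = v \<bullet> x / 2 the square of the transform dominates
  \<open>exp (- (v \<bullet> x))\<close>; this is how integrability with respect to
  \<open>\<mu>\<close> is obtained.\<close>

lemma bump_laplace_ge:
  assumes "\<And>y. y \<in> supp bump_r \<Longrightarrow> v \<bullet> y \<le> c" shows "exp (- c) \<le> bump_laplace \<rho> v"
proof -
  have "exp (- c) = (LINT y|lborel. \<rho> y * exp (- c))" using bump_integral by simp
  also have "\<dots> \<le> bump_laplace \<rho> v"
    unfolding bump_laplace_def
  proof (rule integral_mono)
    show "integrable lborel (\<lambda>y. \<rho> y * exp (- c))" using bump_integrable by simp
    show "\<rho> y * exp (- c) \<le> \<rho> y * exp (- (v \<bullet> y))" for y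
      using assms[of y] bump_outside[of y] bump_nonneg[of y]
      by (cases "y \<in> supp bump_r") (auto intro: mult_left_mono)
  qed (rule bump_laplace_integrable)
  finally show ?thesis .
qed

lemma bump_laplace_near_1:
  assumes "\<And>y. y \<in> supp bump_r \<Longrightarrow> \<bar>exp (- (v \<bullet> y)) - 1\<bar> \<le> e"
  shows "\<bar>bump_laplace \<rho> v - 1\<bar> \<le> e"
proof -
  have "norm ((LINT y|lborel. \<rho> y *\<^sub>R exp (- (v \<bullet> y))) - 1) \<le> e"
    by (rule bump_average[OF bump_nonneg bump_integrable bump_integral, of "supp bump_r"])
       (use assms bump_laplace_integrable[of v] bump_outside in auto)
  then show ?thesis by (simp add: bump_laplace_def)
qed

lemma bump_laplace_le_1:
  assumes v: "v \<in> dual_points \<Omega>" shows "bump_laplace \<rho> v \<le> 1"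
proof -
  have "bump_laplace \<rho> v \<le> (LINT y|lborel. \<rho> y)"
    unfolding bump_laplace_def
  proof (rule integral_mono[OF bump_laplace_integrable bump_integrable])
    fix y
    show "\<rho> y * exp (- (v \<bullet> y)) \<le> \<rho> y"
    proof (cases "y \<in> supp bump_r")
      case True
      then have "y \<in> \<Omega>" using bump_test by (auto simp: test_functions_def)
      then have "exp (- (v \<bullet> y)) \<le> 1" using v by (simp add: dual_points_def)
      then show ?thesis using bump_nonneg[of y] by (simp add: mult_left_le)
    qed (simp add: bump_outside)
  qed
  then show ?thesis using bump_integral by simp
qed

lemma bump_laplace_measurable: "bump_laplace \<rho> \<in> borel_measurable borel"
proof -
  have "(\<lambda>p. \<rho> (snd p) * exp (- (fst p \<bullet> snd p))) \<in> borel_measurable (borel :: ('a \<times> 'a) measure)"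
    by (intro borel_measurable_continuous_onI continuous_intros continuous_on_compose2[OF bump_continuous]) auto
  moreover have "sets (borel :: ('a \<times> 'a) measure) = sets (borel \<Otimes>\<^sub>M lborel)"
    by (subst borel_prod[symmetric]) (rule sets_pair_measure_cong, simp_all)
  ultimately have "(\<lambda>(v, y). \<rho> y * exp (- (v \<bullet> y))) \<in> borel_measurable (borel \<Otimes>\<^sub>M lborel)"
    using measurable_cong_sets[of "borel :: ('a \<times> 'a) measure" "borel \<Otimes>\<^sub>M lborel" borel borel]
    by (simp add: case_prod_unfold)
  from lborel.borel_measurable_lebesgue_integral[OF this]
  show ?thesis unfolding bump_laplace_def by simp
qed

text \<open>The square of a bump as a real function: test functions are complex valued, whereas
  averages take real weights.\<close>

definition "bump_sq x = Re (convolution bump_r bump_r x)"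

lemma bump_sq: "convolution bump_r bump_r x = complex_of_real (bump_sq x)" "bump_sq x \<ge> 0"
proof -
  have "convolution bump_r bump_r x = complex_of_real (LINT y|lborel. \<rho> y * \<rho> (x - y))"
    unfolding convolution_def of_real_mult[symmetric] by (rule integral_complex_of_real)
  moreover have "(LINT y|lborel. \<rho> y * \<rho> (x - y)) \<ge> 0" by (simp add: bump_nonneg)
  ultimately show "convolution bump_r bump_r x = complex_of_real (bump_sq x)" "bump_sq x \<ge> 0"
    by (simp_all add: bump_sq_def)
qed

lemma cc_bump_sq: "cc (\<lambda>x. complex_of_real (bump_sq x))"
  unfolding bump_sq(1)[symmetric] by (rule cc_convolution[OF bump_cc bump_cc])

lemma bump_sq_continuous: "continuous_on UNIV bump_sq"
  using continuous_on_Re[OF cc_continuous[OF cc_bump_sq, of UNIV]] by simp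

lemma bump_sq_laplace: "(LINT y|lborel. bump_sq y * exp (- (v \<bullet> y))) = (bump_laplace \<rho> v)\<^sup>2"
proof -
  have "complex_of_real (LINT y|lborel. bump_sq y * exp (- (v \<bullet> y))) =
     (LINT y|lborel. convolution bump_r bump_r y * complex_of_real (exp (- (v \<bullet> y))))"
    unfolding bump_sq(1) of_real_mult[symmetric] by (rule integral_complex_of_real[symmetric])
  also have "\<dots> = (LINT y|lborel. bump_r y * complex_of_real (exp (- (v \<bullet> y))))\<^sup>2"
    by (rule laplace_convolution[OF bump_cc])
  also have "(LINT y|lborel. bump_r y * complex_of_real (exp (- (v \<bullet> y)))) = complex_of_real (bump_laplace \<rho> v)"
    unfolding bump_laplace_def of_real_mult[symmetric] by (rule integral_complex_of_real)
  finally show ?thesis unfolding of_real_power[symmetric] of_real_eq_iff .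
qed

lemma bump_sq_integral: "(LINT y|lborel. bump_sq y) = 1"
  using bump_sq_laplace[of 0] bump_integral by (simp add: bump_laplace_def)

lemma bump_sq_supp:
  "supp (\<lambda>x. complex_of_real (bump_sq x)) \<subseteq> {x + y |x y. x \<in> supp bump_r \<and> y \<in> supp bump_r}"
  unfolding bump_sq(1)[symmetric] by (rule convolution_supp(1)[OF bump_cc bump_cc])

end

section \<open>A single measure for all bump functions\<close>

context one_bounded_distribution
begin

lemma bump_translates_laplace:
  assumes \<rho>: "is_bump \<Omega> \<rho>"
  obtains M where "finite_measure M" "sets M = sets borel" "AE v in M. v \<in> dual_points \<Omega>"
    "\<And>x. x \<in> insert 0 \<Omega> \<Longrightarrow> translates D (\<lambda>x. complex_of_real (bump_sq \<rho> x)) x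
        = complex_of_real (LINT v|M. exp (- (v \<bullet> x)))"
  using translates_laplace[OF refl bump_test[OF \<rho>] refl] unfolding bump_sq(1)[OF \<rho>] by blast

lemma bump_sq_test:
  assumes \<rho>: "is_bump \<Omega> \<rho>" shows "(\<lambda>x. complex_of_real (bump_sq \<rho> x)) \<in> test_functions \<Omega>"
  using h_test[OF refl bump_test[OF \<rho>] refl] unfolding bump_sq(1)[OF \<rho>] .

text \<open>The left side is an average of the translates for \<open>\<rho>\<close>, weighted by the
  shifted square of \<open>\<sigma>\<close>. Inserting their Laplace representation and exchanging
  the integrals leaves the transform of that weight inside the integral over v.\<close>

lemma convolution_bump_laplace:
  assumes \<rho>: "is_bump \<Omega> \<rho>" and \<sigma>: "is_bump \<Omega> \<sigma>"
    and M: "finite_measure M" "sets M = sets borel" "AE v in M. v \<in> dual_points \<Omega>"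
    and eq: "\<And>x. x \<in> insert 0 \<Omega> \<Longrightarrow> translates D (\<lambda>x. complex_of_real (bump_sq \<rho> x)) x
        = complex_of_real (LINT v|M. exp (- (v \<bullet> x)))"
    and x: "x \<in> insert 0 \<Omega>"
  shows "D (convolution (\<lambda>x. complex_of_real (bump_sq \<rho> x)) (\<lambda>z. complex_of_real (bump_sq \<sigma> (z - x))))
      = complex_of_real (LINT v|M. (bump_laplace \<sigma> v)\<^sup>2 * exp (- (v \<bullet> x)))"
proof -
  let ?\<psi> = "\<lambda>z. complex_of_real (bump_sq \<sigma> (z - x))"
  let ?h = "\<lambda>x. complex_of_real (bump_sq \<rho> x)"
  let ?g = "\<lambda>x. LINT v|M. exp (- (v \<bullet> x))"
  have \<psi>: "?\<psi> \<in> test_functions \<Omega>" by (rule shift_test_function[OF \<Omega> bump_sq_test[OF \<sigma>] x])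
  \<comment> \<open>\<open>eq\<close> is available on \<Omega> and at 0 only; off \<Omega> the
    weight vanishes.\<close>
  have out: "bump_sq \<sigma> (y - x) = 0" if "y \<notin> \<Omega>" for y
  proof -
    have "y \<notin> supp ?\<psi>" using \<psi> that by (auto simp: test_functions_def)
    from not_in_supp[OF this] show ?thesis by simp
  qed
  have cs: "cnj (?\<psi> y) * translates D ?h y = complex_of_real (bump_sq \<sigma> (y - x) * ?g y)" for y
    using eq[of y] out[of y] by (cases "y \<in> \<Omega>") auto
  have int: "integrable lborel (\<lambda>y. bump_sq \<sigma> (y - x) * ?g y)"
    using distribution_convolution(1)[OF \<Omega> D bump_sq_test[OF \<rho>] \<psi>] unfolding cs by (simp only: complex_of_real_integrable_eq)
  have meas: "(\<lambda>y. bump_sq \<sigma> (y - x)) \<in> borel_measurable borel"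
    by (intro borel_measurable_continuous_onI continuous_on_compose2[OF bump_sq_continuous[OF \<sigma>]] continuous_intros) auto
  have "D (convolution ?h ?\<psi>) = complex_of_real (LINT y|lborel. bump_sq \<sigma> (y - x) * ?g y)"
    unfolding distribution_convolution(2)[OF \<Omega> D bump_sq_test[OF \<rho>] \<psi>] cs by (rule integral_complex_of_real)
  also have "(LINT y|lborel. bump_sq \<sigma> (y - x) * ?g y) = (LINT v|M. (LINT y|lborel. bump_sq \<sigma> (y - x) * exp (- (v \<bullet> y))))"
    by (rule laplace_average[OF M meas bump_sq(2)[OF \<sigma>] out int])
  also have "(\<lambda>v. LINT y|lborel. bump_sq \<sigma> (y - x) * exp (- (v \<bullet> y))) = (\<lambda>v. (bump_laplace \<sigma> v)\<^sup>2 * exp (- (v \<bullet> x)))"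
  proof
    fix v
    have "(LINT y|lborel. bump_sq \<sigma> (y - x) * exp (- (v \<bullet> y))) =
        (LINT y|lborel. (\<lambda>w. bump_sq \<sigma> w * exp (- (v \<bullet> w)) * exp (- (v \<bullet> x))) (y - x))"
      by (simp add: inner_diff_right exp_add[symmetric] mult.assoc)
    also have "\<dots> = (LINT y|lborel. bump_sq \<sigma> y * exp (- (v \<bullet> y)) * exp (- (v \<bullet> x)))"
      by (rule lborel_integral_translate)
         (intro borel_measurable_continuous_onI continuous_intros bump_sq_continuous[OF \<sigma>])
    also have "\<dots> = (bump_laplace \<sigma> v)\<^sup>2 * exp (- (v \<bullet> x))"
      using bump_sq_laplace[OF \<sigma>, of v] by simp
    finally show "(LINT y|lborel. bump_sq \<sigma> (y - x) * exp (- (v \<bullet> y))) = (bump_laplace \<sigma> v)\<^sup>2 * exp (- (v \<bullet> x))" .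
  qed
  finally show ?thesis .
qed

lemma bump_laplace_measurable_on:
  "is_bump \<Omega> \<rho> \<Longrightarrow> sets M = sets borel \<Longrightarrow> bump_laplace \<rho> \<in> borel_measurable M"
  using bump_laplace_measurable measurable_cong_sets by blast

lemma finite_density_bump:
  assumes \<sigma>: "is_bump \<Omega> \<sigma>" and M: "finite_measure M" "sets M = sets borel" "AE v in M. v \<in> dual_points \<Omega>"
  shows "finite_measure (density M (\<lambda>v. ennreal ((bump_laplace \<sigma> v)\<^sup>2)))"
proof (rule finite_measureI)
  interpret M: finite_measure M by fact
  have [measurable]: "bump_laplace \<sigma> \<in> borel_measurable M" by (rule bump_laplace_measurable_on[OF \<sigma> M(2)])
  let ?N = "density M (\<lambda>v. ennreal ((bump_laplace \<sigma> v)\<^sup>2))"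
  have "emeasure ?N (space ?N) = (\<integral>\<^sup>+ v. ennreal ((bump_laplace \<sigma> v)\<^sup>2) \<partial>M)"
    by (subst emeasure_density) (auto cong: nn_integral_cong)
  also have "\<dots> \<le> (\<integral>\<^sup>+ v. 1 \<partial>M)"
  proof (rule nn_integral_mono_AE)
    show "AE v in M. ennreal ((bump_laplace \<sigma> v)\<^sup>2) \<le> 1"
      using M(3)
    proof eventually_elim
      case (elim v)
      have "(bump_laplace \<sigma> v)\<^sup>2 \<le> 1"
        using bump_laplace_le_1[OF \<sigma> elim] bump_laplace_pos[OF \<sigma>, of v] by (intro power_le_one) auto
      then show ?case by (simp add: ennreal_le_1)
    qed
  qed
  also have "\<dots> < \<infinity>" by (simp add: M.emeasure_eq_measure)
  finally show "emeasure ?N (space ?N) \<noteq> \<infinity>" by simp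
qed

text \<open>Both densities have the Laplace transform \<open>D (h * k (\<cdot> - x))\<close>, with h
  and k the squares of the two bumps, and this is symmetric in h and k.\<close>

lemma bump_measures_compatible:
  assumes \<rho>: "is_bump \<Omega> \<rho>" and \<sigma>: "is_bump \<Omega> \<sigma>"
    and M: "finite_measure M" "sets M = sets borel" "AE v in M. v \<in> dual_points \<Omega>"
      "\<And>x. x \<in> insert 0 \<Omega> \<Longrightarrow> translates D (\<lambda>x. complex_of_real (bump_sq \<rho> x)) x
        = complex_of_real (LINT v|M. exp (- (v \<bullet> x)))"
    and N: "finite_measure N" "sets N = sets borel" "AE v in N. v \<in> dual_points \<Omega>"
      "\<And>x. x \<in> insert 0 \<Omega> \<Longrightarrow> translates D (\<lambda>x. complex_of_real (bump_sq \<sigma> x)) x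
        = complex_of_real (LINT v|N. exp (- (v \<bullet> x)))"
  shows "density M (\<lambda>v. ennreal ((bump_laplace \<sigma> v)\<^sup>2)) = density N (\<lambda>v. ennreal ((bump_laplace \<rho> v)\<^sup>2))"
proof (rule laplace_unique_finite[OF \<Omega> finite_density_bump[OF \<sigma> M(1-3)] _ _ finite_density_bump[OF \<rho> N(1-3)]])
  have [measurable]: "bump_laplace \<sigma> \<in> borel_measurable M" "bump_laplace \<rho> \<in> borel_measurable N"
    using bump_laplace_measurable_on \<rho> \<sigma> M(2) N(2) by blast+
  show "AE v in density M (\<lambda>v. ennreal ((bump_laplace \<sigma> v)\<^sup>2)). v \<in> dual_points \<Omega>"
    using M(3) by (subst AE_density) (auto elim: eventually_mono)
  show "AE v in density N (\<lambda>v. ennreal ((bump_laplace \<rho> v)\<^sup>2)). v \<in> dual_points \<Omega>"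
    using N(3) by (subst AE_density) (auto elim: eventually_mono)
  let ?h = "\<lambda>x. complex_of_real (bump_sq \<rho> x)" and ?k = "\<lambda>x. complex_of_real (bump_sq \<sigma> x)"
  fix x assume x: "x \<in> insert 0 \<Omega>"
  have "convolution ?h (\<lambda>z. ?k (z - x)) = convolution ?k (\<lambda>z. ?h (z - x))"
    using convolution_commute[OF cc_bump_sq[OF \<rho>] cc_bump_sq[OF \<sigma>]]
      convolution_shift[of ?h ?k x] convolution_shift[of ?k ?h x] by (simp add: fun_eq_iff)
  then have "(LINT v|M. (bump_laplace \<sigma> v)\<^sup>2 * exp (- (v \<bullet> x))) = (LINT v|N. (bump_laplace \<rho> v)\<^sup>2 * exp (- (v \<bullet> x)))"
    using convolution_bump_laplace[OF \<rho> \<sigma> M x] convolution_bump_laplace[OF \<sigma> \<rho> N x] by simp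
  then show "(LINT v|density M (\<lambda>v. ennreal ((bump_laplace \<sigma> v)\<^sup>2)). exp (- (v \<bullet> x))) =
      (LINT v|density N (\<lambda>v. ennreal ((bump_laplace \<rho> v)\<^sup>2)). exp (- (v \<bullet> x)))"
    using exp_inner_measurable[OF M(2)] exp_inner_measurable[OF N(2)] by (subst (1 2) integral_real_density) auto
qed (use M(2) N(2) in simp_all)

theorem laplace_representation:
  obtains \<mu> where "sets \<mu> = sets borel" "AE v in \<mu>. v \<in> dual_points \<Omega>"
    "\<And>x. x \<in> \<Omega> \<Longrightarrow> integrable \<mu> (\<lambda>v. exp (- (v \<bullet> x)))"
    "\<And>\<psi>. \<psi> \<in> test_functions \<Omega> \<Longrightarrow> integrable lborel (\<lambda>x. cnj (\<psi> x) * complex_of_real (LINT v|\<mu>. exp (- (v \<bullet> x))))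
      \<and> D \<psi> = (LINT x|lborel. cnj (\<psi> x) * complex_of_real (LINT v|\<mu>. exp (- (v \<bullet> x))))"
proof -
  define d where "d k = inverse (real (Suc k))" for k
  have d: "d k > 0" and d0: "d \<longlonglongrightarrow> 0" for k
    unfolding d_def using LIMSEQ_inverse_real_of_nat by simp_all
  have "\<exists>\<rho>. is_bump \<Omega> \<rho> \<and> supp (\<lambda>x. complex_of_real (\<rho> x)) \<subseteq> cball 0 (d k)" for k
    by (rule bump_functions_in_cone[OF \<Omega> d[of k]]) (unfold is_bump_def, blast)
  then have "\<exists>\<rho>. \<forall>k. is_bump \<Omega> (\<rho> k) \<and> supp (\<lambda>x. complex_of_real (\<rho> k x)) \<subseteq> cball 0 (d k)"
    by (intro choice allI)
  then obtain \<rho> where \<rho>: "\<And>k. is_bump \<Omega> (\<rho> k)" "\<And>k. supp (\<lambda>x. complex_of_real (\<rho> k x)) \<subseteq> cball 0 (d k)"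
    by blast
  let ?h = "\<lambda>k x. complex_of_real (bump_sq (\<rho> k) x)"
  define Q where "Q k M \<longleftrightarrow> finite_measure M \<and> sets M = sets borel \<and> (AE v in M. v \<in> dual_points \<Omega>) \<and>
    (\<forall>x\<in>insert 0 \<Omega>. translates D (?h k) x = complex_of_real (LINT v|M. exp (- (v \<bullet> x))))" for k M
  have "\<exists>M. Q k M" for k
    by (rule bump_translates_laplace[OF \<rho>(1)[of k]]) (unfold Q_def, blast)
  then have "\<exists>M. \<forall>k. Q k (M k)" by (intro choice allI)
  then obtain M where "\<And>k. Q k (M k)" by blast
  then have M: "finite_measure (M k)" "sets (M k) = sets borel" "AE v in M k. v \<in> dual_points \<Omega>"
    "x \<in> insert 0 \<Omega> \<Longrightarrow> translates D (?h k) x = complex_of_real (LINT v|M k. exp (- (v \<bullet> x)))" for k x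
    unfolding Q_def by blast+
  define w where "w k = bump_laplace (\<rho> k)" for k
  have w: "w k v > 0" for k v unfolding w_def by (rule bump_laplace_pos[OF \<rho>(1)])
  have wm: "w k \<in> borel_measurable L" if "sets L = sets borel" for k L
    unfolding w_def by (rule bump_laplace_measurable_on[OF \<rho>(1) that])
  \<comment> \<open>\<open>w 0\<close> is positive, so its square can be divided out. The result may
    be infinite; by compatibility any other index would give the same measure.\<close>
  define \<mu> where "\<mu> = density (M 0) (\<lambda>v. ennreal (1 / (w 0 v)\<^sup>2))"
  have [simp]: "sets \<mu> = sets borel" by (simp add: \<mu>_def M(2))
  have [simp]: "space \<mu> = UNIV" using sets_eq_imp_space_eq[of \<mu> borel] by simp
  have Mk: "M k = density \<mu> (\<lambda>v. ennreal ((w k v)\<^sup>2))" for k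
  proof -
    have [measurable]: "w j \<in> borel_measurable (M i)" for i j by (rule wm[OF M(2)])
    have "density \<mu> (\<lambda>v. ennreal ((w k v)\<^sup>2)) = density (M 0) (\<lambda>v. ennreal (1 / (w 0 v)\<^sup>2) * ennreal ((w k v)\<^sup>2))"
      unfolding \<mu>_def by (rule density_density_eq) auto
    also have "\<dots> = density (M 0) (\<lambda>v. ennreal ((w k v)\<^sup>2) * ennreal (1 / (w 0 v)\<^sup>2))"
      by (simp only: mult.commute)
    also have "\<dots> = density (density (M 0) (\<lambda>v. ennreal ((w k v)\<^sup>2))) (\<lambda>v. ennreal (1 / (w 0 v)\<^sup>2))"
      by (rule density_density_eq[symmetric]) auto
    also have "density (M 0) (\<lambda>v. ennreal ((w k v)\<^sup>2)) = density (M k) (\<lambda>v. ennreal ((w 0 v)\<^sup>2))"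
      unfolding w_def by (rule bump_measures_compatible[OF \<rho>(1) \<rho>(1) M M])
    also have "density \<dots> (\<lambda>v. ennreal (1 / (w 0 v)\<^sup>2)) = density (M k) (\<lambda>v. ennreal ((w 0 v)\<^sup>2) * ennreal (1 / (w 0 v)\<^sup>2))"
      by (rule density_density_eq) auto
    also have "(\<lambda>v. ennreal ((w 0 v)\<^sup>2) * ennreal (1 / (w 0 v)\<^sup>2)) = (\<lambda>_. 1)"
      using less_imp_neq[OF w[of 0]] by (simp add: ennreal_mult[symmetric] fun_eq_iff)
    finally show ?thesis by (simp add: density_1)
  qed
  have [measurable]: "w k \<in> borel_measurable \<mu>" for k by (rule wm) simp
  have AE: "AE v in \<mu>. v \<in> dual_points \<Omega>"
    unfolding \<mu>_def using M(3)[of 0] wm[OF M(2), of 0 0] by (subst AE_density) (auto elim: eventually_mono)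
  have iw: "integrable \<mu> (\<lambda>v. (w k v)\<^sup>2)" for k
  proof (rule integrableI_nonneg)
    interpret K: finite_measure "M k" by (rule M(1))
    have "(\<integral>\<^sup>+ v. ennreal ((w k v)\<^sup>2) \<partial>\<mu>) = emeasure (M k) (space (M k))"
      unfolding Mk[of k] by (subst emeasure_density) (auto cong: nn_integral_cong)
    then show "(\<integral>\<^sup>+ v. ennreal ((w k v)\<^sup>2) \<partial>\<mu>) < \<infinity>" by (simp add: K.emeasure_eq_measure)
  qed auto
  have em: "(\<lambda>v. exp (- (v \<bullet> x))) \<in> borel_measurable \<mu>" for x by (rule exp_inner_measurable) simp
  \<comment> \<open>Choose a bump so close to 0 that x - 2 y stays in \<Omega> for y in its support.
    Then v \<bullet> y is at most v \<bullet> x / 2, so \<open>(w k v)\<^sup>2\<close>, which has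
    the total mass of \<open>M k\<close> as its integral, dominates
    \<open>exp (- (v \<bullet> x))\<close>.\<close>
  have int: "integrable \<mu> (\<lambda>v. exp (- (v \<bullet> x)))" if x: "x \<in> \<Omega>" for x
  proof -
    have "open \<Omega>" using \<Omega> unfolding open_convex_cone_def by blast
    then obtain s where s: "s > 0" "cball x s \<subseteq> \<Omega>" using x open_contains_cball by blast
    obtain k where k: "d k < s / 2"
      using order_tendstoD(2)[OF d0 half_gt_zero[OF s(1)]] unfolding eventually_sequentially by blast
    show ?thesis
    proof (rule Bochner_Integration.integrable_bound[OF iw[of k] em])
      show "AE v in \<mu>. norm (exp (- (v \<bullet> x))) \<le> norm ((w k v)\<^sup>2)"
        using AE
      proof eventually_elim
        case (elim v)
        have "exp (- (v \<bullet> x / 2)) \<le> w k v"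
          unfolding w_def
        proof (rule bump_laplace_ge[OF \<rho>(1)])
          fix y assume "y \<in> supp (\<lambda>x. complex_of_real (\<rho> k x))"
          then have "norm y \<le> d k" using \<rho>(2)[of k] by auto
          then have "x - 2 *\<^sub>R y \<in> \<Omega>" using k by (intro subsetD[OF s(2)]) (simp add: dist_norm)
          then have "0 \<le> v \<bullet> (x - 2 *\<^sub>R y)" using elim by (simp add: dual_points_def)
          then show "v \<bullet> y \<le> v \<bullet> x / 2" by (simp add: inner_diff_right)
        qed
        then have "(exp (- (v \<bullet> x / 2)))\<^sup>2 \<le> (w k v)\<^sup>2" by (intro power_mono) auto
        moreover have "(exp (- (v \<bullet> x / 2)))\<^sup>2 = exp (- (v \<bullet> x))"
          by (simp add: power2_eq_square exp_add[symmetric])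
        ultimately show ?case by simp
      qed
    qed
  qed
  define f where "f x = (LINT v|\<mu>. exp (- (v \<bullet> x)))" for x
  define g where "g k x = (LINT v|M k. exp (- (v \<bullet> x)))" for k x
  have g: "g k x = (LINT v|\<mu>. (w k v)\<^sup>2 * exp (- (v \<bullet> x)))" for k x
    unfolding g_def Mk by (rule integral_real_density) (auto intro: em)
  have w1: "(\<lambda>k. w k v) \<longlonglongrightarrow> 1" for v
  proof (rule LIMSEQ_I)
    fix e :: real assume e: "e > 0"
    have "isCont (\<lambda>y. exp (- (v \<bullet> y))) 0" by (intro continuous_intros)
    then obtain s where s: "s > 0" "\<And>y. dist y 0 < s \<Longrightarrow> dist (exp (- (v \<bullet> y))) (exp (- (v \<bullet> 0))) < e / 2"
      using e unfolding continuous_at_eps_delta by (meson half_gt_zero)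
    obtain N where N: "\<And>k. k \<ge> N \<Longrightarrow> d k < s"
      using order_tendstoD(2)[OF d0 s(1)] unfolding eventually_sequentially by blast
    have "norm (w k v - 1) < e" if k: "k \<ge> N" for k
    proof -
      have "\<bar>w k v - 1\<bar> \<le> e / 2"
        unfolding w_def
      proof (rule bump_laplace_near_1[OF \<rho>(1)])
        fix y assume "y \<in> supp (\<lambda>x. complex_of_real (\<rho> k x))"
        then have "dist y 0 < s" using \<rho>(2)[of k] N[OF k] by auto
        from s(2)[OF this] show "\<bar>exp (- (v \<bullet> y)) - 1\<bar> \<le> e / 2" by (simp add: dist_real_def)
      qed
      then show ?thesis using e by simp
    qed
    then show "\<exists>N. \<forall>k\<ge>N. norm (w k v - 1) < e" by blast
  qed
  have dom: "AE v in \<mu>. norm ((w k v)\<^sup>2 * exp (- (v \<bullet> x))) \<le> exp (- (v \<bullet> x))" for k x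
    using AE
  proof eventually_elim
    case (elim v)
    have "(w k v)\<^sup>2 \<le> 1"
      using bump_laplace_le_1[OF \<rho>(1) elim, of k] w[of k v] unfolding w_def by (intro power_le_one) auto
    then show ?case by (simp add: mult_left_le_one_le)
  qed
  have glim: "(\<lambda>k. g k x) \<longlonglongrightarrow> f x" if x: "x \<in> \<Omega>" for x
    unfolding g f_def
  proof (rule integral_dominated_convergence[where w = "\<lambda>v. exp (- (v \<bullet> x))"])
    show "AE v in \<mu>. (\<lambda>k. (w k v)\<^sup>2 * exp (- (v \<bullet> x))) \<longlonglongrightarrow> exp (- (v \<bullet> x))"
    proof (rule AE_I2)
      fix v
      have "(\<lambda>k. (w k v)\<^sup>2 * exp (- (v \<bullet> x))) \<longlonglongrightarrow> 1\<^sup>2 * exp (- (v \<bullet> x))" by (intro tendsto_intros w1)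
      then show "(\<lambda>k. (w k v)\<^sup>2 * exp (- (v \<bullet> x))) \<longlonglongrightarrow> exp (- (v \<bullet> x))" by simp
    qed
  qed (use int[OF x] em dom in auto)
  have gle: "\<bar>g k x\<bar> \<le> f x" if x: "x \<in> \<Omega>" for k x
  proof -
    have "\<bar>g k x\<bar> \<le> (LINT v|\<mu>. norm ((w k v)\<^sup>2 * exp (- (v \<bullet> x))))"
      unfolding g using integral_norm_bound[of \<mu> "\<lambda>v. (w k v)\<^sup>2 * exp (- (v \<bullet> x))"] by simp
    also have "\<dots> \<le> f x"
      unfolding f_def
    proof (rule integral_mono_AE)
      show "integrable \<mu> (\<lambda>v. norm ((w k v)\<^sup>2 * exp (- (v \<bullet> x))))"
        using dom[of k x] em[of x] by (intro integrable_norm Bochner_Integration.integrable_bound[OF int[OF x]]) auto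
    qed (use int[OF x] dom in auto)
    finally show ?thesis .
  qed
  have fcont: "continuous_on \<Omega> f"
    unfolding f_def using laplace_continuous[OF \<Omega> _ AE int] by (intro continuous_at_imp_continuous_on ballI) simp
  have "integrable lborel (\<lambda>x. cnj (\<psi> x) * complex_of_real (f x)) \<and> D \<psi> = (LINT x|lborel. cnj (\<psi> x) * complex_of_real (f x))"
    if \<psi>: "\<psi> \<in> test_functions \<Omega>" for \<psi>
  proof
    have c\<psi>: "cc \<psi>" by (rule smooth_cc_imp_cc[OF test_functions_smooth_cc[OF \<psi>]])
    have sup: "supp \<psi> \<subseteq> \<Omega>" "compact (supp \<psi>)" using \<psi> by (auto simp: test_functions_def)
    have out: "\<psi> x = 0" if "x \<notin> \<Omega>" for x using not_in_supp[of x \<psi>] sup that by blast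
    show i: "integrable lborel (\<lambda>x. cnj (\<psi> x) * complex_of_real (f x))"
      by (rule continuous_compact_support_integrable[OF sup(2)])
         (auto simp: not_in_supp intro!: continuous_intros cc_continuous[OF c\<psi>] continuous_on_subset[OF fcont sup(1)])
    have cs: "cnj (\<psi> y) * translates D (?h k) y = cnj (\<psi> y) * complex_of_real (g k y)" for k y
      using M(4)[of y k] out[of y] by (cases "y \<in> \<Omega>") (auto simp: g_def)
    have ik: "integrable lborel (\<lambda>y. cnj (\<psi> y) * complex_of_real (g k y))"
      "D (convolution (?h k) \<psi>) = (LINT y|lborel. cnj (\<psi> y) * complex_of_real (g k y))" for k
      using distribution_convolution[OF \<Omega> D bump_sq_test[OF \<rho>(1)[of k]] \<psi>] unfolding cs by auto
    \<comment> \<open>First reading of \<open>D (h * \<psi>)\<close>: \<open>\<psi>\<close> averages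
      the smeared functions \<open>g k\<close>, which converge to f and are dominated by it.\<close>
    have "(\<lambda>k. D (convolution (?h k) \<psi>)) \<longlonglongrightarrow> (LINT x|lborel. cnj (\<psi> x) * complex_of_real (f x))"
      unfolding ik(2)
    proof (rule integral_dominated_convergence[where w = "\<lambda>x. cmod (cnj (\<psi> x) * complex_of_real (f x))"])
      show "AE x in lborel. (\<lambda>k. cnj (\<psi> x) * complex_of_real (g k x)) \<longlonglongrightarrow> cnj (\<psi> x) * complex_of_real (f x)"
      proof (rule AE_I2)
        fix x
        show "(\<lambda>k. cnj (\<psi> x) * complex_of_real (g k x)) \<longlonglongrightarrow> cnj (\<psi> x) * complex_of_real (f x)"
          using out[of x] glim[of x] by (cases "x \<in> \<Omega>") (auto intro!: tendsto_intros)
      qed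
      show "AE x in lborel. cmod (cnj (\<psi> x) * complex_of_real (g k x)) \<le> cmod (cnj (\<psi> x) * complex_of_real (f x))" for k
      proof (rule AE_I2)
        fix x
        show "cmod (cnj (\<psi> x) * complex_of_real (g k x)) \<le> cmod (cnj (\<psi> x) * complex_of_real (f x))"
        proof (cases "x \<in> \<Omega>")
          case True
          then have "\<bar>g k x\<bar> \<le> \<bar>f x\<bar>" using gle[OF True, of k] by simp
          then show ?thesis by (simp add: norm_mult mult_left_mono)
        qed (simp add: out)
      qed
    qed (use i ik in \<open>auto intro: borel_measurable_integrable\<close>)
    \<comment> \<open>Second reading: the square of the bump averages the translates of
      \<open>\<psi>\<close>, which are continuous under \<open>D\<close> at 0.\<close>
    moreover have "(\<lambda>k. D (convolution (?h k) \<psi>)) \<longlonglongrightarrow> D \<psi>"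
    proof (rule LIMSEQ_I)
      fix e :: real assume e: "e > 0"
      have "isCont (translates D \<psi>) 0" by (rule translates_continuous[OF \<Omega> D \<psi>]) simp
      then obtain s where s: "s > 0" "\<And>y. dist y 0 < s \<Longrightarrow> dist (translates D \<psi> y) (translates D \<psi> 0) < e / 2"
        using e unfolding continuous_at_eps_delta by (meson half_gt_zero)
      obtain N where N: "\<And>k. k \<ge> N \<Longrightarrow> d k < s / 2"
        using order_tendstoD(2)[OF d0 half_gt_zero[OF s(1)]] unfolding eventually_sequentially by blast
      have "norm (D (convolution (?h k) \<psi>) - D \<psi>) < e" if k: "k \<ge> N" for k
      proof -
        have hk: "cc (?h k)" by (rule cc_bump_sq[OF \<rho>(1)])
        have eq: "cnj (?h k y) * translates D \<psi> y = bump_sq (\<rho> k) y *\<^sub>R translates D \<psi> y" for y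
          by (simp add: scaleR_conv_of_real)
        have supk: "supp (?h k) \<subseteq> ball 0 s"
        proof
          fix z assume "z \<in> supp (?h k)"
          then obtain x y where "z = x + y" "norm x \<le> d k" "norm y \<le> d k"
            using bump_sq_supp[OF \<rho>(1), of k] \<rho>(2)[of k] by fastforce
          then have "norm z \<le> d k + d k" by (simp only: norm_triangle_mono)
          then show "z \<in> ball 0 s" using N[OF k] by simp
        qed
        have "norm ((LINT y|lborel. bump_sq (\<rho> k) y *\<^sub>R translates D \<psi> y) - translates D \<psi> 0) \<le> e / 2"
        proof (rule bump_average[of _ "ball 0 s"])
          show "0 \<le> bump_sq (\<rho> k) x" for x by (rule bump_sq(2)[OF \<rho>(1)])
          show "(LINT x|lborel. bump_sq (\<rho> k) x) = 1" by (rule bump_sq_integral[OF \<rho>(1)])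
          show "integrable lborel (bump_sq (\<rho> k))" using cc_integrable[OF hk] by (simp only: complex_of_real_integrable_eq)
          show "bump_sq (\<rho> k) x = 0" if "x \<notin> ball 0 s" for x
          proof -
            have "x \<notin> supp (?h k)" using supk that by blast
            from not_in_supp[OF this] show ?thesis by simp
          qed
          show "integrable lborel (\<lambda>y. bump_sq (\<rho> k) y *\<^sub>R translates D \<psi> y)"
            using distribution_convolution(1)[OF \<Omega> D \<psi> bump_sq_test[OF \<rho>(1)[of k]]] unfolding eq .
          show "norm (translates D \<psi> x - translates D \<psi> 0) \<le> e / 2" if "x \<in> ball 0 s" for x
            using s(2)[of x] that by (simp add: dist_norm)
        qed
        moreover have "D (convolution (?h k) \<psi>) = (LINT y|lborel. bump_sq (\<rho> k) y *\<^sub>R translates D \<psi> y)"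
          unfolding convolution_commute[OF hk c\<psi>]
            distribution_convolution(2)[OF \<Omega> D \<psi> bump_sq_test[OF \<rho>(1)[of k]]] eq ..
        ultimately show ?thesis using e by (simp add: translates_def)
      qed
      then show "\<exists>N. \<forall>k\<ge>N. norm (D (convolution (?h k) \<psi>) - D \<psi>) < e" by blast
    qed
    ultimately show "D \<psi> = (LINT x|lborel. cnj (\<psi> x) * complex_of_real (f x))"
      using LIMSEQ_unique by blast
  qed
  then show thesis using that[of \<mu>] AE int unfolding f_def by simp
qed

end

section \<open>Radon measures on the dual cone\<close>

text \<open>The Riesz vector of a functional. With \<open>blinfun_inner_right\<close> as its inverse
  it is a homeomorphism that takes \<open>dual_cone \<Omega>\<close> to
  \<open>dual_points \<Omega>\<close>.\<close>

definition dual_vector :: "('a::euclidean_space \<Rightarrow>\<^sub>L real) \<Rightarrow> 'a" where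
  "dual_vector \<alpha> = (\<Sum>b\<in>Basis. blinfun_apply \<alpha> b *\<^sub>R b)"

lemma dual_vector_inner: "dual_vector \<alpha> \<bullet> x = blinfun_apply \<alpha> x"
proof -
  have "blinfun_apply \<alpha> x = blinfun_apply \<alpha> (\<Sum>b\<in>Basis. (x \<bullet> b) *\<^sub>R b)"
    by (simp add: euclidean_representation)
  also have "\<dots> = (\<Sum>b\<in>Basis. (x \<bullet> b) * blinfun_apply \<alpha> b)"
    by (simp add: blinfun.sum_right blinfun.scaleR_right)
  finally show ?thesis
    by (simp add: dual_vector_def inner_sum_left inner_commute[of x] mult.commute)
qed

lemma dual_vector_inverse: "blinfun_inner_right (dual_vector \<alpha>) = \<alpha>"
  by (rule blinfun_eqI) (simp add: dual_vector_inner)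

lemma dual_vector_blinfun_inner_right: "dual_vector (blinfun_inner_right v) = v"
  by (simp add: dual_vector_def euclidean_representation)

lemma continuous_on_dual_vector: "continuous_on S dual_vector"
  unfolding dual_vector_def by (intro continuous_intros)

lemma continuous_on_blinfun_inner_right: "continuous_on S blinfun_inner_right"
  by (rule linear_continuous_on[OF bounded_linear_blinfun_inner_right])

lemma dual_cone_iff: "\<alpha> \<in> dual_cone \<Omega> \<longleftrightarrow> dual_vector \<alpha> \<in> dual_points \<Omega>"
  by (simp add: dual_cone_def dual_points_def dual_vector_inner)

lemma closed_dual_cone: "closed (dual_cone \<Omega>)"
proof -
  have "dual_cone \<Omega> = dual_vector -` dual_points \<Omega>" by (auto simp: dual_cone_iff)
  then show ?thesis
    using closed_vimage[OF closed_dual_points continuous_on_dual_vector] by metis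
qed

lemma radon_measure_on_space:
  assumes "sets \<nu> = sets (restrict_space borel (dual_cone \<Omega>))" shows "space \<nu> = dual_cone \<Omega>"
  using sets_eq_imp_space_eq[OF assms] by (simp add: space_restrict_space)

lemma dual_vector_measurable:
  assumes "sets \<nu> = sets (restrict_space borel (dual_cone \<Omega>))"
  shows "dual_vector \<in> borel_measurable \<nu>"
proof -
  have "dual_vector \<in> borel_measurable (restrict_space borel (dual_cone \<Omega>))"
    by (intro measurable_restrict_space1 borel_measurable_continuous_onI continuous_on_dual_vector)
  then show ?thesis using measurable_cong_sets[OF assms refl] by blast
qed

text \<open>The images under \<open>dual_vector\<close> agree by \<open>laplace_unique\<close>. As
  the map is injective with a continuous inverse, every measurable set is the preimage of a Borel
  set, so the images determine the measures.\<close>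

lemma dual_cone_measure_unique:
  fixes \<mu> \<nu> :: "('a::euclidean_space \<Rightarrow>\<^sub>L real) measure"
  assumes \<Omega>: "open_convex_cone \<Omega>"
    and \<mu>: "sets \<mu> = sets (restrict_space borel (dual_cone \<Omega>))"
      "\<And>x. x \<in> \<Omega> \<Longrightarrow> integrable \<mu> (\<lambda>\<alpha>. exp (- blinfun_apply \<alpha> x))"
    and \<nu>: "sets \<nu> = sets (restrict_space borel (dual_cone \<Omega>))"
      "\<And>x. x \<in> \<Omega> \<Longrightarrow> integrable \<nu> (\<lambda>\<alpha>. exp (- blinfun_apply \<alpha> x))"
    and eq: "\<And>x. x \<in> \<Omega> \<Longrightarrow> (LINT \<alpha>|\<mu>. exp (- blinfun_apply \<alpha> x)) = (LINT \<alpha>|\<nu>. exp (- blinfun_apply \<alpha> x))"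
  shows "\<mu> = \<nu>"
proof -
  have meas: "(\<lambda>v::'a. exp (- (v \<bullet> x))) \<in> borel_measurable borel" for x
    by (intro borel_measurable_continuous_onI continuous_intros)
  have pull: "sets (distr \<kappa> borel dual_vector) = sets borel"
    "AE v in distr \<kappa> borel dual_vector. v \<in> dual_points \<Omega>"
    "integrable (distr \<kappa> borel dual_vector) (\<lambda>v. exp (- (v \<bullet> x))) \<longleftrightarrow> integrable \<kappa> (\<lambda>\<alpha>. exp (- blinfun_apply \<alpha> x))"
    "(LINT v|distr \<kappa> borel dual_vector. exp (- (v \<bullet> x))) = (LINT \<alpha>|\<kappa>. exp (- blinfun_apply \<alpha> x))"
    if k: "sets \<kappa> = sets (restrict_space borel (dual_cone \<Omega>))" for \<kappa> x
  proof -
    note m = dual_vector_measurable[OF k]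
    show "sets (distr \<kappa> borel dual_vector) = sets borel" by simp
    show "AE v in distr \<kappa> borel dual_vector. v \<in> dual_points \<Omega>"
      using closed_dual_points[of \<Omega>] radon_measure_on_space[OF k]
      by (subst AE_distr_iff[OF m]) (auto simp: dual_cone_iff intro: borel_closed intro!: AE_I2)
    show "integrable (distr \<kappa> borel dual_vector) (\<lambda>v. exp (- (v \<bullet> x))) \<longleftrightarrow> integrable \<kappa> (\<lambda>\<alpha>. exp (- blinfun_apply \<alpha> x))"
      by (subst integrable_distr_eq[OF m meas]) (simp add: dual_vector_inner)
    show "(LINT v|distr \<kappa> borel dual_vector. exp (- (v \<bullet> x))) = (LINT \<alpha>|\<kappa>. exp (- blinfun_apply \<alpha> x))"
      by (subst integral_distr[OF m meas]) (simp add: dual_vector_inner)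
  qed
  have "distr \<mu> borel dual_vector = distr \<nu> borel dual_vector"
    by (rule laplace_unique[OF \<Omega> pull(1,2)[OF \<mu>(1)] pull(1,2)[OF \<nu>(1)]])
       (simp_all add: pull(3,4)[OF \<mu>(1)] pull(3,4)[OF \<nu>(1)] \<mu>(2) \<nu>(2) eq)
  note distr_eq = this
  have pullback: "emeasure \<kappa> B = emeasure (distr \<kappa> borel dual_vector) (blinfun_inner_right -` B)"
    if k: "sets \<kappa> = sets (restrict_space borel (dual_cone \<Omega>))" and B: "B \<in> sets \<kappa>" for \<kappa> B
  proof -
    have Bb: "B \<in> sets borel" "B \<subseteq> dual_cone \<Omega>"
      using B closed_dual_cone[of \<Omega>] unfolding k by (auto simp: sets_restrict_space_iff borel_closed)
    have "blinfun_inner_right -` B \<in> sets borel"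
      using measurable_sets[OF borel_measurable_continuous_onI[OF continuous_on_blinfun_inner_right] Bb(1)] by simp
    then have "emeasure (distr \<kappa> borel dual_vector) (blinfun_inner_right -` B)
        = emeasure \<kappa> (dual_vector -` (blinfun_inner_right -` B) \<inter> space \<kappa>)"
      by (intro emeasure_distr dual_vector_measurable[OF k])
    also have "dual_vector -` (blinfun_inner_right -` B) \<inter> space \<kappa> = B"
      using Bb(2) radon_measure_on_space[OF k] by (auto simp: dual_vector_inverse)
    finally show ?thesis ..
  qed
  show ?thesis
  proof (rule measure_eqI)
    show "sets \<mu> = sets \<nu>" using \<mu>(1) \<nu>(1) by simp
    fix B assume "B \<in> sets \<mu>"
    then show "emeasure \<mu> B = emeasure \<nu> B"
      using pullback[OF \<mu>(1)] pullback[OF \<nu>(1)] distr_eq \<mu>(1) \<nu>(1) by simp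
  qed
qed

section \<open>Inner regularity and transport to the dual cone\<close>

lemma laplace_finite_on_compact:
  fixes M :: "'a::euclidean_space measure"
  assumes M: "sets M = sets borel" and x: "integrable M (\<lambda>v. exp (- (v \<bullet> x)))" and K: "compact K"
  shows "emeasure M K < \<infinity>"
proof -
  have "compact ((\<lambda>v. v \<bullet> x) ` K)" using K by (intro compact_continuous_image continuous_intros)
  \<comment> \<open>On \<open>K\<close> the exponential is at least \<open>exp (- B)\<close>, so its
    integral controls the mass of \<open>K\<close>.\<close>
  then obtain B where B: "\<And>v. v \<in> K \<Longrightarrow> v \<bullet> x \<le> B"
    using compact_imp_bounded bounded_iff by (metis abs_le_D1 image_eqI real_norm_def)
  have Km: "K \<in> sets M" using K M by (simp add: compact_imp_closed borel_closed)
  have "emeasure M K = (\<integral>\<^sup>+ v. indicator K v \<partial>M)" using Km by simp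
  also have "\<dots> \<le> (\<integral>\<^sup>+ v. ennreal (exp B * exp (- (v \<bullet> x))) \<partial>M)"
  proof (rule nn_integral_mono)
    fix v
    show "indicator K v \<le> ennreal (exp B * exp (- (v \<bullet> x)))"
    proof (cases "v \<in> K")
      case True
      then have "1 \<le> exp B * exp (- (v \<bullet> x))" using B[OF True] by (simp add: exp_add[symmetric])
      then show ?thesis using True by simp
    qed simp
  qed
  also have "\<dots> < \<infinity>"
    using x by (subst nn_integral_eq_integral) auto
  finally show ?thesis .
qed

text \<open>The restriction to a closed ball is finite, hence inner regular, and the balls exhaust
  the space.\<close>

lemma inner_regular_locally_finite:
  fixes M :: "'a::euclidean_space measure"
  assumes M: "sets M = sets borel" and fin: "\<And>K. compact K \<Longrightarrow> emeasure M K < \<infinity>" and B: "B \<in> sets borel"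
  shows "emeasure M B = (SUP K\<in>{K. compact K \<and> K \<subseteq> B}. emeasure M K)"
proof (rule antisym)
  have Bm: "B \<in> sets M" using B M by simp
  have inc: "emeasure M B = (SUP n. emeasure M (B \<inter> cball 0 (real n)))"
  proof -
    have "x \<in> (\<Union>n. B \<inter> cball 0 (real n))" if x: "x \<in> B" for x
    proof -
      obtain n where "norm x \<le> real n" using real_arch_simple by blast
      then show ?thesis using x by (intro UN_I[of n]) auto
    qed
    then have U: "(\<Union>n. B \<inter> cball 0 (real n)) = B" by (intro equalityI subsetI) auto
    have inc: "incseq (\<lambda>n. B \<inter> cball 0 (real n))"
    proof (rule monoI)
      fix m n :: nat assume "m \<le> n"
      then have "cball (0::'a) (real m) \<subseteq> cball 0 (real n)" by (intro subset_cball) simp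
      then show "B \<inter> cball 0 (real m) \<subseteq> B \<inter> cball 0 (real n)" by (rule Int_mono[OF order_refl])
    qed
    have rg: "range (\<lambda>n. B \<inter> cball 0 (real n)) \<subseteq> sets M"
      unfolding M by (rule image_subsetI) (rule sets.Int[OF B borel_closed[OF closed_cball]])
    have "(SUP n. emeasure M (B \<inter> cball 0 (real n))) = emeasure M (\<Union>n. B \<inter> cball 0 (real n))"
      by (rule SUP_emeasure_incseq[OF rg inc])
    then show ?thesis unfolding U ..
  qed
  show "emeasure M B \<le> (SUP K\<in>{K. compact K \<and> K \<subseteq> B}. emeasure M K)"
    unfolding inc
  proof (rule SUP_least)
    fix n
    let ?C = "cball (0::'a) (real n)"
    let ?N = "density M (indicator ?C)"
    have C: "?C \<in> sets M" using M by simp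
    have N: "emeasure ?N A = emeasure M (A \<inter> ?C)" if "A \<in> sets borel" for A
      using emeasure_restricted[OF C, of A] that M by (simp add: Int_commute)
    have "emeasure ?N B = (SUP K\<in>{K. K \<subseteq> B \<and> compact K}. emeasure ?N K)"
    proof (rule inner_regular)
      show "sets ?N = sets borel" using M by simp
      show "emeasure ?N (space ?N) \<noteq> \<infinity>"
        using N[of UNIV] fin[of ?C] sets_eq_imp_space_eq[OF M] by simp
      show "B \<in> sets borel" by (rule B)
    qed
    also have "\<dots> \<le> (SUP K\<in>{K. compact K \<and> K \<subseteq> B}. emeasure M K)"
    proof (rule SUP_least)
      fix K assume "K \<in> {K. K \<subseteq> B \<and> compact K}"
      then have K: "K \<subseteq> B" "compact K" by auto
      then have "emeasure ?N K = emeasure M (K \<inter> ?C)" by (intro N) (simp add: compact_imp_closed borel_closed)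
      also have "\<dots> \<le> (SUP K\<in>{K. compact K \<and> K \<subseteq> B}. emeasure M K)"
        using K by (intro SUP_upper) (auto intro: compact_Int)
      finally show "emeasure ?N K \<le> (SUP K\<in>{K. compact K \<and> K \<subseteq> B}. emeasure M K)" .
    qed
    finally show "emeasure M (B \<inter> ?C) \<le> (SUP K\<in>{K. compact K \<and> K \<subseteq> B}. emeasure M K)"
      using N[OF B] by simp
  qed
  show "(SUP K\<in>{K. compact K \<and> K \<subseteq> B}. emeasure M K) \<le> emeasure M B"
    using Bm by (intro SUP_least emeasure_mono) auto
qed

text \<open>The image of \<open>M\<close> under the Riesz isomorphism, restricted to the dual cone;
  the restriction loses only a null set, since \<open>M\<close> is carried by
  \<open>dual_points \<Omega>\<close>. Compact sets correspond in both directions, which transfers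
  local finiteness and inner regularity.\<close>

lemma dual_cone_radon_measure:
  fixes M :: "'a::euclidean_space measure"
  assumes \<Omega>: "open_convex_cone \<Omega>" and M: "sets M = sets borel" "AE v in M. v \<in> dual_points \<Omega>"
    and int: "\<And>x. x \<in> \<Omega> \<Longrightarrow> integrable M (\<lambda>v. exp (- (v \<bullet> x)))"
  obtains \<mu> where "radon_measure_on (dual_cone \<Omega>) \<mu>"
    "\<And>x. x \<in> \<Omega> \<Longrightarrow> integrable \<mu> (\<lambda>\<alpha>. exp (- blinfun_apply \<alpha> x))"
    "\<And>x. x \<in> \<Omega> \<Longrightarrow> (LINT \<alpha>|\<mu>. exp (- blinfun_apply \<alpha> x)) = (LINT v|M. exp (- (v \<bullet> x)))"
proof -
  let ?J = "blinfun_inner_right :: 'a \<Rightarrow> 'a \<Rightarrow>\<^sub>L real"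
  obtain x0 where x0: "x0 \<in> \<Omega>" using \<Omega> unfolding open_convex_cone_def by blast
  have Jm: "?J \<in> borel_measurable M"
    using borel_measurable_continuous_onI[OF continuous_on_blinfun_inner_right] measurable_cong_sets[OF M(1) refl] by blast
  have dc: "dual_cone \<Omega> \<in> sets borel" using closed_dual_cone by (rule borel_closed)
  define \<mu> where "\<mu> = restrict_space (distr M borel ?J) (dual_cone \<Omega>)"
  have s\<mu>: "sets \<mu> = sets (restrict_space borel (dual_cone \<Omega>))"
    unfolding \<mu>_def by (intro sets_restrict_space_cong) simp
  have em: "emeasure \<mu> B = emeasure M (?J -` B)" if "B \<in> sets borel" "B \<subseteq> dual_cone \<Omega>" for B
    unfolding \<mu>_def using that dc Jm sets_eq_imp_space_eq[OF M(1)]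
    by (subst emeasure_restrict_space) (auto simp: emeasure_distr)
  have Jc: "compact (?J -` K)" if "compact K" for K
  proof -
    have "?J -` K = dual_vector ` K"
      by (auto simp: dual_vector_inverse) (metis dual_vector_blinfun_inner_right image_eqI)
    then show ?thesis using that by (simp add: compact_continuous_image continuous_on_dual_vector)
  qed
  have fin: "emeasure M K < \<infinity>" if "compact K" for K
    by (rule laplace_finite_on_compact[OF M(1) int[OF x0] that])
  have "radon_measure_on (dual_cone \<Omega>) \<mu>"
    unfolding radon_measure_on_def
  proof (intro conjI allI impI ballI s\<mu>)
    fix K assume "compact K \<and> K \<subseteq> dual_cone \<Omega>"
    then show "emeasure \<mu> K < \<infinity>"
      using em[of K] fin[OF Jc[of K]] by (simp add: compact_imp_closed borel_closed)
  next
    fix B assume B': "B \<in> sets \<mu>"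
    then have B: "B \<in> sets borel" "B \<subseteq> dual_cone \<Omega>"
      using dc unfolding s\<mu> by (auto simp: sets_restrict_space_iff)
    have JB: "?J -` B \<in> sets borel"
      using measurable_sets[OF borel_measurable_continuous_onI[OF continuous_on_blinfun_inner_right] B(1)] by simp
    have "emeasure \<mu> B = (SUP K\<in>{K. compact K \<and> K \<subseteq> ?J -` B}. emeasure M K)"
      unfolding em[OF B] by (rule inner_regular_locally_finite[OF M(1) fin JB])
    also have "\<dots> \<le> (SUP K\<in>{K. compact K \<and> K \<subseteq> B}. emeasure \<mu> K)"
    proof (rule SUP_least)
      fix K assume "K \<in> {K. compact K \<and> K \<subseteq> ?J -` B}"
      then have K: "compact K" "?J ` K \<subseteq> B" by auto
      have cJ: "compact (?J ` K)"
        by (rule compact_continuous_image[OF continuous_on_blinfun_inner_right K(1)])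
      have "?J -` ?J ` K = K" by (auto simp: image_iff) (metis dual_vector_blinfun_inner_right)
      then have "emeasure M K = emeasure \<mu> (?J ` K)"
        using em[of "?J ` K"] cJ K(2) B(2) by (simp add: compact_imp_closed borel_closed)
      also have "\<dots> \<le> (SUP K\<in>{K. compact K \<and> K \<subseteq> B}. emeasure \<mu> K)"
        using cJ K(2) by (intro SUP_upper) auto
      finally show "emeasure M K \<le> (SUP K\<in>{K. compact K \<and> K \<subseteq> B}. emeasure \<mu> K)" .
    qed
    finally have "emeasure \<mu> B \<le> (SUP K\<in>{K. compact K \<and> K \<subseteq> B}. emeasure \<mu> K)" .
    moreover have "(SUP K\<in>{K. compact K \<and> K \<subseteq> B}. emeasure \<mu> K) \<le> emeasure \<mu> B"
      using B' by (intro SUP_least emeasure_mono) auto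
    ultimately show "emeasure \<mu> B = (SUP K\<in>{K. compact K \<and> K \<subseteq> B}. emeasure \<mu> K)" by (rule antisym)
  qed
  moreover have "integrable \<mu> (\<lambda>\<alpha>. exp (- blinfun_apply \<alpha> x)) \<and>
      (LINT \<alpha>|\<mu>. exp (- blinfun_apply \<alpha> x)) = (LINT v|M. exp (- (v \<bullet> x)))" if x: "x \<in> \<Omega>" for x
  proof -
    let ?e = "\<lambda>\<alpha> :: 'a \<Rightarrow>\<^sub>L real. exp (- blinfun_apply \<alpha> x)"
    have eb: "?e \<in> borel_measurable borel"
      by (intro borel_measurable_continuous_onI continuous_intros)
    have ib: "(\<lambda>\<alpha>. indicator (dual_cone \<Omega>) \<alpha> *\<^sub>R ?e \<alpha>) \<in> borel_measurable borel"
      using eb dc by measurable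
    have AE: "AE v in M. exp (- (v \<bullet> x)) = indicator (dual_cone \<Omega>) (?J v) *\<^sub>R ?e (?J v)"
      using M(2) by eventually_elim (simp add: dual_cone_iff dual_vector_blinfun_inner_right)
    have mM: "(\<lambda>v. indicator (dual_cone \<Omega>) (?J v) *\<^sub>R ?e (?J v)) \<in> borel_measurable M"
      using measurable_compose[OF Jm ib] .
    have dcs: "dual_cone \<Omega> \<inter> space (distr M borel ?J) \<in> sets (distr M borel ?J)" using dc by simp
    have "integrable M (\<lambda>v. indicator (dual_cone \<Omega>) (?J v) *\<^sub>R ?e (?J v))"
      using integrable_cong_AE[OF exp_inner_measurable[OF M(1)] mM AE] int[OF x] by simp
    then have 1: "integrable \<mu> ?e"
      unfolding \<mu>_def integrable_restrict_space[OF dcs] integrable_distr_eq[OF Jm ib] .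
    have "(LINT \<alpha>|\<mu>. ?e \<alpha>) = (LINT v|M. indicator (dual_cone \<Omega>) (?J v) *\<^sub>R ?e (?J v))"
      unfolding \<mu>_def integral_restrict_space[OF dcs] by (rule integral_distr[OF Jm ib])
    also have "\<dots> = (LINT v|M. exp (- (v \<bullet> x)))"
      by (rule integral_cong_AE[OF mM exp_inner_measurable[OF M(1)]]) (use AE in \<open>auto elim: eventually_mono\<close>)
    finally show ?thesis using 1 by blast
  qed
  ultimately show thesis using that by blast
qed

theorem theorem4p13:
  fixes \<tau> :: "'a::euclidean_space \<Rightarrow> 'a"
    and \<Omega> :: "'a set"
    and D :: "('a \<Rightarrow> complex) \<Rightarrow> complex"
  assumes "\<tau> = (\<lambda>x. - x)"
    and "open_convex_cone \<Omega>"
    and "\<not> contains_affine_line \<Omega>"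
    and "distribution \<Omega> D"
    and "positive_definite \<tau> \<Omega> D"
    and "one_bounded \<tau> \<Omega> D"
  shows "\<exists>f. real_analytic_on f \<Omega> \<and> represented_by \<Omega> D f \<and>
    (\<exists>!\<mu>. radon_measure_on (dual_cone \<Omega>) \<mu> \<and>
      (\<forall>x\<in>\<Omega>. integrable \<mu> (\<lambda>\<alpha>. exp (- blinfun_apply \<alpha> x)) \<and>
        f x = complex_of_real (LINT \<alpha>|\<mu>. exp (- blinfun_apply \<alpha> x))))"
proof -
  interpret one_bounded_distribution \<tau> \<Omega> D by unfold_locales (fact assms)+
  obtain M where M: "sets M = sets borel" "AE v in M. v \<in> dual_points \<Omega>"
    "\<And>x. x \<in> \<Omega> \<Longrightarrow> integrable M (\<lambda>v. exp (- (v \<bullet> x)))"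
    and rep: "\<And>\<psi>. \<psi> \<in> test_functions \<Omega> \<Longrightarrow> integrable lborel (\<lambda>x. cnj (\<psi> x) * complex_of_real (LINT v|M. exp (- (v \<bullet> x))))
      \<and> D \<psi> = (LINT x|lborel. cnj (\<psi> x) * complex_of_real (LINT v|M. exp (- (v \<bullet> x))))"
    by (rule laplace_representation) (rule that)
  obtain \<mu> where \<mu>: "radon_measure_on (dual_cone \<Omega>) \<mu>"
    "\<And>x. x \<in> \<Omega> \<Longrightarrow> integrable \<mu> (\<lambda>\<alpha>. exp (- blinfun_apply \<alpha> x))"
    "\<And>x. x \<in> \<Omega> \<Longrightarrow> (LINT \<alpha>|\<mu>. exp (- blinfun_apply \<alpha> x)) = (LINT v|M. exp (- (v \<bullet> x)))"
    by (rule dual_cone_radon_measure[OF \<Omega> M], assumption) (rule that)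
  \<comment> \<open>Off \<Omega> the integral may diverge and then has the default value 0; test
    functions vanish there.\<close>
  define f where "f x = complex_of_real (LINT v|M. exp (- (v \<bullet> x)))" for x
  have "real_analytic_on f \<Omega>"
    unfolding f_def by (rule laplace_real_analytic[OF \<Omega> M(1,3)])
  moreover have "represented_by \<Omega> D f"
    unfolding represented_by_def set_integrable_def set_lebesgue_integral_def
  proof
    fix \<psi> assume \<psi>: "\<psi> \<in> test_functions \<Omega>"
    have "\<psi> x = 0" if "x \<notin> \<Omega>" for x
      using not_in_supp[of x \<psi>] \<psi> that by (auto simp: test_functions_def)
    then have "indicator \<Omega> x *\<^sub>R (cnj (\<psi> x) * f x) = cnj (\<psi> x) * f x" for x
      by (cases "x \<in> \<Omega>") auto
    then show "integrable lborel (\<lambda>x. indicator \<Omega> x *\<^sub>R (cnj (\<psi> x) * f x)) \<and>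
        D \<psi> = (LINT x|lborel. indicator \<Omega> x *\<^sub>R (cnj (\<psi> x) * f x))"
      using rep[OF \<psi>] by (simp add: f_def)
  qed
  moreover have "\<exists>!\<mu>. radon_measure_on (dual_cone \<Omega>) \<mu> \<and>
      (\<forall>x\<in>\<Omega>. integrable \<mu> (\<lambda>\<alpha>. exp (- blinfun_apply \<alpha> x)) \<and>
        f x = complex_of_real (LINT \<alpha>|\<mu>. exp (- blinfun_apply \<alpha> x)))"
  proof (rule ex1I[of _ \<mu>])
    show "radon_measure_on (dual_cone \<Omega>) \<mu> \<and>
      (\<forall>x\<in>\<Omega>. integrable \<mu> (\<lambda>\<alpha>. exp (- blinfun_apply \<alpha> x)) \<and>
        f x = complex_of_real (LINT \<alpha>|\<mu>. exp (- blinfun_apply \<alpha> x)))"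
      using \<mu> by (simp add: f_def)
    fix \<nu> assume \<nu>: "radon_measure_on (dual_cone \<Omega>) \<nu> \<and>
      (\<forall>x\<in>\<Omega>. integrable \<nu> (\<lambda>\<alpha>. exp (- blinfun_apply \<alpha> x)) \<and>
        f x = complex_of_real (LINT \<alpha>|\<nu>. exp (- blinfun_apply \<alpha> x)))"
    show "\<nu> = \<mu>"
    proof (rule dual_cone_measure_unique[OF \<Omega>])
      show "sets \<nu> = sets (restrict_space borel (dual_cone \<Omega>))"
        "sets \<mu> = sets (restrict_space borel (dual_cone \<Omega>))"
        using \<nu> \<mu>(1) by (auto simp: radon_measure_on_def)
      fix x assume x: "x \<in> \<Omega>"
      show "integrable \<nu> (\<lambda>\<alpha>. exp (- blinfun_apply \<alpha> x))" using \<nu> x by blast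
      show "integrable \<mu> (\<lambda>\<alpha>. exp (- blinfun_apply \<alpha> x))" by (rule \<mu>(2)[OF x])
      have "f x = complex_of_real (LINT \<alpha>|\<nu>. exp (- blinfun_apply \<alpha> x))" using \<nu> x by blast
      then show "(LINT \<alpha>|\<nu>. exp (- blinfun_apply \<alpha> x)) = (LINT \<alpha>|\<mu>. exp (- blinfun_apply \<alpha> x))"
        using \<mu>(3)[OF x] by (simp add: f_def)
    qed
  qed
  ultimately show ?thesis by blast
qed

end
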